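(* Let $G$ be an amenable graph, $A_i$ an anisotropic component of $C(G)$ with root $R_i$, $G_i=G[\bigcup_{X\in A_i}X]$, and let $J_i$ be the jellyfish graph obtained from $G_i$ by the modifications (M1), (M2), (M3), with head $H=J_i[R_i]$, and let $L_v$ be one of its legs. Then $D(J_i,\mathcal{P}_G)=\min\{c: D((L_v,\mathcal{P}_G),c)\ge d^*\}$, where $d^*=D(H)$.
   Context: Color refinement on a graph $K$: start with $\mathcal{P}_0=\{V(K)\}$; given $\mathcal{P}_{i-1}$, two vertices lie in the same cell of $\mathcal{P}_i$ iff they lie in the same cell of $\mathcal{P}_{i-1}$ and have the same number of neighbors in every cell of $\mathcal{P}_{i-1}$; stop when stable; for $K=G$ the result is the stable partition $\mathcal{P}_G$. $G$ is amenable if, for every graph $H'$, running color refinement on $G\cup H'$ and declaring $G\cong H'$ iff each final cell contains equally many vertices of $G$ and $H'$ gives the correct answer. The cell graph $C(G)$ is the complete graph on $\mathcal{P}_G$. A cell $X$ is homogeneous if $G[X]$ is empty or complete, heterogeneous otherwise. A pair of distinct cells $X,Y$ is isotropic if the bipartite graph $G[X,Y]$ between them is empty or complete bipartite, anisotropic otherwise; anisotropic components are the connected components of the graph on $\mathcal{P}_G$ formed by the anisotropic pairs. For amenable $G$ each anisotropic component is a tree with at most one heterogeneous cell. The root $R_i$ of $A_i$ is its heterogeneous cell if one exists, otherwise a cell of least cardinality in $A_i$. Modifications applied to $G_i$: (M1) if $G_i[R_i]$ is a matching graph $rK_2$ ($r\ge 2$) or empty, replace it by its complement; (M2) for every other cell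 $X$ of $A_i$, if $G_i[X]$ is complete, replace it by its complement; (M3) for each pair of distinct cells $X,Y$ of $A_i$: if $XY$ is isotropic and $G_i[X,Y]$ is complete bipartite, replace it by the empty bipartite graph; if $XY$ is anisotropic and $G_i[X,Y]$ is the bipartite complement of a star forest $sK_{1,t}$, replace it by $sK_{1,t}$. The result $J_i$ is a jellyfish graph: its head is $H=J_i[R_i]$ and for each $v\in R_i$ the leg $L_v$ is the tree rooted at $v$ formed by $v$ and its descendants (in $J_i$, each vertex in a non-root cell $Y$ has a unique neighbor in the parent cell of $Y$ in $A_i$, its parent); legs are pairwise vertex-disjoint. For a graph $F$ with $V(F)\subseteq V(G)$, $Aut(F,\mathcal{P}_G)$ is the set of automorphisms of $F$ mapping each vertex into its own cell of $\mathcal{P}_G$; a labeling of $F$ is $\mathcal{P}_G$-distinguishing if the only label-preserving element of $Aut(F,\mathcal{P}_G)$ is the identity; $D(F,\mathcal{P}_G)$ is the fewest colors of such a labeling. Two $\mathcal{P}_G$-distinguishing labelings $\phi,\phi'$ of $F$ are equivalent if $\phi(v)=\phi'(\pi(v))$ for all $v$ for some $\pi\in Aut(F,\mathcal{P}_G)$; $D((F,\mathcal{P}_G),c)$ is the number of pairwise inequivalent $\mathcal{P}_G$-distinguishing labelings of $F$ using at most $c$ colors. $D(H)$ is the ordinary distinguishing number of $H$ (fewest colors in a labeling whose only label-preserving automorphism is the identity). *)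

theory Defs
  imports
    "Graph_Theory.Graph_Theory"
    "HOL-Library.FuncSet"
    "HOL-Combinatorics.Permutations"
begin

text \<open>
  A finite simple graph is a loop-free symmetric digraph without parallel arcs
  (locale \<^locale>\<open>pair_graph\<close>): an undirected edge is a pair of opposite arcs.
\<close>

definition induced :: "'a pair_pre_digraph \<Rightarrow> 'a set \<Rightarrow> 'a pair_pre_digraph" where
  "induced K S = \<lparr>pverts = S, parcs = parcs K \<inter> S \<times> S\<rparr>"

definition disjoint_union ::
    "'a pair_pre_digraph \<Rightarrow> 'b pair_pre_digraph \<Rightarrow> ('a + 'b) pair_pre_digraph" where
  "disjoint_union K L =
     \<lparr>pverts = pverts K <+> pverts L,
      parcs = map_prod Inl Inl ` parcs K \<union> map_prod Inr Inr ` parcs L\<rparr>"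


subsection \<open>Color refinement and amenability\<close>

definition refine :: "'a pair_pre_digraph \<Rightarrow> 'a set set \<Rightarrow> 'a set set" where
  "refine K P = pverts K //
     {(u, v). (\<exists>X\<in>P. u \<in> X \<and> v \<in> X) \<and>
              (\<forall>C\<in>P. card {w \<in> C. (u, w) \<in> parcs K} = card {w \<in> C. (v, w) \<in> parcs K})}"

definition color_refinement :: "'a pair_pre_digraph \<Rightarrow> nat \<Rightarrow> 'a set set" where
  "color_refinement K i = (refine K ^^ i) {pverts K}"

definition stable_partition :: "'a pair_pre_digraph \<Rightarrow> 'a set set" where
  "stable_partition K =
     color_refinement K (LEAST i. color_refinement K (Suc i) = color_refinement K i)"

text \<open>
  The second graph ranges over graphs on natural numbers; every finite graph is isomorphic
  to one of these, and the cell sizes compared are invariant under isomorphism.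
\<close>

definition amenable :: "'a pair_pre_digraph \<Rightarrow> bool" where
  "amenable G \<longleftrightarrow>
     (\<forall>H :: nat pair_pre_digraph. pair_graph H \<longrightarrow>
        ((\<forall>X \<in> stable_partition (disjoint_union G H). card (Inl -` X) = card (Inr -` X))
           \<longleftrightarrow> digraph_iso (with_proj G) (with_proj H)))"


subsection \<open>Cells and anisotropic components\<close>

definition empty_on :: "'a pair_pre_digraph \<Rightarrow> 'a set \<Rightarrow> bool" where
  "empty_on K X \<longleftrightarrow> (\<forall>u\<in>X. \<forall>v\<in>X. (u, v) \<notin> parcs K)"

definition complete_on :: "'a pair_pre_digraph \<Rightarrow> 'a set \<Rightarrow> bool" where
  "complete_on K X \<longleftrightarrow> (\<forall>u\<in>X. \<forall>v\<in>X. u \<noteq> v \<longrightarrow> (u, v) \<in> parcs K)"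

text \<open>\<open>K[X]\<close> is \<open>r K\<^sub>2\<close>; here \<open>card X = 2 * r\<close>, so \<open>r \<ge> 2\<close> is expressed by \<open>card X \<ge> 4\<close>.\<close>

definition matching_on :: "'a pair_pre_digraph \<Rightarrow> 'a set \<Rightarrow> bool" where
  "matching_on K X \<longleftrightarrow> card X \<ge> 4 \<and> (\<forall>u\<in>X. \<exists>!v. v \<in> X \<and> (u, v) \<in> parcs K)"

definition homogeneous :: "'a pair_pre_digraph \<Rightarrow> 'a set \<Rightarrow> bool" where
  "homogeneous K X \<longleftrightarrow> empty_on K X \<or> complete_on K X"

definition bip_empty :: "'a pair_pre_digraph \<Rightarrow> 'a set \<Rightarrow> 'a set \<Rightarrow> bool" where
  "bip_empty K X Y \<longleftrightarrow> (\<forall>u\<in>X. \<forall>v\<in>Y. (u, v) \<notin> parcs K)"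

definition bip_complete :: "'a pair_pre_digraph \<Rightarrow> 'a set \<Rightarrow> 'a set \<Rightarrow> bool" where
  "bip_complete K X Y \<longleftrightarrow> (\<forall>u\<in>X. \<forall>v\<in>Y. (u, v) \<in> parcs K)"

definition isotropic :: "'a pair_pre_digraph \<Rightarrow> 'a set \<Rightarrow> 'a set \<Rightarrow> bool" where
  "isotropic K X Y \<longleftrightarrow> bip_empty K X Y \<or> bip_complete K X Y"

text \<open>
  The bipartite graph with arc set \<open>E\<close> between the disjoint sets \<open>X\<close> and \<open>Y\<close> is a star forest
  \<open>s K\<^sub>1\<^sub>,\<^sub>t\<close> whose centers form one of the two sides.  Between two cells of a stable partition
  the bipartite graph and its bipartite complement are biregular, so a star forest
  necessarily has this shape.
\<close>

definition stars_centered :: "('a \<times> 'a) set \<Rightarrow> 'a set \<Rightarrow> 'a set \<Rightarrow> bool" where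
  "stars_centered E X Y \<longleftrightarrow>
     (\<exists>t\<ge>1. \<forall>x\<in>X. card {y \<in> Y. (x, y) \<in> E} = t) \<and> (\<forall>y\<in>Y. \<exists>!x. x \<in> X \<and> (y, x) \<in> E)"

definition star_forest :: "('a \<times> 'a) set \<Rightarrow> 'a set \<Rightarrow> 'a set \<Rightarrow> bool" where
  "star_forest E X Y \<longleftrightarrow> stars_centered E X Y \<or> stars_centered E Y X"

definition bip_complement :: "'a pair_pre_digraph \<Rightarrow> 'a set \<Rightarrow> 'a set \<Rightarrow> ('a \<times> 'a) set" where
  "bip_complement K X Y = (X \<times> Y \<union> Y \<times> X) - parcs K"

definition aniso_rel :: "'a pair_pre_digraph \<Rightarrow> ('a set \<times> 'a set) set" where
  "aniso_rel G = {(X, Y). X \<in> stable_partition G \<and> Y \<in> stable_partition G \<and>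
                          X \<noteq> Y \<and> \<not> isotropic G X Y}"

definition anisotropic_components :: "'a pair_pre_digraph \<Rightarrow> 'a set set set" where
  "anisotropic_components G = stable_partition G // (aniso_rel G)\<^sup>*"

definition is_root :: "'a pair_pre_digraph \<Rightarrow> 'a set set \<Rightarrow> 'a set \<Rightarrow> bool" where
  "is_root G A R \<longleftrightarrow> R \<in> A \<and>
     (if \<exists>X\<in>A. \<not> homogeneous G X then \<not> homogeneous G R else \<forall>X\<in>A. card R \<le> card X)"


subsection \<open>The jellyfish graph\<close>

definition cell_arcs :: "'a pair_pre_digraph \<Rightarrow> 'a set \<Rightarrow> 'a set \<Rightarrow> ('a \<times> 'a) set" where
  "cell_arcs K R X =
     (if (if X = R then matching_on K X \<or> empty_on K X else complete_on K X)
      then {(u, v). u \<in> X \<and> v \<in> X \<and> u \<noteq> v} - parcs K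
      else parcs K \<inter> X \<times> X)"

definition pair_arcs :: "'a pair_pre_digraph \<Rightarrow> 'a set \<Rightarrow> 'a set \<Rightarrow> ('a \<times> 'a) set" where
  "pair_arcs K X Y =
     (if (if isotropic K X Y then bip_complete K X Y
          else star_forest (bip_complement K X Y) X Y)
      then X \<times> Y - parcs K
      else parcs K \<inter> X \<times> Y)"

definition jellyfish :: "'a pair_pre_digraph \<Rightarrow> 'a set set \<Rightarrow> 'a set \<Rightarrow> 'a pair_pre_digraph" where
  "jellyfish G A R =
     (let Gi = induced G (\<Union>A) in
      \<lparr>pverts = pverts Gi,
       parcs = (\<Union>X\<in>A. cell_arcs Gi R X) \<union> (\<Union>X\<in>A. \<Union>Y\<in>A - {X}. pair_arcs Gi X Y)\<rparr>)"

definition jelly_head :: "'a pair_pre_digraph \<Rightarrow> 'a set set \<Rightarrow> 'a set \<Rightarrow> 'a pair_pre_digraph" where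
  "jelly_head G A R = induced (jellyfish G A R) R"

definition cell_dist :: "'a pair_pre_digraph \<Rightarrow> 'a set \<Rightarrow> 'a set \<Rightarrow> nat" where
  "cell_dist G R X = (LEAST n. (R, X) \<in> aniso_rel G ^^ n)"

text \<open>
  In the tree of anisotropic pairs rooted at \<open>R\<close>, the parent of a cell is its neighbor
  that is one step closer to \<open>R\<close>.
\<close>

definition parent_cell :: "'a pair_pre_digraph \<Rightarrow> 'a set \<Rightarrow> 'a set \<Rightarrow> 'a set \<Rightarrow> bool" where
  "parent_cell G R X Y \<longleftrightarrow> (X, Y) \<in> aniso_rel G \<and> cell_dist G R Y = Suc (cell_dist G R X)"

definition parent_child :: "'a pair_pre_digraph \<Rightarrow> 'a set set \<Rightarrow> 'a set \<Rightarrow> ('a \<times> 'a) set" where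
  "parent_child G A R =
     {(u, w) \<in> parcs (jellyfish G A R). \<exists>X\<in>A. \<exists>Y\<in>A. parent_cell G R X Y \<and> u \<in> X \<and> w \<in> Y}"

definition leg :: "'a pair_pre_digraph \<Rightarrow> 'a set set \<Rightarrow> 'a set \<Rightarrow> 'a \<Rightarrow> 'a pair_pre_digraph" where
  "leg G A R v = induced (jellyfish G A R) ((parent_child G A R)\<^sup>* `` {v})"


subsection \<open>Distinguishing labelings\<close>

definition Aut :: "'a pair_pre_digraph \<Rightarrow> ('a \<Rightarrow> 'a) set" where
  "Aut F = {\<pi>. \<pi> permutes pverts F \<and>
     (\<forall>u\<in>pverts F. \<forall>v\<in>pverts F. (\<pi> u, \<pi> v) \<in> parcs F \<longleftrightarrow> (u, v) \<in> parcs F)}"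

definition cell_Aut :: "'a pair_pre_digraph \<Rightarrow> 'a set set \<Rightarrow> ('a \<Rightarrow> 'a) set" where
  "cell_Aut F P = {\<pi> \<in> Aut F. \<forall>v\<in>pverts F. \<forall>X\<in>P. v \<in> X \<longrightarrow> \<pi> v \<in> X}"

text \<open>
  The following notions are relative to a set \<open>\<Gamma>\<close> of permutations of \<open>V\<close>, which is below
  either \<^term>\<open>Aut F\<close> or \<^term>\<open>cell_Aut F P\<close>.  Labelings with at most \<open>c\<close> colors take values in
  \<open>{..<c}\<close> and are extensional, so that they can be counted.  For finite \<open>V\<close> the minimum in \<open>fewest_colors\<close>
  exists, since an injective labeling is distinguishing.
\<close>

definition distinguishing_labelings ::
    "'a set \<Rightarrow> ('a \<Rightarrow> 'a) set \<Rightarrow> nat \<Rightarrow> ('a \<Rightarrow> nat) set" where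
  "distinguishing_labelings V \<Gamma> c =
     {\<phi> \<in> V \<rightarrow>\<^sub>E {..<c}. \<forall>\<pi>\<in>\<Gamma>. (\<forall>v\<in>V. \<phi> (\<pi> v) = \<phi> v) \<longrightarrow> \<pi> = id}"

definition fewest_colors :: "'a set \<Rightarrow> ('a \<Rightarrow> 'a) set \<Rightarrow> nat" where
  "fewest_colors V \<Gamma> = (LEAST c. distinguishing_labelings V \<Gamma> c \<noteq> {})"

definition inequivalent_count :: "'a set \<Rightarrow> ('a \<Rightarrow> 'a) set \<Rightarrow> nat \<Rightarrow> nat" where
  "inequivalent_count V \<Gamma> c =
     card (distinguishing_labelings V \<Gamma> c //
       {(\<phi>, \<phi>'). \<phi> \<in> distinguishing_labelings V \<Gamma> c \<and> \<phi>' \<in> distinguishing_labelings V \<Gamma> c \<and>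
                 (\<exists>\<pi>\<in>\<Gamma>. \<forall>v\<in>V. \<phi> v = \<phi>' (\<pi> v))})"

definition dist_number :: "'a pair_pre_digraph \<Rightarrow> nat" where
  "dist_number F = fewest_colors (pverts F) (Aut F)"

definition cell_dist_number :: "'a pair_pre_digraph \<Rightarrow> 'a set set \<Rightarrow> nat" where
  "cell_dist_number F P = fewest_colors (pverts F) (cell_Aut F P)"

definition cell_dist_count :: "'a pair_pre_digraph \<Rightarrow> 'a set set \<Rightarrow> nat \<Rightarrow> nat" where
  "cell_dist_count F P c = inequivalent_count (pverts F) (cell_Aut F P) c"

end

theory Submission
  imports Defs
begin

text \<open>
  If \<open>G\<close> is amenable, every graph \<open>G'\<close> on the same vertices in which each vertex has the same number
  of neighbors in each stable cell as in \<open>G\<close> is the image of \<open>G\<close> under a bijection preserving the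
  stable cells.  Everything about anisotropic components follows by choosing \<open>G'\<close> well.
  Replacing the graph between two cells by another biregular graph shows that it is, up to
  bipartite complement, a star forest, so that the larger cell projects onto the smaller one.
  Permuting it on the side of one cell \<open>Y\<close> by an arbitrary permutation shows that two
  independent structures on \<open>Y\<close>, for instance the pullbacks of the adjacency in the root and of the equality
  in a smaller child cell, cannot coexist: the size of their overlap would have to be the same for all
  relative positions.  Hence cell sizes do not decrease away from the root, the root is the only possible
  heterogeneous cell, and a cell with two routes to the root is impossible.

  The jellyfish graph is therefore its head with isomorphic trees attached, and its automorphism
  group is the wreath product of the leg group and the head group.  A labeling is
  distinguishing iff it is distinguishing on each leg and the equivalence classes of the leg
  labelings form a distinguishing labeling of the head.
\<close>

section \<open>Color refinement and amenability\<close>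

fun cr_rel :: "'a pair_pre_digraph \<Rightarrow> nat \<Rightarrow> 'a rel" where
  "cr_rel K 0 = pverts K \<times> pverts K"
| "cr_rel K (Suc i) = {(u, v) \<in> cr_rel K i. \<forall>w\<in>pverts K.
     card {z \<in> cr_rel K i `` {w}. (u, z) \<in> parcs K} = card {z \<in> cr_rel K i `` {w}. (v, z) \<in> parcs K}}"

lemma equiv_cr_rel: "equiv (pverts K) (cr_rel K i)"
proof (induction i)
  case 0
  show ?case by (auto simp: equiv_def refl_on_def sym_def trans_def)
next
  case (Suc i)
  then have "refl_on (pverts K) (cr_rel K i)" "sym (cr_rel K i)" "trans (cr_rel K i)"
    "cr_rel K i \<subseteq> pverts K \<times> pverts K"
    by (auto elim!: equivE)
  moreover have "sym (cr_rel K (Suc i))" "trans (cr_rel K (Suc i))"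
    using \<open>sym (cr_rel K i)\<close> \<open>trans (cr_rel K i)\<close>
    by (auto intro!: symI transI dest: symD transD)
  ultimately show ?case by (intro equivI) (auto simp: refl_on_def)
qed

lemma cr_rel_antimono: "i \<le> j \<Longrightarrow> cr_rel K j \<subseteq> cr_rel K i"
  by (induction j rule: dec_induct) auto

lemma in_quotient_pair_iff:
  assumes "equiv V E"
  shows "(\<exists>X\<in>V // E. u \<in> X \<and> v \<in> X) \<longleftrightarrow> (u, v) \<in> E"
proof
  assume "\<exists>X\<in>V // E. u \<in> X \<and> v \<in> X"
  then show "(u, v) \<in> E" using assms quotient_eq_iff by fastforce
next
  assume "(u, v) \<in> E"
  moreover from this have "u \<in> V" using assms by (meson equiv_class_eq_iff)
  moreover have "u \<in> E `` {u}" using equiv_class_self[OF assms \<open>u \<in> V\<close>] .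
  ultimately show "\<exists>X\<in>V // E. u \<in> X \<and> v \<in> X"
    by (intro bexI[of _ "E `` {u}"]) (auto intro: quotientI)
qed

lemma quotient_inject:
  assumes "equiv V E" "equiv V F" "V // E = V // F"
  shows "E = F"
  using in_quotient_pair_iff[OF assms(1)] in_quotient_pair_iff[OF assms(2)] assms(3)
  by (metis subsetI subset_antisym surj_pair)

lemma refine_quotient:
  assumes "equiv (pverts K) E"
  shows "refine K (pverts K // E) = pverts K // {(u, v) \<in> E. \<forall>w\<in>pverts K.
     card {z \<in> E `` {w}. (u, z) \<in> parcs K} = card {z \<in> E `` {w}. (v, z) \<in> parcs K}}"
  unfolding refine_def in_quotient_pair_iff[OF assms]
  by (simp add: quotient_def)

lemma color_refinement_eq_quotient:
  assumes "pverts K \<noteq> {}"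
  shows "color_refinement K i = pverts K // cr_rel K i"
proof (induction i)
  case 0
  show ?case using assms by (auto simp: color_refinement_def quotient_def)
next
  case (Suc i)
  then show ?case
    using refine_quotient[OF equiv_cr_rel, of K i] by (simp add: color_refinement_def)
qed

lemma cr_rel_stabilizes:
  assumes "finite (pverts K)"
  shows "\<exists>i. cr_rel K (Suc i) = cr_rel K i"
proof (rule ccontr)
  assume "\<nexists>i. cr_rel K (Suc i) = cr_rel K i"
  then have strict: "cr_rel K (Suc i) \<subset> cr_rel K i" for i
    by (intro psubsetI cr_rel_antimono) auto
  have fin: "finite (cr_rel K i)" for i
    using cr_rel_antimono[of 0 i K] assms by (auto intro: finite_subset)
  have "card (cr_rel K i) + i \<le> card (cr_rel K 0)" for i
  proof (induction i)
    case (Suc i)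
    then show ?case using psubset_card_mono[OF fin strict, of i] by linarith
  qed simp
  from this[of "Suc (card (cr_rel K 0))"] show False by linarith
qed

lemma stable_partition_eq_quotient:
  assumes "finite (pverts K)" "pverts K \<noteq> {}"
  obtains s where "stable_partition K = pverts K // cr_rel K s" "cr_rel K (Suc s) = cr_rel K s"
    "\<And>i. cr_rel K s \<subseteq> cr_rel K i"
proof -
  define s where "s = (LEAST i. color_refinement K (Suc i) = color_refinement K i)"
  have "\<exists>i. color_refinement K (Suc i) = color_refinement K i"
    using cr_rel_stabilizes[OF assms(1)] by (metis assms(2) color_refinement_eq_quotient)
  then have "color_refinement K (Suc s) = color_refinement K s"
    unfolding s_def by (rule LeastI_ex)
  then have eq: "cr_rel K (Suc s) = cr_rel K s"
    using quotient_inject[OF equiv_cr_rel equiv_cr_rel] assms(2)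
    by (metis color_refinement_eq_quotient)
  have step: "cr_rel K (s + j) = cr_rel K s" for j
    by (induction j) (use eq in auto)
  have "cr_rel K s \<subseteq> cr_rel K i" for i
  proof (cases "i \<le> s")
    case False
    then show ?thesis using step[of "i - s"] by simp
  qed (rule cr_rel_antimono)
  moreover have "stable_partition K = pverts K // cr_rel K s"
    unfolding stable_partition_def s_def[symmetric] by (rule color_refinement_eq_quotient[OF assms(2)])
  ultimately show thesis using that eq by blast
qed

lemma stable_partition_empty:
  assumes "pverts K = {}"
  shows "stable_partition K = {}"
proof -
  have "color_refinement K (Suc i) = {}" for i
    using assms by (simp add: color_refinement_def refine_def)
  moreover have "color_refinement K 0 \<noteq> {}" by (simp add: color_refinement_def)
  ultimately have "(LEAST i. color_refinement K (Suc i) = color_refinement K i) \<noteq> 0"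
    by (metis (mono_tags, lifting) LeastI)
  with \<open>\<And>i. color_refinement K (Suc i) = {}\<close> show ?thesis
    unfolding stable_partition_def by (metis not0_implies_Suc)
qed

lemma
  assumes "finite (pverts K)"
  shows Union_stable_partition: "\<Union>(stable_partition K) = pverts K"
    and stable_cells_disjoint: "X \<in> stable_partition K \<Longrightarrow> Y \<in> stable_partition K \<Longrightarrow> X \<noteq> Y \<Longrightarrow> X \<inter> Y = {}"
    and stable_cell_nonempty: "X \<in> stable_partition K \<Longrightarrow> X \<noteq> {}"
proof -
  show "\<Union>(stable_partition K) = pverts K"
  proof (cases "pverts K = {}")
    case False
    then obtain s where "stable_partition K = pverts K // cr_rel K s"
      using stable_partition_eq_quotient[OF assms] by metis
    then show ?thesis using Union_quotient[OF equiv_cr_rel] by metis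
  qed (simp add: stable_partition_empty)
next
  assume "X \<in> stable_partition K" 
  then have "pverts K \<noteq> {}" using stable_partition_empty by blast
  then obtain s where s: "stable_partition K = pverts K // cr_rel K s"
    using stable_partition_eq_quotient[OF assms] by metis
  show "X \<noteq> {}" using in_quotient_imp_non_empty[OF equiv_cr_rel] s \<open>X \<in> _\<close> by metis
  show "X \<inter> Y = {}" if "Y \<in> stable_partition K" "X \<noteq> Y"
    using quotient_disj[OF equiv_cr_rel] s \<open>X \<in> _\<close> that by metis
qed

lemma stable_partition_equitable:
  assumes "finite (pverts K)" "X \<in> stable_partition K" "C \<in> stable_partition K" "u \<in> X" "v \<in> X"
  shows "card {w \<in> C. (u, w) \<in> parcs K} = card {w \<in> C. (v, w) \<in> parcs K}"
proof -
  have "pverts K \<noteq> {}" using assms(2) stable_partition_empty by blast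
  then obtain s where s: "stable_partition K = pverts K // cr_rel K s" "cr_rel K (Suc s) = cr_rel K s"
    using stable_partition_eq_quotient[OF assms(1)] by metis
  have "(u, v) \<in> cr_rel K (Suc s)"
    using assms s in_quotient_pair_iff[OF equiv_cr_rel] by metis
  moreover obtain w where "w \<in> pverts K" "C = cr_rel K s `` {w}"
    using assms(3) s(1) by (metis quotientE)
  ultimately show ?thesis by simp
qed

lemma digraph_iso_with_projD:
  assumes "digraph_iso (with_proj K) (with_proj L)"
  obtains f where "bij_betw f (pverts K) (pverts L)"
    "\<And>u v. u \<in> pverts K \<Longrightarrow> v \<in> pverts K \<Longrightarrow> (f u, f v) \<in> parcs L \<longleftrightarrow> (u, v) \<in> parcs K"
proof -
  from assms obtain h where h: "pre_digraph.digraph_isomorphism (with_proj K) h"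
    "with_proj L = app_iso h (with_proj K)" by (auto simp: digraph_iso_def)
  then have V: "pverts L = iso_verts h ` pverts K" and E: "parcs L = iso_arcs h ` parcs K"
    and t: "iso_tail h = fst" and hd: "iso_head h = snd"
    by (auto simp: with_proj_def app_iso_def)
  have inj: "inj_on (iso_verts h) (pverts K)"
    and wf: "wf_digraph (with_proj K)"
    and arc: "\<And>e. e \<in> parcs K \<Longrightarrow> iso_arcs h e = (iso_verts h (fst e), iso_verts h (snd e))"
    using h(1) t hd by (auto simp: pre_digraph.digraph_isomorphism_def prod_eq_iff)
  have sub: "(u, v) \<in> parcs K \<Longrightarrow> u \<in> pverts K \<and> v \<in> pverts K" for u v
    using wf by (auto simp: wf_digraph_def)
  show thesis
  proof (rule that)
    show "bij_betw (iso_verts h) (pverts K) (pverts L)"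
      using inj V by (simp add: bij_betw_def)
    fix u v assume uv: "u \<in> pverts K" "v \<in> pverts K"
    show "(iso_verts h u, iso_verts h v) \<in> parcs L \<longleftrightarrow> (u, v) \<in> parcs K"
    proof
      assume "(iso_verts h u, iso_verts h v) \<in> parcs L"
      then obtain e where e: "e \<in> parcs K" "(iso_verts h u, iso_verts h v) = iso_arcs h e"
        unfolding E by auto
      then have "iso_verts h u = iso_verts h (fst e)" "iso_verts h v = iso_verts h (snd e)"
        using arc by auto
      then have "u = fst e" "v = snd e" using sub[of "fst e" "snd e"] e(1) uv inj
        by (auto dest: inj_onD)
      then show "(u, v) \<in> parcs K" using e(1) by simp
    next
      assume "(u, v) \<in> parcs K"
      then show "(iso_verts h u, iso_verts h v) \<in> parcs L"
        unfolding E using arc by force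
    qed
  qed
qed

lemma card_filter_Union_disjoint:
  assumes "finite Q" "\<And>X. X \<in> Q \<Longrightarrow> finite X" "\<And>X Y. X \<in> Q \<Longrightarrow> Y \<in> Q \<Longrightarrow> X \<noteq> Y \<Longrightarrow> X \<inter> Y = {}"
  shows "card {w \<in> \<Union>Q. \<phi> w} = (\<Sum>X\<in>Q. card {w \<in> X. \<phi> w})"
proof -
  have "{w \<in> \<Union>Q. \<phi> w} = (\<Union>X\<in>Q. {w \<in> X. \<phi> w})" by auto
  also have "card \<dots> = (\<Sum>X\<in>Q. card {w \<in> X. \<phi> w})"
    by (rule card_UN_disjoint) (use assms in \<open>auto simp: disjoint_iff\<close>)
  finally show ?thesis .
qed

lemma pair_graph_image:
  assumes "pair_graph K" "inj_on g (pverts K)"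
  shows "pair_graph \<lparr>pverts = g ` pverts K, parcs = map_prod g g ` parcs K\<rparr>"
proof -
  interpret pair_graph K by fact
  let ?H = "\<lparr>pverts = g ` pverts K, parcs = map_prod g g ` parcs K\<rparr>"
  show ?thesis
  proof
    fix e assume "e \<in> parcs ?H"
    then obtain u v where uv: "(u, v) \<in> parcs K" "e = (g u, g v)" by auto
    then have "u \<in> pverts K" "v \<in> pverts K" "u \<noteq> v"
      using in_arcsD1 in_arcsD2 pair_no_loops[of "(u, v)"] by auto
    with uv assms(2) show "fst e \<in> pverts ?H" "snd e \<in> pverts ?H" "fst e \<noteq> snd e"
      by (auto dest: inj_onD)
  next
    show "finite (pverts ?H)" "finite (parcs ?H)"
      using pair_finite_verts pair_finite_arcs by auto
    have "sym (parcs K)" using pair_sym_arcs by (simp add: symmetric_def)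
    then have "sym (parcs ?H)" by (auto simp: sym_def)
    then show "symmetric (with_proj ?H)" by (simp add: symmetric_def)
  qed
qed

text \<open>The disjoint union of \<^term>\<open>G\<close> with a copy of \<^term>\<open>G'\<close> refines exactly like \<^term>\<open>G\<close> itself.\<close>

lemma amenable_rewiring:
  assumes G: "pair_graph G" "amenable G" and G': "pair_graph G'" "pverts G' = pverts G"
    and deg: "\<And>u C. u \<in> pverts G \<Longrightarrow> C \<in> stable_partition G \<Longrightarrow>
      card {w \<in> C. (u, w) \<in> parcs G'} = card {w \<in> C. (u, w) \<in> parcs G}"
  obtains f where "f permutes pverts G" "\<And>C. C \<in> stable_partition G \<Longrightarrow> f ` C = C"
    "\<And>u v. u \<in> pverts G \<Longrightarrow> v \<in> pverts G \<Longrightarrow> (f u, f v) \<in> parcs G' \<longleftrightarrow> (u, v) \<in> parcs G"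
proof (cases "pverts G = {}")
  case True
  then show thesis using that[of id] by (auto simp: stable_partition_empty permutes_id)
next
  case ne: False
  interpret G: pair_graph G by fact
  interpret G': pair_graph G' by fact
  let ?V = "pverts G"
  have fin: "finite ?V" by (rule G.pair_finite_verts)
  obtain s where s: "stable_partition G = ?V // cr_rel G s" "\<And>i. cr_rel G s \<subseteq> cr_rel G i"
    using stable_partition_eq_quotient[OF fin ne] by metis
  have deg_i: "card {z \<in> cr_rel G i `` {w}. (u, z) \<in> parcs G'} = card {z \<in> cr_rel G i `` {w}. (u, z) \<in> parcs G}"
    if "u \<in> ?V" for u w i
  proof -
    define Q where "Q = {X \<in> stable_partition G. X \<subseteq> cr_rel G i `` {w}}"
    have sub: "cr_rel G i `` {w} \<subseteq> ?V"
      using equiv_cr_rel[of G i] by (meson Image_singleton_iff equiv_class_eq_iff subsetI)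
    have "cr_rel G i `` {w} \<subseteq> \<Union>Q"
    proof
      fix z assume z: "z \<in> cr_rel G i `` {w}"
      then have zV: "z \<in> ?V" using sub by blast
      have "cr_rel G s `` {z} \<subseteq> cr_rel G i `` {w}"
        using s(2)[of i] z equiv_cr_rel[of G i] by (auto simp: equiv_def dest: transD)
      moreover have "cr_rel G s `` {z} \<in> stable_partition G"
        using zV s(1) by (simp add: quotientI)
      moreover have "z \<in> cr_rel G s `` {z}"
        using equiv_class_self[OF equiv_cr_rel zV] .
      ultimately show "z \<in> \<Union>Q" unfolding Q_def by blast
    qed
    then have eq: "cr_rel G i `` {w} = \<Union>Q" unfolding Q_def by blast
    have QV: "X \<subseteq> ?V" if "X \<in> Q" for X using that sub unfolding Q_def by blast
    have "Q \<subseteq> Pow ?V" using QV by blast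
    then have "finite Q" using fin by (rule finite_subset[OF _ finite_Pow_iff[THEN iffD2]])
    moreover have "\<And>X. X \<in> Q \<Longrightarrow> finite X" by (rule finite_subset[OF QV fin])
    moreover have "\<And>X Y. X \<in> Q \<Longrightarrow> Y \<in> Q \<Longrightarrow> X \<noteq> Y \<Longrightarrow> X \<inter> Y = {}"
      using stable_cells_disjoint[OF fin] unfolding Q_def by blast
    ultimately have c: "card {z \<in> \<Union>Q. \<phi> z} = (\<Sum>X\<in>Q. card {z \<in> X. \<phi> z})" for \<phi>
      by (rule card_filter_Union_disjoint)
    show ?thesis unfolding eq c
      by (rule sum.cong) (use deg that in \<open>auto simp: Q_def\<close>)
  qed
  obtain g :: "'a \<Rightarrow> nat" where g: "inj_on g ?V"
    using finite_imp_inj_to_nat_seg[OF fin] by blast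
  define H where "H = \<lparr>pverts = g ` ?V, parcs = map_prod g g ` parcs G'\<rparr>"
  have H: "pair_graph H" unfolding H_def using pair_graph_image[of G' g] G' g by simp
  have arcH: "(g u, g v) \<in> parcs H \<longleftrightarrow> (u, v) \<in> parcs G'" if "u \<in> ?V" "v \<in> ?V" for u v
    using that g G'.in_arcsD1 G'.in_arcsD2 G'(2) unfolding H_def
    by (auto simp: inj_on_eq_iff intro: rev_image_eqI)
  define D where "D = disjoint_union G H"
  define a where "a = case_sum id (inv_into ?V g)"
  have a_simps [simp]: "a (Inl u) = u" "u \<in> ?V \<Longrightarrow> a (Inr (g u)) = u" for u
    unfolding a_def using g by auto
  have VD: "pverts D = Inl ` ?V \<union> (\<lambda>u. Inr (g u)) ` ?V"
    unfolding D_def disjoint_union_def H_def by (auto simp: Plus_def)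
  have aV: "a x \<in> ?V" if "x \<in> pverts D" for x using that unfolding VD by auto
  have arcD1: "(Inl u, x) \<in> parcs D \<longleftrightarrow> (\<exists>v. x = Inl v \<and> (u, v) \<in> parcs G)" for u x
    unfolding D_def disjoint_union_def by auto
  have arcD2: "(Inr u, x) \<in> parcs D \<longleftrightarrow> (\<exists>v. x = Inr v \<and> (u, v) \<in> parcs H)" for u x
    unfolding D_def disjoint_union_def by auto
  have Esub: "cr_rel G i `` {w} \<subseteq> ?V" for i w
    using equiv_cr_rel[of G i] by (meson Image_singleton_iff equiv_class_eq_iff subsetI)
  have rel: "cr_rel D i = {(x, y). x \<in> pverts D \<and> y \<in> pverts D \<and> (a x, a y) \<in> cr_rel G i}" for i
  proof (induction i)
    case 0
    then show ?case using aV by auto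
  next
    case (Suc i)
    have Im: "cr_rel D i `` {w} = {y \<in> pverts D. a y \<in> cr_rel G i `` {a w}}" if "w \<in> pverts D" for w
      unfolding Suc using that by auto
    have card_eq: "card {z \<in> cr_rel D i `` {w}. (x, z) \<in> parcs D} =
        card {z \<in> cr_rel G i `` {a w}. (a x, z) \<in> parcs G}" if w: "w \<in> pverts D" and x: "x \<in> pverts D" for w x
    proof -
      consider (l) u where "u \<in> ?V" "x = Inl u" | (r) u where "u \<in> ?V" "x = Inr (g u)"
        using x unfolding VD by blast
      then show ?thesis
      proof cases
        case l
        have "{z \<in> cr_rel D i `` {w}. (x, z) \<in> parcs D} = Inl ` {z \<in> cr_rel G i `` {a w}. (u, z) \<in> parcs G}"
          unfolding Im[OF w] l arcD1 using Esub[of i "a w"] by (auto simp: VD)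
        then show ?thesis using l by (simp add: card_image)
      next
        case r
        have "{z \<in> cr_rel D i `` {w}. (x, z) \<in> parcs D} =
            (\<lambda>v. Inr (g v)) ` {z \<in> cr_rel G i `` {a w}. (u, z) \<in> parcs G'}"
          unfolding Im[OF w] r arcD2 using Esub[of i "a w"] r(1) by (auto simp: VD arcH)
        moreover have "inj_on (\<lambda>v. Inr (g v) :: 'a + nat) {z \<in> cr_rel G i `` {a w}. (u, z) \<in> parcs G'}"
          using g Esub[of i "a w"] by (auto simp: inj_on_def)
        ultimately show ?thesis using r deg_i[OF r(1)] by (simp add: card_image)
      qed
    qed
    have "(\<forall>w\<in>pverts D. card {z \<in> cr_rel D i `` {w}. (x, z) \<in> parcs D} = card {z \<in> cr_rel D i `` {w}. (y, z) \<in> parcs D})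
       \<longleftrightarrow> (\<forall>w\<in>?V. card {z \<in> cr_rel G i `` {w}. (a x, z) \<in> parcs G} = card {z \<in> cr_rel G i `` {w}. (a y, z) \<in> parcs G})"
      if "x \<in> pverts D" "y \<in> pverts D" for x y
    proof -
      have "?V = a ` pverts D" unfolding VD by force
      then show ?thesis using card_eq that by simp
    qed
    then show ?case using Suc by auto
  qed
  have neD: "pverts D \<noteq> {}" using ne unfolding VD by blast
  have finD: "finite (pverts D)" using fin unfolding VD by blast
  have "card (Inl -` X) = card (Inr -` X)" if X: "X \<in> stable_partition D" for X
  proof -
    obtain t where "stable_partition D = pverts D // cr_rel D t"
      using stable_partition_eq_quotient[OF finD neD] by metis
    then obtain w where w: "w \<in> pverts D" "X = cr_rel D t `` {w}"
      using X by (metis quotientE)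
    have X: "X = {y \<in> pverts D. a y \<in> cr_rel G t `` {a w}}"
      unfolding w(2) rel using w(1) by auto
    have "Inl -` X = cr_rel G t `` {a w}"
      unfolding X using Esub[of t "a w"] by (auto simp: VD)
    moreover have "Inr -` X = g ` (cr_rel G t `` {a w})"
      unfolding X using Esub[of t "a w"] by (auto simp: VD)
    moreover have "inj_on g (cr_rel G t `` {a w})" using g Esub inj_on_subset by metis
    ultimately show ?thesis by (simp add: card_image)
  qed
  then have "digraph_iso (with_proj G) (with_proj H)"
    using G(2) H unfolding amenable_def D_def by blast
  then obtain f0 where f0: "bij_betw f0 ?V (pverts H)"
    "\<And>u v. u \<in> ?V \<Longrightarrow> v \<in> ?V \<Longrightarrow> (f0 u, f0 v) \<in> parcs H \<longleftrightarrow> (u, v) \<in> parcs G"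
    using digraph_iso_with_projD by blast
  define f where "f u = (if u \<in> ?V then inv_into ?V g (f0 u) else u)" for u
  have gf: "g (f u) = f0 u" "f u \<in> ?V" if "u \<in> ?V" for u
  proof -
    have "f0 u \<in> g ` ?V" using f0(1) that unfolding H_def by (auto simp: bij_betw_def)
    then show "g (f u) = f0 u" "f u \<in> ?V"
      unfolding f_def using that by (auto simp: f_inv_into_f inv_into_into)
  qed
  have "inj_on f ?V"
    by (rule inj_onI) (metis gf(1) f0(1) bij_betw_def inj_onD)
  moreover have "f ` ?V \<subseteq> ?V" using gf(2) by blast
  ultimately have "bij_betw f ?V ?V" using endo_inj_surj[OF fin] by (simp add: bij_betw_def)
  then have perm: "f permutes ?V" by (rule bij_imp_permutes) (simp add: f_def)
  have iso: "(f u, f v) \<in> parcs G' \<longleftrightarrow> (u, v) \<in> parcs G" if "u \<in> ?V" "v \<in> ?V" for u v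
    using f0(2)[OF that] arcH[of "f u" "f v"] gf that by simp
  have same: "(u, f u) \<in> cr_rel G i" if "u \<in> ?V" for u i
    using that
  proof (induction i arbitrary: u)
    case 0
    then show ?case using gf(2) by simp
  next
    case (Suc i)
    have "card {z \<in> cr_rel G i `` {w}. (u, z) \<in> parcs G} = card {z \<in> cr_rel G i `` {w}. (f u, z) \<in> parcs G}" for w
    proof -
      let ?C = "cr_rel G i `` {w}"
      have mem: "f z \<in> ?C \<longleftrightarrow> z \<in> ?C" if "z \<in> ?V" for z
        using Suc.IH[OF that] equiv_cr_rel[of G i] by (auto simp: equiv_def dest: transD symD)
      have "{z \<in> ?C. (f u, z) \<in> parcs G'} = f ` {z \<in> ?C. (u, z) \<in> parcs G}"
      proof (intro set_eqI iffI)
        fix z assume z: "z \<in> {z \<in> ?C. (f u, z) \<in> parcs G'}"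
        then obtain z' where "z = f z'" "z' \<in> ?V"
          using Esub permutes_image[OF perm] by blast
        with z mem iso[OF Suc.prems] show "z \<in> f ` {z \<in> ?C. (u, z) \<in> parcs G}" by auto
      next
        fix z assume "z \<in> f ` {z \<in> ?C. (u, z) \<in> parcs G}"
        then show "z \<in> {z \<in> ?C. (f u, z) \<in> parcs G'}"
          using mem iso[OF Suc.prems] Esub[of i w] by auto
      qed
      then have "card {z \<in> ?C. (u, z) \<in> parcs G} = card {z \<in> ?C. (f u, z) \<in> parcs G'}"
        using permutes_inj[OF perm] by (simp add: card_image inj_on_subset)
      then show ?thesis using deg_i[OF gf(2)[OF Suc.prems]] by simp
    qed
    then show ?case using Suc by simp
  qed
  have "f ` C = C" if C: "C \<in> stable_partition G" for C
  proof -
    obtain w where w: "w \<in> ?V" "C = cr_rel G s `` {w}" using C s(1) by (metis quotientE)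
    have "f ` C \<subseteq> C" using same[of _ s] Esub[of s w] equiv_cr_rel[of G s]
      unfolding w(2) by (auto simp: equiv_def dest: transD)
    moreover have "finite C" using Esub[of s w] fin w(2) finite_subset by blast
    ultimately show ?thesis
      using permutes_inj[OF perm] by (intro card_subset_eq) (auto simp: card_image inj_on_subset)
  qed
  with perm iso show thesis using that by blast
qed

section \<open>Biregular bipartite graphs\<close>

definition biregular :: "('a \<times> 'b) set \<Rightarrow> 'a set \<Rightarrow> 'b set \<Rightarrow> nat \<Rightarrow> nat \<Rightarrow> bool" where
  "biregular M X Y a b \<longleftrightarrow> M \<subseteq> X \<times> Y \<and>
     (\<forall>x\<in>X. card {y \<in> Y. (x, y) \<in> M} = a) \<and> (\<forall>y\<in>Y. card {x \<in> X. (x, y) \<in> M} = b)"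

lemma biregular_double_count:
  assumes "finite X" "finite Y" "biregular M X Y a b"
  shows "card X * a = card Y * b"
proof -
  have "(\<Sum>x\<in>X. card {y \<in> Y. (x, y) \<in> M}) = (\<Sum>y\<in>Y. card {x \<in> X. (x, y) \<in> M})"
    by (rule sum_multicount_gen) (use assms in auto)
  then show ?thesis using assms(3) unfolding biregular_def by simp
qed

lemma eq_of_mod_eq_div_eq:
  assumes "t mod m = t' mod m" "t div a = t' div a" "0 < a" "a \<le> (m::nat)"
  shows "t = t'"
proof -
  have *: "t = t'" if "t mod m = t' mod m" "t div a = t' div a" "t \<le> t'" for t t'
  proof -
    have "m dvd t' - t" using that by (metis mod_eq_dvd_iff_nat)
    moreover have "t' - t = t' mod a - t mod a"
      using that(2) by (metis diff_cancel2 add.commute div_mult_mod_eq diff_add_inverse2)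
    then have "t' - t < m" using assms(3,4) by (metis diff_le_self le_less_trans less_le_trans mod_less_divisor)
    ultimately have "t' - t = 0" by (metis nat_dvd_not_less neq0_conv)
    then show ?thesis using that(3) by simp
  qed
  show ?thesis using *[of t t'] *[of t' t] assms by (metis nat_le_linear)
qed

text \<open>The \<open>i\<close>-th vertex of \<open>X\<close> is joined to the \<open>i\<close>-th block of length \<open>a\<close>, blocks being wrapped around \<open>Y\<close> cyclically.\<close>

lemma ex_biregular:
  assumes fin: "finite X" "finite Y" and eq: "card X * a = card Y * b" and le: "a \<le> card Y"
  shows "\<exists>M. biregular M X Y a b"
proof (cases "a = 0 \<or> X = {} \<or> Y = {}")
  case True
  then have "biregular {} X Y a b"
    using fin eq le unfolding biregular_def by auto
  then show ?thesis by blast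
next
  case False
  define m where "m = card Y"
  define n where "n = card X"
  have pos: "a > 0" "m > 0" using False fin by (auto simp: m_def card_gt_0_iff)
  obtain i where i: "bij_betw i X {0..<n}" using ex_bij_betw_finite_nat[OF fin(1)] n_def by auto
  obtain j where j: "bij_betw j Y {0..<m}" using ex_bij_betw_finite_nat[OF fin(2)] m_def by auto
  define M where "M = {(x, y) \<in> X \<times> Y. \<exists>t. t div a = i x \<and> t mod m = j y}"
  have le': "a \<le> m" using le by (simp add: m_def)
  have row: "card {y \<in> Y. (x, y) \<in> M} = a" if x: "x \<in> X" for x
  proof -
    have div: "t div a = i x \<longleftrightarrow> t \<in> {i x * a..<i x * a + a}" for t
    proof
      assume "t div a = i x"
      then have "t = i x * a + t mod a" by (metis div_mult_mod_eq)
      moreover have "t mod a < a" using pos(1) by simp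
      ultimately show "t \<in> {i x * a..<i x * a + a}" by (metis atLeastLessThan_iff le_add1 nat_add_left_cancel_less)
    qed (auto intro!: div_nat_eqI simp: mult.commute)
    have "j ` {y \<in> Y. (x, y) \<in> M} = (\<lambda>t. t mod m) ` {i x * a..<i x * a + a}"
    proof (intro set_eqI iffI)
      fix k assume "k \<in> j ` {y \<in> Y. (x, y) \<in> M}"
      then show "k \<in> (\<lambda>t. t mod m) ` {i x * a..<i x * a + a}"
        unfolding M_def using div by (auto simp: image_iff) (metis atLeastLessThan_iff)
    next
      fix k assume "k \<in> (\<lambda>t. t mod m) ` {i x * a..<i x * a + a}"
      then obtain t where t: "t \<in> {i x * a..<i x * a + a}" "k = t mod m" by blast
      then have "k \<in> j ` Y" using j pos by (auto simp: bij_betw_def)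
      with t x show "k \<in> j ` {y \<in> Y. (x, y) \<in> M}" unfolding M_def using div by blast
    qed
    moreover have "inj_on (\<lambda>t. t mod m) {i x * a..<i x * a + a}"
      by (rule inj_onI) (use eq_of_mod_eq_div_eq[OF _ _ pos(1) le'] div in metis)
    moreover have "inj_on j {y \<in> Y. (x, y) \<in> M}"
      using j by (auto simp: bij_betw_def intro: inj_on_subset)
    ultimately have "card {y \<in> Y. (x, y) \<in> M} = card {i x * a..<i x * a + a}"
      using card_image[of j "{y \<in> Y. (x, y) \<in> M}"] card_image[of "\<lambda>t. t mod m" "{i x * a..<i x * a + a}"]
      by simp
    then show ?thesis by simp
  qed
  have col: "card {x \<in> X. (x, y) \<in> M} = b" if y: "y \<in> Y" for y
  proof -
    have jy: "j y < m" using j y by (auto simp: bij_betw_def)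
    let ?T = "{t. t < n * a \<and> t mod m = j y}"
    have "i ` {x \<in> X. (x, y) \<in> M} = (\<lambda>t. t div a) ` ?T"
    proof (intro set_eqI iffI)
      fix k assume "k \<in> i ` {x \<in> X. (x, y) \<in> M}"
      then obtain x t where x: "x \<in> X" "k = i x" "t div a = i x" "t mod m = j y"
        unfolding M_def by auto
      have "t div a < n" using x i by (auto simp: bij_betw_def)
      then have "t < n * a" using pos by (simp add: div_less_iff_less_mult)
      with x show "k \<in> (\<lambda>t. t div a) ` ?T" by (intro image_eqI[of _ _ t]) auto
    next
      fix k assume "k \<in> (\<lambda>t. t div a) ` ?T"
      then obtain t where t: "t < n * a" "t mod m = j y" "k = t div a" by blast
      then have "k < n" using pos by (simp add: div_less_iff_less_mult)
      then have "k \<in> i ` X" using i by (simp add: bij_betw_def)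
      then obtain x where "x \<in> X" "k = i x" by blast
      with t y show "k \<in> i ` {x \<in> X. (x, y) \<in> M}"
        unfolding M_def by (intro image_eqI[of _ _ x]) auto
    qed
    moreover have "inj_on (\<lambda>t. t div a) ?T"
      by (rule inj_onI) (use eq_of_mod_eq_div_eq[OF _ _ pos(1) le'] in auto)
    moreover have "inj_on i {x \<in> X. (x, y) \<in> M}"
      using i by (auto simp: bij_betw_def intro: inj_on_subset)
    ultimately have "card {x \<in> X. (x, y) \<in> M} = card ?T"
      using card_image[of i "{x \<in> X. (x, y) \<in> M}"] card_image[of "\<lambda>t. t div a" ?T] by simp
    also have "?T = (\<lambda>s. j y + m * s) ` {0..<b}"
    proof (intro set_eqI iffI)
      fix t assume t: "t \<in> ?T"
      then have "t < b * m" using eq by (simp add: m_def n_def mult.commute)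
      then have "t div m < b" using pos by (simp add: div_less_iff_less_mult)
      moreover have "t = j y + m * (t div m)" using t by (metis (mono_tags) mem_Collect_eq mod_mult_div_eq)
      ultimately show "t \<in> (\<lambda>s. j y + m * s) ` {0..<b}" by auto
    next
      fix t assume "t \<in> (\<lambda>s. j y + m * s) ` {0..<b}"
      then obtain s where s: "s < b" "t = j y + m * s" by auto
      have "m * s + m \<le> m * b" using s(1) by (metis Suc_leI mult_Suc_right mult_le_mono2 add.commute)
      then have "t < n * a" using s jy eq by (simp add: m_def n_def)
      with s jy show "t \<in> ?T" by simp
    qed
    also have "card \<dots> = b"
      by (subst card_image) (use pos in \<open>auto simp: inj_on_def\<close>)
    finally show ?thesis .
  qed
  have "biregular M X Y a b" unfolding biregular_def using row col by (auto simp: M_def)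
  then show ?thesis by blast
qed

lemma switch_degree:
  fixes M :: "('a \<times> 'b) set"
  assumes "finite Y" "(x1, y1) \<in> M" "(x2, y2) \<in> M" "(x1, y2) \<notin> M" "(x2, y1) \<notin> M" "y1 \<in> Y" "y2 \<in> Y"
  shows "card {y \<in> Y. (x, y) \<in> M - {(x1, y1), (x2, y2)} \<union> {(x1, y2), (x2, y1)}} = card {y \<in> Y. (x, y) \<in> M}"
proof -
  have ne: "x1 \<noteq> x2" "y1 \<noteq> y2" using assms by auto
  have swap: "card (insert q (S - {p})) = card S" if "p \<in> S" "q \<notin> S" "finite S" for p q :: 'b and S
    using that by (metis card.remove card_insert_disjoint finite_Diff Diff_iff)
  consider "x = x1" | "x = x2" | "x \<noteq> x1" "x \<noteq> x2" by blast
  then show ?thesis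
  proof cases
    case 1
    have "{y \<in> Y. (x, y) \<in> M - {(x1, y1), (x2, y2)} \<union> {(x1, y2), (x2, y1)}} = insert y2 ({y \<in> Y. (x, y) \<in> M} - {y1})"
      using 1 ne assms by auto
    then show ?thesis using swap[of y1 "{y \<in> Y. (x, y) \<in> M}" y2] 1 assms by simp
  next
    case 2
    have "{y \<in> Y. (x, y) \<in> M - {(x1, y1), (x2, y2)} \<union> {(x1, y2), (x2, y1)}} = insert y1 ({y \<in> Y. (x, y) \<in> M} - {y2})"
      using 2 ne assms by auto
    then show ?thesis using swap[of y2 "{y \<in> Y. (x, y) \<in> M}" y1] 2 assms by simp
  next
    case 3
    then show ?thesis by (intro arg_cong[where f = card]) auto
  qed
qed

lemma biregular_switch:
  assumes "finite X" "finite Y" "biregular M X Y a b"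
    "(x1, y1) \<in> M" "(x2, y2) \<in> M" "(x1, y2) \<notin> M" "(x2, y1) \<notin> M"
  shows "biregular (M - {(x1, y1), (x2, y2)} \<union> {(x1, y2), (x2, y1)}) X Y a b"
proof -
  have sub: "M \<subseteq> X \<times> Y" using assms(3) by (simp add: biregular_def)
  then have XY: "x1 \<in> X" "x2 \<in> X" "y1 \<in> Y" "y2 \<in> Y" using assms(4,5) by auto
  have "card {x \<in> X. (x, y) \<in> M - {(x1, y1), (x2, y2)} \<union> {(x1, y2), (x2, y1)}} = card {x \<in> X. (x, y) \<in> M}" for y
  proof -
    have "{x \<in> X. (x, y) \<in> M - {(x1, y1), (x2, y2)} \<union> {(x1, y2), (x2, y1)}} =
        {x \<in> X. (y, x) \<in> M\<inverse> - {(y1, x1), (y2, x2)} \<union> {(y1, x2), (y2, x1)}}" by auto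
    also have "card \<dots> = card {x \<in> X. (y, x) \<in> M\<inverse>}"
      by (rule switch_degree) (use assms XY in auto)
    finally show ?thesis by simp
  qed
  moreover have "card {y \<in> Y. (x, y) \<in> M - {(x1, y1), (x2, y2)} \<union> {(x1, y2), (x2, y1)}} = card {y \<in> Y. (x, y) \<in> M}" for x
    by (rule switch_degree) (use assms XY in auto)
  ultimately show ?thesis
    using assms(3) sub XY unfolding biregular_def by auto
qed

definition complete_component_verts :: "('a \<times> 'b) set \<Rightarrow> 'a set \<Rightarrow> 'b set \<Rightarrow> 'a set" where
  "complete_component_verts M X Y = {x \<in> X. \<forall>y\<in>Y. (x, y) \<in> M \<longrightarrow>
     (\<forall>x'\<in>X. (x', y) \<in> M \<longrightarrow> (\<forall>y'\<in>Y. (x', y') \<in> M \<longleftrightarrow> (x, y') \<in> M))}"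

lemma complete_component_verts_iso:
  assumes f: "bij_betw f X X" and h: "bij_betw h Y Y"
    and iso: "\<And>x y. x \<in> X \<Longrightarrow> y \<in> Y \<Longrightarrow> (x, y) \<in> M \<longleftrightarrow> (f x, h y) \<in> M'"
  shows "card (complete_component_verts M X Y) = card (complete_component_verts M' X Y)"
proof -
  have X: "X = f ` X" and Y: "Y = h ` Y" using f h by (auto simp: bij_betw_def)
  have mem: "f x \<in> complete_component_verts M' X Y \<longleftrightarrow> x \<in> complete_component_verts M X Y" if "x \<in> X" for x
  proof -
    have "f x \<in> complete_component_verts M' X Y \<longleftrightarrow> (\<forall>y\<in>h ` Y. (f x, y) \<in> M' \<longrightarrow>
        (\<forall>x'\<in>f ` X. (x', y) \<in> M' \<longrightarrow> (\<forall>y'\<in>h ` Y. (x', y') \<in> M' \<longleftrightarrow> (f x, y') \<in> M')))"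
      unfolding X[symmetric] Y[symmetric] complete_component_verts_def
      using that bij_betwE[OF f] by simp
    also have "\<dots> \<longleftrightarrow> x \<in> complete_component_verts M X Y"
      using that by (simp add: complete_component_verts_def iso)
    finally show ?thesis .
  qed
  have sub: "complete_component_verts M X Y \<subseteq> X" "complete_component_verts M' X Y \<subseteq> X"
    unfolding complete_component_verts_def by auto
  have "f ` complete_component_verts M X Y = complete_component_verts M' X Y"
  proof (intro set_eqI iffI)
    fix z assume "z \<in> f ` complete_component_verts M X Y"
    then show "z \<in> complete_component_verts M' X Y" using mem sub by blast
  next
    fix z assume z: "z \<in> complete_component_verts M' X Y"
    then obtain x where "x \<in> X" "z = f x" using sub X by blast
    with z mem show "z \<in> f ` complete_component_verts M X Y" by blast
  qed
  moreover have "inj_on f (complete_component_verts M X Y)"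
    using f sub by (auto simp: bij_betw_def intro: inj_on_subset)
  ultimately show ?thesis by (metis card_image)
qed

text \<open>
  One graph has a component \<open>K\<^sub>b\<^sub>,\<^sub>a\<close>; switching an edge of it with an edge outside
  destroys this component and creates no new complete bipartite component.
\<close>

lemma ex_nonisomorphic_biregular_sparse:
  assumes fin: "finite X" "finite Y" and eq: "card X * a = card Y * b"
    and ab: "2 \<le> a" "2 \<le> b" "2 * a \<le> card Y"
  obtains M M' where "biregular M X Y a b" "biregular M' X Y a b"
    "card (complete_component_verts M' X Y) < card (complete_component_verts M X Y)"
proof -
  have "card X * a \<ge> (2 * b) * a" using eq ab(3) mult_le_mono1[OF ab(3), of b] by (simp add: ac_simps)
  then have bX: "2 * b \<le> card X" using ab(1) by simp
  obtain X0 where X0: "X0 \<subseteq> X" "card X0 = b" using bX obtain_subset_with_card_n[of b X] by auto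
  obtain Y0 where Y0: "Y0 \<subseteq> Y" "card Y0 = a" using ab(3) obtain_subset_with_card_n[of a Y] by auto
  have fin0: "finite X0" "finite Y0" using X0 Y0 fin finite_subset by blast+
  have cards: "card (X - X0) = card X - b" "card (Y - Y0) = card Y - a"
    using X0 Y0 fin0 by (auto simp: card_Diff_subset)
  have "card (X - X0) * a = card (Y - Y0) * b"
    unfolding cards diff_mult_distrib using eq by (simp add: mult.commute)
  moreover have "a \<le> card (Y - Y0)" using cards ab(3) by simp
  ultimately obtain C where C: "biregular C (X - X0) (Y - Y0) a b"
    using ex_biregular[of "X - X0" "Y - Y0" a b] fin by blast
  then have Csub: "C \<subseteq> (X - X0) \<times> (Y - Y0)" by (simp add: biregular_def)
  define M where "M = X0 \<times> Y0 \<union> C"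
  have M: "biregular M X Y a b"
    unfolding biregular_def
  proof (intro conjI ballI)
    show "M \<subseteq> X \<times> Y" using X0 Y0 Csub unfolding M_def by auto
  next
    fix x assume x: "x \<in> X"
    show "card {y \<in> Y. (x, y) \<in> M} = a"
    proof (cases "x \<in> X0")
      case True
      then have "{y \<in> Y. (x, y) \<in> M} = Y0" using Csub Y0 unfolding M_def by auto
      then show ?thesis using Y0 by simp
    next
      case False
      then have "{y \<in> Y. (x, y) \<in> M} = {y \<in> Y - Y0. (x, y) \<in> C}" using Csub unfolding M_def by auto
      then show ?thesis using C x False unfolding biregular_def by auto
    qed
  next
    fix y assume y: "y \<in> Y"
    show "card {x \<in> X. (x, y) \<in> M} = b"
    proof (cases "y \<in> Y0")
      case True
      then have "{x \<in> X. (x, y) \<in> M} = X0" using Csub X0 unfolding M_def by auto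
      then show ?thesis using X0 by simp
    next
      case False
      then have "{x \<in> X. (x, y) \<in> M} = {x \<in> X - X0. (x, y) \<in> C}" using Csub unfolding M_def by auto
      then show ?thesis using C y False unfolding biregular_def by auto
    qed
  qed
  obtain x1 x1' where x1: "x1 \<in> X0" "x1' \<in> X0" "x1 \<noteq> x1'"
    using X0(2) ab(2) by (metis card_2_iff' obtain_subset_with_card_n subset_iff)
  obtain y1 y1' where y1: "y1 \<in> Y0" "y1' \<in> Y0" "y1 \<noteq> y1'"
    using Y0(2) ab(1) by (metis card_2_iff' obtain_subset_with_card_n subset_iff)
  have "X - X0 \<noteq> {}" using cards(1) bX ab(2) by (intro notI) simp
  then obtain x2 where x2: "x2 \<in> X - X0" by blast
  then have "card {y \<in> Y - Y0. (x2, y) \<in> C} = a" using C by (auto simp: biregular_def)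
  then have "{y \<in> Y - Y0. (x2, y) \<in> C} \<noteq> {}" using ab(1) by (metis card.empty not_numeral_le_zero)
  then obtain y2 where y2: "y2 \<in> Y - Y0" "(x2, y2) \<in> C" by blast
  define M' where "M' = M - {(x1, y1), (x2, y2)} \<union> {(x1, y2), (x2, y1)}"
  have M': "biregular M' X Y a b"
    unfolding M'_def by (rule biregular_switch[OF fin M]) (use x1 y1 x2 y2 Csub in \<open>auto simp: M_def\<close>)
  have mem1: "(x, y) \<in> M \<longleftrightarrow> y \<in> Y0" if "x \<in> X0" for x y
    using that Csub unfolding M_def by auto
  have mem2: "(x, y) \<in> M \<longleftrightarrow> (x, y) \<in> C" if "x \<notin> X0" for x y
    using that unfolding M_def by auto
  have n1: "(x1, y) \<in> M' \<longleftrightarrow> y = y2 \<or> y \<in> Y0 \<and> y \<noteq> y1" for y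
    using x1 x2 y1 mem1 unfolding M'_def by auto
  have n2: "(x2, y) \<in> M' \<longleftrightarrow> y = y1 \<or> (x2, y) \<in> C \<and> y \<noteq> y2" for y
    using x1 x2 y1 y2 mem2[of x2] unfolding M'_def by auto
  have n3: "(x, y) \<in> M' \<longleftrightarrow> (x, y) \<in> M" if "x \<noteq> x1" "x \<noteq> x2" for x y
    using that unfolding M'_def by auto
  let ?g = "\<lambda>M. complete_component_verts M X Y"
  have g_mem: "(x', y') \<in> M' \<longleftrightarrow> (x, y') \<in> M'"
    if "x \<in> ?g M'" "(x, y) \<in> M'" "(x', y) \<in> M'" for x x' y y'
  proof -
    have "y \<in> Y" "x' \<in> X" "x \<in> X" and sub: "M' \<subseteq> X \<times> Y" using that M' by (auto simp: biregular_def)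
    then show ?thesis using that unfolding complete_component_verts_def by blast
  qed
  have sub: "?g M' \<subseteq> ?g M - X0"
  proof
    fix x assume x: "x \<in> ?g M'"
    have xX: "x \<in> X" using x by (simp add: complete_component_verts_def)
    have n1': "(x1', y) \<in> M' \<longleftrightarrow> y \<in> Y0" for y using n3[of x1' y] x1 x2 mem1 by auto
    have "x \<noteq> x1" using g_mem[of x y1' x1' y1] x n1 n1' y1 y2 by auto
    have "x \<notin> X0"
    proof
      assume x0: "x \<in> X0"
      have "(x, y) \<in> M' \<longleftrightarrow> y \<in> Y0" for y using n3[of x y] x0 \<open>x \<noteq> x1\<close> x2 mem1 by auto
      then show False using g_mem[of x y1' x1 y1] x n1 y1 y2 by auto
    qed
    have "x \<noteq> x2"
      using g_mem[of x y1 x1' y1'] x n2 n1' y1 Csub by auto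
    have nx: "(x, y) \<in> M' \<longleftrightarrow> (x, y) \<in> C" for y
      using n3 \<open>x \<noteq> x1\<close> \<open>x \<noteq> x2\<close> \<open>x \<notin> X0\<close> mem2 by auto
    have "(x', y') \<in> M \<longleftrightarrow> (x, y') \<in> M" if "(x, y) \<in> M" "x' \<in> X" "(x', y) \<in> M" for y x' y'
    proof -
      have xy: "(x, y) \<in> C" "y \<notin> Y0" using that mem2 \<open>x \<notin> X0\<close> Csub by auto
      then have x': "x' \<notin> X0" using that(3) mem1 by blast
      have "x' \<noteq> x2"
      proof
        assume "x' = x2"
        show False
        proof (cases "y = y2")
          case True
          then show False using g_mem[of x y x1 y1'] x xy nx n1 y1 Csub by auto
        next
          case False
          then have "(x', y) \<in> M'" using that(3) n2 mem2 x2 \<open>x' = x2\<close> by auto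
          then show False using g_mem[of x y x' y1] x xy nx n2 y1 Csub \<open>x' = x2\<close> by auto
        qed
      qed
      then have "(x', y') \<in> M' \<longleftrightarrow> (x', y') \<in> M" for y'
        using n3[of x'] x' x1 \<open>x' \<noteq> x2\<close> by metis
      then show ?thesis using g_mem[of x y x' y'] x xy that nx mem2 \<open>x \<notin> X0\<close> by auto
    qed
    then show "x \<in> ?g M - X0"
      unfolding complete_component_verts_def using xX \<open>x \<notin> X0\<close> by blast
  qed
  have "X0 \<subseteq> ?g M"
    unfolding complete_component_verts_def using X0 mem1 mem2 Csub by blast
  then have "?g M' \<subset> ?g M" using sub x1 by blast
  moreover have "finite (?g M)" using fin by (simp add: complete_component_verts_def)
  ultimately show thesis using that[OF M M'] by (simp add: psubset_card_mono)
qed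

lemma biregular_complement:
  assumes "finite X" "finite Y" "biregular M X Y a b"
  shows "biregular (X \<times> Y - M) X Y (card Y - a) (card X - b)"
proof -
  have "card {y \<in> Y. (x, y) \<in> X \<times> Y - M} = card Y - a" if "x \<in> X" for x
  proof -
    have "{y \<in> Y. (x, y) \<in> X \<times> Y - M} = Y - {y \<in> Y. (x, y) \<in> M}" using that by auto
    then show ?thesis using that assms by (simp add: card_Diff_subset biregular_def)
  qed
  moreover have "card {x \<in> X. (x, y) \<in> X \<times> Y - M} = card X - b" if "y \<in> Y" for y
  proof -
    have "{x \<in> X. (x, y) \<in> X \<times> Y - M} = X - {x \<in> X. (x, y) \<in> M}" using that by auto
    then show ?thesis using that assms by (simp add: card_Diff_subset biregular_def)
  qed
  ultimately show ?thesis unfolding biregular_def by auto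
qed

lemma ex_nonisomorphic_biregular:
  assumes fin: "finite X" "finite Y" and eq: "card X * a = card Y * b"
    and ab: "2 \<le> a" "2 \<le> b" "a + 2 \<le> card Y" "b + 2 \<le> card X"
  obtains M M' where "biregular M X Y a b" "biregular M' X Y a b"
    "\<And>f h. bij_betw f X X \<Longrightarrow> bij_betw h Y Y \<Longrightarrow>
       (\<And>x y. x \<in> X \<Longrightarrow> y \<in> Y \<Longrightarrow> (x, y) \<in> M \<longleftrightarrow> (f x, h y) \<in> M') \<Longrightarrow> False"
proof (cases "2 * a \<le> card Y")
  case True
  then obtain M M' where "biregular M X Y a b" "biregular M' X Y a b"
    "card (complete_component_verts M' X Y) < card (complete_component_verts M X Y)"
    using ex_nonisomorphic_biregular_sparse[OF fin eq ab(1,2)] by blast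
  then show thesis using that complete_component_verts_iso by (metis less_irrefl)
next
  case False
  have "card X * (card Y - a) = card Y * (card X - b)"
    using eq by (simp add: diff_mult_distrib2 mult.commute)
  moreover have "2 \<le> card Y - a" "2 \<le> card X - b" "2 * (card Y - a) \<le> card Y"
    using ab False by auto
  ultimately obtain M M' where M: "biregular M X Y (card Y - a) (card X - b)"
      "biregular M' X Y (card Y - a) (card X - b)"
    and lt: "card (complete_component_verts M' X Y) < card (complete_component_verts M X Y)"
    using ex_nonisomorphic_biregular_sparse[OF fin] by blast
  have "biregular (X \<times> Y - M) X Y a b" "biregular (X \<times> Y - M') X Y a b"
    using biregular_complement[OF fin M(1)] biregular_complement[OF fin M(2)] ab by auto
  moreover have False
    if f: "bij_betw f X X" and h: "bij_betw h Y Y"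
      and iso: "\<And>x y. x \<in> X \<Longrightarrow> y \<in> Y \<Longrightarrow> (x, y) \<in> X \<times> Y - M \<longleftrightarrow> (f x, h y) \<in> X \<times> Y - M'" for f h
  proof -
    have "(x, y) \<in> M \<longleftrightarrow> (f x, h y) \<in> M'" if "x \<in> X" "y \<in> Y" for x y
      using iso[OF that] that bij_betwE[OF f] bij_betwE[OF h] by simp
    from complete_component_verts_iso[OF f h this] lt show False by simp
  qed
  ultimately show thesis using that by blast
qed

section \<open>Relations in varying relative position\<close>

definition alternating :: "'a set \<Rightarrow> ('a \<Rightarrow> 'a \<Rightarrow> bool) \<Rightarrow> bool" where
  "alternating X E \<longleftrightarrow> (\<exists>x\<in>X. \<exists>y\<in>X. \<exists>z\<in>X. \<exists>w\<in>X.
     distinct [x, y, z, w] \<and> E x z \<and> E y w \<and> \<not> E y z \<and> \<not> E x w)"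

lemma ex_permutes_map_eq:
  assumes "length xs = length ys" "distinct xs" "distinct ys" "set xs \<subseteq> X" "set ys \<subseteq> X"
  shows "\<exists>\<rho>. \<rho> permutes X \<and> map \<rho> xs = ys"
  using assms
proof (induction xs ys rule: list_induct2)
  case Nil
  then show ?case by (auto intro: permutes_id)
next
  case (Cons x xs y ys)
  then obtain \<rho> where \<rho>: "\<rho> permutes X" "map \<rho> xs = ys" by auto
  have "transpose (\<rho> x) y permutes X"
    using Cons.prems \<rho>(1) by (intro permutes_swap_id) (auto simp: permutes_in_image)
  then have "transpose (\<rho> x) y \<circ> \<rho> permutes X" using \<rho>(1) by (rule permutes_compose[rotated])
  moreover have "\<rho> x \<notin> set ys"
    using Cons.prems(1) \<rho> permutes_inj[OF \<rho>(1)] by (auto simp: inj_eq)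
  then have "map (transpose (\<rho> x) y \<circ> \<rho>) xs = map \<rho> xs"
    using Cons.prems(2) \<rho>(2) by (intro map_cong) (auto simp: transpose_def dest: rev_image_eqI[of _ _ _ \<rho>])
  then have "map (transpose (\<rho> x) y \<circ> \<rho>) xs = ys" using \<rho>(2) by simp
  ultimately have "transpose (\<rho> x) y \<circ> \<rho> permutes X \<and>
      map (transpose (\<rho> x) y \<circ> \<rho>) (x # xs) = y # ys" by simp
  then show ?case by (rule exI[of _ "transpose (\<rho> x) y \<circ> \<rho>"])
qed

text \<open>
  Summing the overlaps with signs over \<open>\<rho>\<close> composed with \<open>id\<close>, \<open>(x y)\<close>, \<open>(z w)\<close> and \<open>(x y)(z w)\<close>
  leaves only the pairs between \<open>{x, y}\<close> and \<open>{z, w}\<close>, which contribute 8.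
\<close>

lemma overlap_not_constant:
  assumes fin: "finite X"
    and sym: "\<And>u v. E u v \<Longrightarrow> E v u" "\<And>u v. E' u v \<Longrightarrow> E' v u"
    and alt: "alternating X E" "alternating X E'"
    and const: "\<And>\<sigma>. \<sigma> permutes X \<Longrightarrow> card {(u, v) \<in> X \<times> X. E u v \<and> E' (\<sigma> u) (\<sigma> v)} = N"
  shows False
proof -
  obtain x y z w where X: "x \<in> X" "y \<in> X" "z \<in> X" "w \<in> X" and d: "distinct [x, y, z, w]"
    and E: "E x z" "E y w" "\<not> E y z" "\<not> E x w"
    using alt(1) unfolding alternating_def by blast
  obtain x' y' z' w' where X': "x' \<in> X" "y' \<in> X" "z' \<in> X" "w' \<in> X" and d': "distinct [x', y', z', w']"
    and E': "E' x' z'" "E' y' w'" "\<not> E' y' z'" "\<not> E' x' w'"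
    using alt(2) unfolding alternating_def by blast
  obtain \<rho> where \<rho>: "\<rho> permutes X" "map \<rho> [x, y, z, w] = [x', y', z', w']"
    using ex_permutes_map_eq[of "[x, y, z, w]" "[x', y', z', w']" X] d d' X X' by auto
  define B where "B u v \<longleftrightarrow> E' (\<rho> u) (\<rho> v)" for u v
  have B: "B x z" "B y w" "\<not> B y z" "\<not> B x w" "B u v \<longleftrightarrow> B v u" for u v
    using \<rho>(2) E' sym(2) unfolding B_def by auto
  define b where "b u v = (of_bool (B u v) :: int)" for u v
  define e where "e u v = (of_bool (E u v) :: int)" for u v
  let ?a = "transpose x y" and ?c = "transpose z w"
  have sum: "(\<Sum>(u, v)\<in>X \<times> X. e u v * b (\<tau> u) (\<tau> v)) = int N" if "\<tau> permutes X" for \<tau>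
  proof -
    have "(\<Sum>(u, v)\<in>X \<times> X. e u v * b (\<tau> u) (\<tau> v)) =
        (\<Sum>p\<in>X \<times> X. of_bool (case p of (u, v) \<Rightarrow> E u v \<and> B (\<tau> u) (\<tau> v)))"
      by (rule sum.cong) (auto simp: e_def b_def)
    also have "\<dots> = int (card {p \<in> X \<times> X. case p of (u, v) \<Rightarrow> E u v \<and> B (\<tau> u) (\<tau> v)})"
      using fin by (simp add: sum.If_cases of_bool_def Int_def)
    also have "{p \<in> X \<times> X. case p of (u, v) \<Rightarrow> E u v \<and> B (\<tau> u) (\<tau> v)} =
        {(u, v) \<in> X \<times> X. E u v \<and> E' ((\<rho> \<circ> \<tau>) u) ((\<rho> \<circ> \<tau>) v)}"
      unfolding B_def by auto
    also have "card \<dots> = N"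
      using const[OF permutes_compose[OF that \<rho>(1)]] .
    finally show ?thesis .
  qed
  have a: "?a permutes X" and c: "?c permutes X" using X by (auto intro: permutes_swap_id)
  define g where "g u v = b u v - b (?a u) (?a v) - b (?c u) (?c v) + b (?a (?c u)) (?a (?c v))" for u v
  have "(\<Sum>(u, v)\<in>X \<times> X. e u v * g u v) = int N - int N - int N + int N"
    using sum[OF permutes_id] sum[OF a] sum[OF c] sum[OF permutes_compose[OF c a]]
    unfolding g_def by (simp add: split_def algebra_simps sum.distrib sum_subtractf)
  then have zero: "(\<Sum>(u, v)\<in>X \<times> X. e u v * g u v) = 0" by simp
  let ?S = "{x, y} \<times> {z, w} \<union> {z, w} \<times> {x, y}"
  have g0: "g u v = 0" if "(u, v) \<notin> ?S" for u v
  proof (cases "u \<notin> {z, w} \<and> v \<notin> {z, w}")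
    case True
    then show ?thesis unfolding g_def by (simp add: transpose_def)
  next
    case False
    then have "u \<notin> {x, y} \<and> v \<notin> {x, y}" using that d by auto
    then have "?a u = u" "?a v = v" "?a (?c u) = ?c u" "?a (?c v) = ?c v"
      using d by (auto simp: transpose_def)
    then show ?thesis unfolding g_def by simp
  qed
  have "(\<Sum>(u, v)\<in>X \<times> X. e u v * g u v) = (\<Sum>(u, v)\<in>?S. e u v * g u v)"
  proof (rule sum.mono_neutral_right)
    show "?S \<subseteq> X \<times> X" using X by auto
    show "\<forall>p\<in>X \<times> X - ?S. (case p of (u, v) \<Rightarrow> e u v * g u v) = 0"
    proof
      fix p assume p: "p \<in> X \<times> X - ?S"
      obtain u v where "p = (u, v)" by (cases p)
      with p g0[of u v] show "(case p of (u, v) \<Rightarrow> e u v * g u v) = 0" by (simp del: Un_iff)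
    qed
  qed (use fin in simp)
  also have "\<dots> = 8"
  proof -
    have tr: "?a x = y" "?a y = x" "?a z = z" "?a w = w" "?c z = w" "?c w = z" "?c x = x" "?c y = y"
      using d by (auto simp: transpose_def)
    have bv: "b x z = 1" "b y w = 1" "b y z = 0" "b x w = 0" "b z x = 1" "b w y = 1" "b z y = 0" "b w x = 0"
      using B unfolding b_def by auto
    have ev: "e x z = 1" "e y w = 1" "e y z = 0" "e x w = 0" "e z x = 1" "e w y = 1" "e z y = 0" "e w x = 0"
      using E sym(1) unfolding e_def by auto
    have gv: "g x z = 2" "g y w = 2" "g z x = 2" "g w y = 2"
      unfolding g_def tr bv by simp_all
    have "{x, y} \<times> {z, w} \<inter> {z, w} \<times> {x, y} = {}" using d by auto
    then have "(\<Sum>(u, v)\<in>?S. e u v * g u v) =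
        (\<Sum>u\<in>{x, y}. \<Sum>v\<in>{z, w}. e u v * g u v) + (\<Sum>u\<in>{z, w}. \<Sum>v\<in>{x, y}. e u v * g u v)"
      unfolding sum.cartesian_product by (intro sum.union_disjoint) auto
    also have "\<dots> = e x z * g x z + e x w * g x w + e y z * g y z + e y w * g y w
        + e z x * g z x + e z y * g z y + e w x * g w x + e w y * g w y"
      using d by simp
    finally have "(\<Sum>(u, v)\<in>?S. e u v * g u v) = e x z * g x z + e x w * g x w + e y z * g y z + e y w * g y w
        + e z x * g z x + e z y * g z y + e w x * g w x + e w y * g w y" .
    then show ?thesis unfolding ev gv by simp
  qed
  finally show False using zero by simp
qed

lemma overlap_contradiction:
  assumes "finite X" "\<And>u v. E u v \<Longrightarrow> E v u" "\<And>u v. E' u v \<Longrightarrow> E' v u" "alternating X E" "alternating X E'"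
    and tw: "\<And>\<sigma>. \<sigma> permutes X \<Longrightarrow> \<exists>f. inj f \<and> f ` X = X \<and> (\<forall>u\<in>X. \<forall>v\<in>X. E (f u) (f v) \<longleftrightarrow> E u v) \<and>
      (\<forall>u\<in>X. \<forall>v\<in>X. E' (\<sigma> (f u)) (\<sigma> (f v)) \<longleftrightarrow> E' u v)"
  shows False
proof (rule overlap_not_constant[OF assms(1-5)])
  fix \<sigma> assume "\<sigma> permutes X"
  from tw[OF this] obtain f where f: "inj f" "f ` X = X" "\<forall>u\<in>X. \<forall>v\<in>X. E (f u) (f v) \<longleftrightarrow> E u v"
    "\<forall>u\<in>X. \<forall>v\<in>X. E' (\<sigma> (f u)) (\<sigma> (f v)) \<longleftrightarrow> E' u v" by (elim exE conjE)
  have "map_prod f f ` {(u, v) \<in> X \<times> X. E u v \<and> E' u v} = {(u, v) \<in> X \<times> X. E u v \<and> E' (\<sigma> u) (\<sigma> v)}"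
  proof (intro set_eqI iffI)
    fix p assume p: "p \<in> {(u, v) \<in> X \<times> X. E u v \<and> E' (\<sigma> u) (\<sigma> v)}"
    obtain u v where uv: "p = (u, v)" by (cases p)
    then have "u \<in> f ` X" "v \<in> f ` X" using p f(2) by auto
    then obtain u' v' where "u' \<in> X" "v' \<in> X" "u = f u'" "v = f v'" by blast
    then show "p \<in> map_prod f f ` {(u, v) \<in> X \<times> X. E u v \<and> E' u v}"
      using p uv f(3,4) by (intro image_eqI[of _ _ "(u', v')"]) auto
  next
    fix p assume "p \<in> map_prod f f ` {(u, v) \<in> X \<times> X. E u v \<and> E' u v}"
    then obtain u v where uv: "u \<in> X" "v \<in> X" "E u v" "E' u v" "p = (f u, f v)" by auto
    then have "f u \<in> X" "f v \<in> X" using f(2) by blast+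
    then show "p \<in> {(u, v) \<in> X \<times> X. E u v \<and> E' (\<sigma> u) (\<sigma> v)}" using uv f(3,4) by auto
  qed
  moreover have "card (map_prod f f ` {(u, v) \<in> X \<times> X. E u v \<and> E' u v}) = card {(u, v) \<in> X \<times> X. E u v \<and> E' u v}"
    by (rule card_image) (meson f(1) inj_on_subset prod.inj_map subset_UNIV)
  ultimately show "card {(u, v) \<in> X \<times> X. E u v \<and> E' (\<sigma> u) (\<sigma> v)} = card {(u, v) \<in> X \<times> X. E u v \<and> E' u v}"
    by simp
qed

lemma agreement_not_constant:
  assumes "finite Y" and q: "q ` Y = R" "q' ` Y = R" and r: "r \<in> R" "r' \<in> R" "r \<noteq> r'"
    and const: "\<And>\<sigma>. \<sigma> permutes Y \<Longrightarrow> card {u \<in> Y. q (\<sigma> u) = q' u} = N"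
  shows False
proof -
  have "r \<in> q' ` Y" "r' \<in> q' ` Y" using q(2) r by auto
  then obtain u w where uw: "u \<in> Y" "w \<in> Y" "q' u = r" "q' w = r'" by blast
  have "r \<in> q ` Y" "r' \<in> q ` Y" using q(1) r by auto
  then obtain a b where ab: "a \<in> Y" "b \<in> Y" "q a = r" "q b = r'" by blast
  have "u \<noteq> w" "a \<noteq> b" using uw ab r(3) by auto
  then obtain \<sigma> where \<sigma>: "\<sigma> permutes Y" "map \<sigma> [u, w] = [a, b]"
    using ex_permutes_map_eq[of "[u, w]" "[a, b]" Y] uw ab by auto
  have "{t \<in> Y. q ((\<sigma> \<circ> transpose u w) t) = q' t} = {t \<in> Y. q (\<sigma> t) = q' t} - {u, w}"
    using uw ab \<sigma>(2) r(3) by (auto simp: transpose_def)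
  moreover have "u \<in> {t \<in> Y. q (\<sigma> t) = q' t}" using uw ab \<sigma>(2) by auto
  ultimately have "{t \<in> Y. q ((\<sigma> \<circ> transpose u w) t) = q' t} \<subset> {t \<in> Y. q (\<sigma> t) = q' t}" by blast
  then have "card {t \<in> Y. q ((\<sigma> \<circ> transpose u w) t) = q' t} < card {t \<in> Y. q (\<sigma> t) = q' t}"
    using assms(1) by (intro psubset_card_mono) auto
  moreover have "\<sigma> \<circ> transpose u w permutes Y"
    using uw \<sigma>(1) by (intro permutes_compose permutes_swap_id)
  ultimately show False using const \<sigma>(1) by (metis less_irrefl)
qed

lemma alternating_regular:
  assumes fin: "finite R"
    and sym: "\<And>u v. E u v \<Longrightarrow> E v u" and irr: "\<And>u. \<not> E u u"
    and reg: "\<And>u v. u \<in> R \<Longrightarrow> v \<in> R \<Longrightarrow> card {w \<in> R. E u w} = card {w \<in> R. E v w}"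
    and ne: "p \<in> R" "p' \<in> R" "E p p'" and nc: "t \<in> R" "t' \<in> R" "t \<noteq> t'" "\<not> E t t'"
  shows "alternating R E"
proof -
  have "card {w \<in> R. E p w} > 0" using ne fin by (auto simp: card_gt_0_iff)
  then have "card {w \<in> R. E t w} > 0" using reg[OF ne(1) nc(1)] by simp
  then obtain r where r: "r \<in> R" "E t r" by (auto simp: card_gt_0_iff)
  note r' = nc(2) nc(4)
  let ?N = "\<lambda>u. {w \<in> R. E u w}"
  have "card (?N r) = card (?N t')" using reg r(1) nc(2) by blast
  then have eq: "card (?N r - ?N t') = card (?N t' - ?N r)"
    using fin by (simp add: card_Diff_subset_Int Int_commute)
  have tN: "t \<in> ?N r - ?N t'" using nc r sym by blast
  obtain s' where s': "s' \<in> ?N t' - ?N r" "s' \<noteq> r"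
  proof (cases "E r t'")
    case True
    then have "{t, t'} \<subseteq> ?N r - ?N t'" using tN nc(2) irr by auto
    then have "card {t, t'} \<le> card (?N r - ?N t')" using fin by (intro card_mono) auto
    then have "2 \<le> card (?N t' - ?N r)" using eq nc(3) by simp
    then have "\<not> ?N t' - ?N r \<subseteq> {r}" using card_mono[of "{r}" "?N t' - ?N r"] by auto
    then show thesis using that by blast
  next
    case False
    have "finite (?N r - ?N t')" using fin by simp
    then have "card (?N r - ?N t') > 0" using tN card_gt_0_iff by blast
    then have "?N t' - ?N r \<noteq> {}" unfolding eq using card_gt_0_iff by blast
    then obtain s' where "s' \<in> ?N t' - ?N r" by blast
    moreover have "s' \<noteq> r" using calculation False sym by blast
    ultimately show thesis using that by blast
  qed
  have "E r t" using sym[OF r(2)] .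
  have "E t' s'" "\<not> E r s'" "s' \<in> R" using s' by auto
  moreover have "\<not> E t' t" using sym nc(4) by blast
  moreover have "r \<noteq> t'" "r \<noteq> t" "t' \<noteq> s'" "t \<noteq> s'"
    using r(2) nc(4) irr calculation by metis+
  ultimately have "distinct [r, t', t, s'] \<and> E r t \<and> E t' s' \<and> \<not> E t' t \<and> \<not> E r s'"
    using \<open>E r t\<close> nc(3) s'(2) by simp
  then show ?thesis unfolding alternating_def
    using r(1) nc(1,2) \<open>s' \<in> R\<close> by (intro bexI[of _ r] bexI[of _ t'] bexI[of _ t] bexI[of _ s'])
qed

lemma alternating_vimage:
  assumes "alternating R S" "q ` X = R"
  shows "alternating X (\<lambda>u v. S (q u) (q v))"
proof -
  obtain x y z w where X: "x \<in> R" "y \<in> R" "z \<in> R" "w \<in> R" "distinct [x, y, z, w]"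
    and S: "S x z" "S y w" "\<not> S y z" "\<not> S x w"
    using assms(1) unfolding alternating_def by blast
  have "x \<in> q ` X" "y \<in> q ` X" "z \<in> q ` X" "w \<in> q ` X" using X assms(2) by auto
  then obtain x' y' z' w' where "x' \<in> X" "y' \<in> X" "z' \<in> X" "w' \<in> X" "q x' = x" "q y' = y" "q z' = z" "q w' = w"
    by blast
  with X S show ?thesis unfolding alternating_def by (intro bexI[of _ x'] bexI[of _ y'] bexI[of _ z'] bexI[of _ w']) auto
qed

lemma alternating_kernel:
  assumes "r \<in> R" "r' \<in> R" "r \<noteq> r'" and fib: "\<And>r. r \<in> R \<Longrightarrow> card {u \<in> X. q u = r} \<ge> 2"
  shows "alternating X (\<lambda>u v. q u = q v)"
proof -
  have two: "\<exists>u\<in>X. \<exists>v\<in>X. u \<noteq> v \<and> q u = s \<and> q v = s" if s: "s \<in> R" for s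
  proof -
    obtain u v where "u \<in> {u \<in> X. q u = s}" "v \<in> {u \<in> X. q u = s}" "u \<noteq> v"
      using fib[OF s] by (metis (no_types, lifting) card_le_Suc0_iff_eq card.infinite not_less_eq_eq numeral_2_eq_2 zero_le)
    then show ?thesis by blast
  qed
  obtain x z where "x \<in> X" "z \<in> X" "x \<noteq> z" "q x = r" "q z = r" using two assms(1) by metis
  moreover obtain y w where "y \<in> X" "w \<in> X" "y \<noteq> w" "q y = r'" "q w = r'" using two assms(2) by metis
  ultimately show ?thesis using assms(3) unfolding alternating_def
    by (intro bexI[of _ x] bexI[of _ y] bexI[of _ z] bexI[of _ w]) auto
qed

section \<open>Pairs of cells of an amenable graph\<close>

lemma card_Collect_eq_1_iff: "card {u \<in> S. \<phi> u} = 1 \<longleftrightarrow> (\<exists>!u. u \<in> S \<and> \<phi> u)"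
proof
  assume "card {u \<in> S. \<phi> u} = 1"
  then obtain u where "{u \<in> S. \<phi> u} = {u}" by (rule card_1_singletonE)
  then show "\<exists>!u. u \<in> S \<and> \<phi> u" by (intro ex1I[of _ u]) blast+
next
  assume "\<exists>!u. u \<in> S \<and> \<phi> u"
  then obtain u where "u \<in> S \<and> \<phi> u" "\<forall>v. v \<in> S \<and> \<phi> v \<longrightarrow> v = u" by (rule ex1E)
  then have "{u \<in> S. \<phi> u} = {u}" by blast
  then show "card {u \<in> S. \<phi> u} = 1" by simp
qed

lemma stars_centered_iff_card:
  "stars_centered E X Y \<longleftrightarrow> (\<exists>t\<ge>1. \<forall>x\<in>X. card {y \<in> Y. (x, y) \<in> E} = t) \<and>
     (\<forall>y\<in>Y. card {x \<in> X. (y, x) \<in> E} = 1)"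
  unfolding stars_centered_def card_Collect_eq_1_iff ..

locale amenable_graph = pair_graph G for G :: "'a pair_pre_digraph" +
  assumes amenable: "amenable G"
begin

abbreviation "P \<equiv> stable_partition G"

lemma arc_sym: "(u, v) \<in> parcs G \<Longrightarrow> (v, u) \<in> parcs G"
  using pair_sym_arcs by (auto simp: symmetric_def dest: symD)

lemma arc_sym_iff: "(u, v) \<in> parcs G \<longleftrightarrow> (v, u) \<in> parcs G"
  using arc_sym by blast

lemma arc_irrefl: "(u, u) \<notin> parcs G"
  using pair_no_loops[of "(u, u)"] by auto

lemma cell_subset: "X \<in> P \<Longrightarrow> X \<subseteq> pverts G"
  using Union_stable_partition[OF pair_finite_verts] by auto

lemma cell_finite: "X \<in> P \<Longrightarrow> finite X"
  using cell_subset pair_finite_verts finite_subset by blast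

lemma cell_nonempty: "X \<in> P \<Longrightarrow> X \<noteq> {}"
  by (rule stable_cell_nonempty[OF pair_finite_verts])

lemma cell_card_pos: "X \<in> P \<Longrightarrow> card X > 0"
  using cell_finite cell_nonempty by (simp add: card_gt_0_iff)

lemma cell_unique: "X \<in> P \<Longrightarrow> Y \<in> P \<Longrightarrow> u \<in> X \<Longrightarrow> u \<in> Y \<Longrightarrow> X = Y"
  using stable_cells_disjoint[OF pair_finite_verts] by blast

lemma equitable:
  "X \<in> P \<Longrightarrow> C \<in> P \<Longrightarrow> u \<in> X \<Longrightarrow> v \<in> X \<Longrightarrow>
    card {w \<in> C. (u, w) \<in> parcs G} = card {w \<in> C. (v, w) \<in> parcs G}"
  by (rule stable_partition_equitable[OF pair_finite_verts])

lemma rewire_pair: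
  assumes X: "X \<in> P" and Y: "Y \<in> P" and XY: "X \<noteq> Y" and M: "M \<subseteq> X \<times> Y"
    and row: "\<And>x. x \<in> X \<Longrightarrow> card {y \<in> Y. (x, y) \<in> M} = card {y \<in> Y. (x, y) \<in> parcs G}"
    and col: "\<And>y. y \<in> Y \<Longrightarrow> card {x \<in> X. (x, y) \<in> M} = card {x \<in> X. (x, y) \<in> parcs G}"
  obtains f where "f permutes pverts G" "\<And>C. C \<in> P \<Longrightarrow> f ` C = C"
    "\<And>x y. x \<in> X \<Longrightarrow> y \<in> Y \<Longrightarrow> (f x, f y) \<in> M \<longleftrightarrow> (x, y) \<in> parcs G"
    "\<And>u v. u \<in> pverts G \<Longrightarrow> v \<in> pverts G \<Longrightarrow> \<not> (u \<in> X \<and> v \<in> Y) \<Longrightarrow> \<not> (u \<in> Y \<and> v \<in> X) \<Longrightarrow>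
       (f u, f v) \<in> parcs G \<longleftrightarrow> (u, v) \<in> parcs G"
proof -
  have disj: "X \<inter> Y = {}" using cell_unique X Y XY by blast
  define G' where "G' = \<lparr>pverts = pverts G, parcs = (parcs G - (X \<times> Y \<union> Y \<times> X)) \<union> (M \<union> M\<inverse>)\<rparr>"
  have V: "pverts G' = pverts G" by (simp add: G'_def)
  have arcs: "(u, v) \<in> parcs G' \<longleftrightarrow> (if u \<in> X \<and> v \<in> Y then (u, v) \<in> M
      else if u \<in> Y \<and> v \<in> X then (v, u) \<in> M else (u, v) \<in> parcs G)" for u v
    using M disj by (auto simp: G'_def)
  have G': "pair_graph G'"
  proof
    fix e assume e: "e \<in> parcs G'"
    obtain u v where uv: "e = (u, v)" by (cases e)
    have sub: "u \<in> pverts G \<and> v \<in> pverts G \<and> u \<noteq> v"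
    proof (cases "(u, v) \<in> parcs G")
      case True
      then show ?thesis using in_arcsD1 in_arcsD2 arc_irrefl by blast
    next
      case False
      then have "(u, v) \<in> X \<times> Y \<union> Y \<times> X" using e arcs[of u v] uv by (auto split: if_splits)
      then show ?thesis using disj cell_subset[OF X] cell_subset[OF Y] by blast
    qed
    then show "fst e \<in> pverts G'" "snd e \<in> pverts G'" "fst e \<noteq> snd e" using uv V by auto
  next
    show "finite (pverts G')" using pair_finite_verts V by simp
    have "M \<subseteq> pverts G \<times> pverts G" using M cell_subset[OF X] cell_subset[OF Y] by blast
    then have "finite M" using pair_finite_verts finite_subset by blast
    then show "finite (parcs G')" using pair_finite_arcs by (simp add: G'_def)
    have "sym (parcs G')" using arc_sym by (auto simp: G'_def sym_def)
    then show "symmetric (with_proj G')" by (simp add: symmetric_def)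
  qed
  have deg: "card {w \<in> C. (u, w) \<in> parcs G'} = card {w \<in> C. (u, w) \<in> parcs G}"
    if u: "u \<in> pverts G" and C: "C \<in> P" for u C
  proof -
    consider "u \<in> X" "C = Y" | "u \<in> Y" "C = X" | "\<not> (u \<in> X \<and> C = Y)" "\<not> (u \<in> Y \<and> C = X)" by blast
    then show ?thesis
    proof cases
      case 1
      then have "{w \<in> C. (u, w) \<in> parcs G'} = {y \<in> Y. (u, y) \<in> M}" by (auto simp: arcs)
      then show ?thesis using 1 row by simp
    next
      case 2
      then have "{w \<in> C. (u, w) \<in> parcs G'} = {x \<in> X. (x, u) \<in> M}" using disj by (auto simp: arcs)
      then show ?thesis using 2 col by (simp add: arc_sym_iff)
    next
      case 3
      have "(u, w) \<in> parcs G' \<longleftrightarrow> (u, w) \<in> parcs G" if "w \<in> C" for w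
        using 3 that cell_unique[OF C] X Y arcs[of u w] by auto
      then show ?thesis by (metis (no_types, lifting) Collect_cong)
    qed
  qed
  obtain f where f: "f permutes pverts G" "\<And>C. C \<in> P \<Longrightarrow> f ` C = C"
    "\<And>u v. u \<in> pverts G \<Longrightarrow> v \<in> pverts G \<Longrightarrow> (f u, f v) \<in> parcs G' \<longleftrightarrow> (u, v) \<in> parcs G"
    using amenable_rewiring[OF pair_graph_axioms amenable G' V deg] by blast
  have mem: "f u \<in> C \<longleftrightarrow> u \<in> C" if "C \<in> P" for u C
    using f(2)[OF that] permutes_inj[OF f(1)] by (metis inj_image_mem_iff)
  show thesis
  proof (rule that[OF f(1,2)])
    show "(f x, f y) \<in> M \<longleftrightarrow> (x, y) \<in> parcs G" if "x \<in> X" "y \<in> Y" for x y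
    proof -
      have "(f x, f y) \<in> parcs G' \<longleftrightarrow> (x, y) \<in> parcs G"
        using f(3) that cell_subset[OF X] cell_subset[OF Y] by blast
      then show ?thesis using that mem[OF X] mem[OF Y] arcs[of "f x" "f y"] by simp
    qed
    show "(f u, f v) \<in> parcs G \<longleftrightarrow> (u, v) \<in> parcs G"
      if "u \<in> pverts G" "v \<in> pverts G" "\<not> (u \<in> X \<and> v \<in> Y)" "\<not> (u \<in> Y \<and> v \<in> X)" for u v
      using f(3)[OF that(1,2)] that(3,4) mem[OF X] mem[OF Y] arcs[of "f u" "f v"] by simp
  qed
qed

text \<open>\<open>f\<close> maps \<open>G\<close> to the graph in which the bipartite graph between \<open>X\<close> and \<open>Y\<close> is permuted on the side \<open>Y\<close>.\<close>

definition twisting :: "'a set \<Rightarrow> 'a set \<Rightarrow> ('a \<Rightarrow> 'a) \<Rightarrow> ('a \<Rightarrow> 'a) \<Rightarrow> bool" where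
  "twisting X Y \<sigma> f \<longleftrightarrow> f permutes pverts G \<and> (\<forall>C\<in>P. f ` C = C) \<and>
     (\<forall>x\<in>X. \<forall>y\<in>Y. (f x, \<sigma> (f y)) \<in> parcs G \<longleftrightarrow> (x, y) \<in> parcs G) \<and>
     (\<forall>u\<in>pverts G. \<forall>v\<in>pverts G. \<not> (u \<in> X \<and> v \<in> Y) \<and> \<not> (u \<in> Y \<and> v \<in> X) \<longrightarrow>
       ((f u, f v) \<in> parcs G \<longleftrightarrow> (u, v) \<in> parcs G))"

lemma twistingD:
  assumes "twisting X Y \<sigma> f"
  shows "f permutes pverts G" "\<And>C. C \<in> P \<Longrightarrow> f ` C = C"
    "\<And>x y. x \<in> X \<Longrightarrow> y \<in> Y \<Longrightarrow> (f x, \<sigma> (f y)) \<in> parcs G \<longleftrightarrow> (x, y) \<in> parcs G"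
    "\<And>u v. u \<in> pverts G \<Longrightarrow> v \<in> pverts G \<Longrightarrow> \<not> (u \<in> X \<and> v \<in> Y) \<Longrightarrow> \<not> (u \<in> Y \<and> v \<in> X) \<Longrightarrow>
       (f u, f v) \<in> parcs G \<longleftrightarrow> (u, v) \<in> parcs G"
  using assms unfolding twisting_def by simp_all

lemma ex_twisting:
  assumes X: "X \<in> P" and Y: "Y \<in> P" and XY: "X \<noteq> Y" and \<sigma>: "\<sigma> permutes Y"
  shows "\<exists>f. twisting X Y \<sigma> f"
proof -
  define M where "M = {(x, y) \<in> X \<times> Y. (x, \<sigma> y) \<in> parcs G}"
  have \<sigma>Y: "\<sigma> y \<in> Y \<longleftrightarrow> y \<in> Y" for y using \<sigma> by (simp add: permutes_in_image)
  have row: "card {y \<in> Y. (x, y) \<in> M} = card {y \<in> Y. (x, y) \<in> parcs G}" if "x \<in> X" for x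
  proof -
    have "\<sigma> ` {y \<in> Y. (x, y) \<in> M} = {y \<in> Y. (x, y) \<in> parcs G}"
    proof (intro set_eqI iffI)
      fix y assume y: "y \<in> {y \<in> Y. (x, y) \<in> parcs G}"
      then obtain y' where "y' \<in> Y" "y = \<sigma> y'" using permutes_image[OF \<sigma>] by blast
      with y that show "y \<in> \<sigma> ` {y \<in> Y. (x, y) \<in> M}" unfolding M_def by blast
    qed (auto simp: M_def \<sigma>Y)
    moreover have "card (\<sigma> ` {y \<in> Y. (x, y) \<in> M}) = card {y \<in> Y. (x, y) \<in> M}"
      by (rule card_image) (meson \<sigma> permutes_inj inj_on_subset subset_UNIV)
    ultimately show ?thesis by simp
  qed
  have col: "card {x \<in> X. (x, y) \<in> M} = card {x \<in> X. (x, y) \<in> parcs G}" if y: "y \<in> Y" for y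
  proof -
    have "{x \<in> X. (x, y) \<in> M} = {x \<in> X. (\<sigma> y, x) \<in> parcs G}"
      unfolding M_def using y arc_sym_iff by auto
    moreover have "{x \<in> X. (x, y) \<in> parcs G} = {x \<in> X. (y, x) \<in> parcs G}" using arc_sym_iff by blast
    ultimately show ?thesis using equitable[OF Y X, of "\<sigma> y" y] y \<sigma>Y by simp
  qed
  have "M \<subseteq> X \<times> Y" by (auto simp: M_def)
  from rewire_pair[OF X Y XY this row col] obtain f where f: "f permutes pverts G" "\<And>C. C \<in> P \<Longrightarrow> f ` C = C"
    "\<And>x y. x \<in> X \<Longrightarrow> y \<in> Y \<Longrightarrow> (f x, f y) \<in> M \<longleftrightarrow> (x, y) \<in> parcs G"
    "\<And>u v. u \<in> pverts G \<Longrightarrow> v \<in> pverts G \<Longrightarrow> \<not> (u \<in> X \<and> v \<in> Y) \<Longrightarrow> \<not> (u \<in> Y \<and> v \<in> X) \<Longrightarrow>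
       (f u, f v) \<in> parcs G \<longleftrightarrow> (u, v) \<in> parcs G" by metis
  have "(f x, \<sigma> (f y)) \<in> parcs G \<longleftrightarrow> (x, y) \<in> parcs G" if "x \<in> X" "y \<in> Y" for x y
  proof -
    have "f x \<in> X" "f y \<in> Y" using f(2)[OF X] f(2)[OF Y] that by blast+
    then show ?thesis using f(3)[OF that] by (simp add: M_def)
  qed
  with f have "twisting X Y \<sigma> f" unfolding twisting_def by simp
  then show ?thesis by blast
qed

lemma aniso_sym: "(X, Y) \<in> aniso_rel G \<Longrightarrow> (Y, X) \<in> aniso_rel G"
  unfolding aniso_rel_def isotropic_def bip_empty_def bip_complete_def using arc_sym by blast

lemma anisoD: "(X, Y) \<in> aniso_rel G \<Longrightarrow> X \<in> P \<and> Y \<in> P \<and> X \<noteq> Y \<and> \<not> isotropic G X Y"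
  unfolding aniso_rel_def by auto

lemma aniso_card: "(X, Y) \<in> aniso_rel G \<Longrightarrow> card X \<ge> 2"
proof (rule ccontr)
  assume XY: "(X, Y) \<in> aniso_rel G" and "\<not> card X \<ge> 2"
  note D = anisoD[OF XY]
  have "card X = 1" using cell_card_pos[of X] D \<open>\<not> card X \<ge> 2\<close> by linarith
  then obtain x where x: "X = {x}" by (auto simp: card_1_singleton_iff)
  have "(x, v) \<in> parcs G \<longleftrightarrow> (x, w) \<in> parcs G" if "v \<in> Y" "w \<in> Y" for v w
  proof -
    have "card {u \<in> X. (v, u) \<in> parcs G} = card {u \<in> X. (w, u) \<in> parcs G}"
      using equitable[of Y X v w] D that by blast
    moreover have "card {u \<in> X. (z, u) \<in> parcs G} = (if (x, z) \<in> parcs G then 1 else 0)" for z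
    proof -
      have "{u \<in> X. (z, u) \<in> parcs G} = (if (x, z) \<in> parcs G then {x} else {})"
        unfolding x using arc_sym_iff[of x z] by auto
      then show ?thesis by simp
    qed
    ultimately show ?thesis by (auto split: if_splits)
  qed
  then have "isotropic G X Y" unfolding isotropic_def bip_empty_def bip_complete_def x by blast
  then show False using D by blast
qed

lemma star_forest_pair:
  assumes XY: "(X, Y) \<in> aniso_rel G"
  shows "star_forest (parcs G) X Y \<or> star_forest (bip_complement G X Y) X Y"
proof (rule ccontr)
  assume no: "\<not> ?thesis"
  note D = anisoD[OF XY]
  have X: "X \<in> P" and Y: "Y \<in> P" and ne: "X \<noteq> Y" using D by auto
  have fin: "finite X" "finite Y" using cell_finite X Y by auto
  have disj: "X \<inter> Y = {}" using cell_unique X Y ne by blast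
  obtain x0 y0 where x0: "x0 \<in> X" and y0: "y0 \<in> Y" using cell_nonempty X Y by blast
  define a where "a = card {y \<in> Y. (x0, y) \<in> parcs G}"
  define b where "b = card {x \<in> X. (y0, x) \<in> parcs G}"
  have a: "card {y \<in> Y. (x, y) \<in> parcs G} = a" if "x \<in> X" for x
    unfolding a_def by (rule equitable[OF X Y that x0])
  have b: "card {x \<in> X. (y, x) \<in> parcs G} = b" if "y \<in> Y" for y
    unfolding b_def by (rule equitable[OF Y X that y0])
  have b': "card {x \<in> X. (x, y) \<in> parcs G} = b" if "y \<in> Y" for y
    using b[OF that] arc_sym_iff by simp
  have bireg: "biregular (parcs G \<inter> X \<times> Y) X Y a b"
  proof -
    have "{y \<in> Y. (x, y) \<in> parcs G \<inter> X \<times> Y} = {y \<in> Y. (x, y) \<in> parcs G}" if "x \<in> X" for x using that by auto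
    moreover have "{x \<in> X. (x, y) \<in> parcs G \<inter> X \<times> Y} = {x \<in> X. (x, y) \<in> parcs G}" if "y \<in> Y" for y using that by auto
    ultimately show ?thesis unfolding biregular_def using a b' by simp
  qed
  have count: "card X * a = card Y * b" by (rule biregular_double_count[OF fin bireg])
  have a_le: "a \<le> card Y" and b_le: "b \<le> card X"
    unfolding a_def b_def using fin by (auto intro: card_mono)
  have pos: "card X > 0" "card Y > 0" using cell_card_pos X Y by auto
  have "a \<noteq> 0"
  proof
    assume "a = 0"
    then have "bip_empty G X Y" using a fin unfolding bip_empty_def by auto
    then show False using D by (simp add: isotropic_def)
  qed
  have "b \<noteq> 0" using count \<open>a \<noteq> 0\<close> pos by (intro notI) simp
  have compl: "card {y \<in> Y. (x, y) \<in> bip_complement G X Y} = card Y - a" if "x \<in> X" for x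
  proof -
    have "{y \<in> Y. (x, y) \<in> bip_complement G X Y} = Y - {y \<in> Y. (x, y) \<in> parcs G}"
      using that unfolding bip_complement_def by auto
    then show ?thesis using a[OF that] fin by (simp add: card_Diff_subset)
  qed
  have compl': "card {x \<in> X. (y, x) \<in> bip_complement G X Y} = card X - b" if "y \<in> Y" for y
  proof -
    have "{x \<in> X. (y, x) \<in> bip_complement G X Y} = X - {x \<in> X. (y, x) \<in> parcs G}"
      using that unfolding bip_complement_def by auto
    then show ?thesis using b[OF that] fin by (simp add: card_Diff_subset)
  qed
  have "a \<noteq> card Y"
  proof
    assume "a = card Y"
    have "bip_complete G X Y"
      unfolding bip_complete_def
    proof (intro ballI)
      fix u v assume "u \<in> X" "v \<in> Y"
      have "{y \<in> Y. (u, y) \<in> parcs G} = Y"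
        using a[OF \<open>u \<in> X\<close>] \<open>a = card Y\<close> fin by (intro card_subset_eq) auto
      then show "(u, v) \<in> parcs G" using \<open>v \<in> Y\<close> by blast
    qed
    then show False using D by (simp add: isotropic_def)
  qed
  have "b \<noteq> card X" using count \<open>a \<noteq> card Y\<close> pos by (auto simp: mult.commute)
  have "a \<noteq> 1"
  proof
    assume "a = 1"
    then have "stars_centered (parcs G) Y X"
      unfolding stars_centered_iff_card using a b \<open>b \<noteq> 0\<close> by (intro conjI exI[of _ b]) auto
    then show False using no by (simp add: star_forest_def)
  qed
  moreover have "b \<noteq> 1"
  proof
    assume "b = 1"
    then have "stars_centered (parcs G) X Y"
      unfolding stars_centered_iff_card using a b \<open>a \<noteq> 0\<close> by (intro conjI exI[of _ a]) auto
    then show False using no by (simp add: star_forest_def)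
  qed
  moreover have "card Y - a \<noteq> 1"
  proof
    assume "card Y - a = 1"
    then have "stars_centered (bip_complement G X Y) Y X"
      unfolding stars_centered_iff_card using compl compl' \<open>b \<noteq> card X\<close> b_le
      by (intro conjI exI[of _ "card X - b"]) auto
    then show False using no by (simp add: star_forest_def)
  qed
  moreover have "card X - b \<noteq> 1"
  proof
    assume "card X - b = 1"
    then have "stars_centered (bip_complement G X Y) X Y"
      unfolding stars_centered_iff_card using compl compl' \<open>a \<noteq> card Y\<close> a_le
      by (intro conjI exI[of _ "card Y - a"]) auto
    then show False using no by (simp add: star_forest_def)
  qed
  ultimately have "2 \<le> a" "2 \<le> b" "a + 2 \<le> card Y" "b + 2 \<le> card X"
    using \<open>a \<noteq> 0\<close> \<open>b \<noteq> 0\<close> \<open>a \<noteq> card Y\<close> \<open>b \<noteq> card X\<close> a_le b_le by linarith+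
  from ex_nonisomorphic_biregular[OF fin count this] obtain M M' where
    M: "biregular M X Y a b" "biregular M' X Y a b"
    and noniso: "\<And>f h. bij_betw f X X \<Longrightarrow> bij_betw h Y Y \<Longrightarrow>
       (\<And>x y. x \<in> X \<Longrightarrow> y \<in> Y \<Longrightarrow> (x, y) \<in> M \<longleftrightarrow> (f x, h y) \<in> M') \<Longrightarrow> False" by metis
  have iso: "\<exists>f. f permutes pverts G \<and> (\<forall>C\<in>P. f ` C = C) \<and> (\<forall>x\<in>X. \<forall>y\<in>Y. (f x, f y) \<in> M \<longleftrightarrow> (x, y) \<in> parcs G)"
    if "biregular M X Y a b" for M
  proof -
    have "M \<subseteq> X \<times> Y" "\<And>x. x \<in> X \<Longrightarrow> card {y \<in> Y. (x, y) \<in> M} = card {y \<in> Y. (x, y) \<in> parcs G}"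
      "\<And>y. y \<in> Y \<Longrightarrow> card {x \<in> X. (x, y) \<in> M} = card {x \<in> X. (x, y) \<in> parcs G}"
      using that a b' by (simp_all add: biregular_def)
    note facts = this
    show ?thesis
    proof (rule rewire_pair[OF X Y ne facts])
      fix f assume "f permutes pverts G" "\<And>C. C \<in> P \<Longrightarrow> f ` C = C"
        "\<And>x y. x \<in> X \<Longrightarrow> y \<in> Y \<Longrightarrow> (f x, f y) \<in> M \<longleftrightarrow> (x, y) \<in> parcs G"
      then show ?thesis by (intro exI[of _ f]) simp
    qed
  qed
  obtain f where f: "f permutes pverts G" "\<forall>C\<in>P. f ` C = C"
    "\<forall>x\<in>X. \<forall>y\<in>Y. (f x, f y) \<in> M \<longleftrightarrow> (x, y) \<in> parcs G" using iso[OF M(1)] by (elim exE conjE)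
  obtain f' where f': "f' permutes pverts G" "\<forall>C\<in>P. f' ` C = C"
    "\<forall>x\<in>X. \<forall>y\<in>Y. (f' x, f' y) \<in> M' \<longleftrightarrow> (x, y) \<in> parcs G" using iso[OF M(2)] by (elim exE conjE)
  have inv: "f (inv f u) = u" for u using permutes_inverses(1)[OF f(1)] .
  have invC: "inv f ` C = C" if "C \<in> P" for C
    using f(2) that permutes_inj[OF f(1)] by (metis image_inv_f_f)
  have bij: "bij_betw (f' \<circ> inv f) C C" if "C \<in> P" for C
    unfolding bij_betw_def
  proof
    show "inj_on (f' \<circ> inv f) C"
      using permutes_inj[OF f'(1)] permutes_inj[OF permutes_inv[OF f(1)]] by (meson inj_compose inj_on_subset subset_UNIV)
    show "(f' \<circ> inv f) ` C = C" using invC f'(2) that by (metis image_comp)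
  qed
  show False
  proof (rule noniso[OF bij[OF X] bij[OF Y]])
    fix x y assume xy: "x \<in> X" "y \<in> Y"
    then have "inv f x \<in> X" "inv f y \<in> Y" using invC X Y by blast+
    then show "(x, y) \<in> M \<longleftrightarrow> ((f' \<circ> inv f) x, (f' \<circ> inv f) y) \<in> M'"
      using f(3) f'(3) inv by (metis comp_apply)
  qed
qed

definition flipped :: "'a set \<Rightarrow> 'a set \<Rightarrow> bool" where
  "flipped X Y \<longleftrightarrow> star_forest (bip_complement G X Y) X Y"

lemma flipped_sym: "flipped X Y \<longleftrightarrow> flipped Y X"
proof -
  have "bip_complement G X Y = bip_complement G Y X" unfolding bip_complement_def by blast
  then show ?thesis unfolding flipped_def star_forest_def by auto
qed

definition link :: "'a set \<Rightarrow> 'a set \<Rightarrow> ('a \<times> 'a) set" where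
  "link X Y = {(x, y) \<in> X \<times> Y. (x, y) \<in> parcs G \<longleftrightarrow> \<not> flipped X Y}"

lemma link_sym: "(x, y) \<in> link X Y \<longleftrightarrow> (y, x) \<in> link Y X"
  unfolding link_def using flipped_sym arc_sym_iff by auto

lemma pair_arcs_eq_link:
  assumes "(X, Y) \<in> aniso_rel G"
  shows "pair_arcs G X Y = link X Y"
  using anisoD[OF assms] unfolding pair_arcs_def link_def flipped_def by auto

lemma link_biregular:
  assumes XY: "(X, Y) \<in> aniso_rel G" and le: "card X \<le> card Y"
  obtains t where "biregular (link X Y) X Y t 1" "card Y = card X * t" "t \<ge> 1"
proof -
  note D = anisoD[OF XY]
  have fin: "finite X" "finite Y" using D cell_finite by auto
  have pos: "card X > 0" "card Y > 0" using cell_card_pos D by auto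
  define E where "E = (if flipped X Y then bip_complement G X Y else parcs G)"
  have E: "(x, y) \<in> E \<longleftrightarrow> (x, y) \<in> link X Y" "(y, x) \<in> E \<longleftrightarrow> (x, y) \<in> link X Y" if "x \<in> X" "y \<in> Y" for x y
    using that arc_sym_iff[of x y] unfolding E_def link_def bip_complement_def by auto
  have "star_forest E X Y"
    using star_forest_pair[OF XY] unfolding E_def flipped_def by auto
  from \<open>star_forest E X Y\<close> have "\<exists>t\<ge>1. biregular (link X Y) X Y t 1"
    unfolding star_forest_def
  proof
    assume "stars_centered E X Y"
    then obtain t where t: "t \<ge> 1" "\<forall>x\<in>X. card {y \<in> Y. (x, y) \<in> E} = t" "\<forall>y\<in>Y. card {x \<in> X. (y, x) \<in> E} = 1"
      unfolding stars_centered_iff_card by blast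
    have "{y \<in> Y. (x, y) \<in> E} = {y \<in> Y. (x, y) \<in> link X Y}" if "x \<in> X" for x using E that by blast
    moreover have "{x \<in> X. (y, x) \<in> E} = {x \<in> X. (x, y) \<in> link X Y}" if "y \<in> Y" for y using E that by blast
    ultimately have "biregular (link X Y) X Y t 1"
      unfolding biregular_def using t by (auto simp: link_def)
    then show ?thesis using t by blast
  next
    assume "stars_centered E Y X"
    then obtain t where t: "t \<ge> 1" "\<forall>y\<in>Y. card {x \<in> X. (y, x) \<in> E} = t" "\<forall>x\<in>X. card {y \<in> Y. (x, y) \<in> E} = 1"
      unfolding stars_centered_iff_card by blast
    have "{y \<in> Y. (x, y) \<in> E} = {y \<in> Y. (x, y) \<in> link X Y}" if "x \<in> X" for x using E that by blast
    moreover have "{x \<in> X. (y, x) \<in> E} = {x \<in> X. (x, y) \<in> link X Y}" if "y \<in> Y" for y using E that by blast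
    ultimately have bireg: "biregular (link X Y) X Y 1 t"
      unfolding biregular_def using t by (auto simp: link_def)
    have "card X = card Y * t" using biregular_double_count[OF fin bireg] by simp
    then have "t = 1" using le pos t(1) by (metis One_nat_def le_antisym mult.right_neutral mult_le_cancel1)
    then show ?thesis using bireg by blast
  qed
  then obtain t where t: "t \<ge> 1" "biregular (link X Y) X Y t 1" by blast
  then show thesis using that biregular_double_count[OF fin t(2)] by simp
qed

definition proj :: "'a set \<Rightarrow> 'a set \<Rightarrow> 'a \<Rightarrow> 'a" where
  "proj X Y y = (THE x. x \<in> X \<and> (x, y) \<in> link X Y)"

lemma proj_unique:
  assumes "(X, Y) \<in> aniso_rel G" "card X \<le> card Y" "y \<in> Y"
  shows "\<exists>!x. x \<in> X \<and> (x, y) \<in> link X Y"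
proof -
  obtain t where "biregular (link X Y) X Y t 1" using link_biregular[OF assms(1,2)] by metis
  then have "card {x \<in> X. (x, y) \<in> link X Y} = 1" using assms(3) by (simp add: biregular_def)
  then show ?thesis by (simp only: card_Collect_eq_1_iff)
qed

lemma proj_eq_iff:
  assumes "(X, Y) \<in> aniso_rel G" "card X \<le> card Y" "y \<in> Y"
  shows "proj X Y y = x \<longleftrightarrow> (x, y) \<in> link X Y"
proof
  assume "proj X Y y = x"
  then show "(x, y) \<in> link X Y" using theI'[OF proj_unique[OF assms]] unfolding proj_def by blast
next
  assume "(x, y) \<in> link X Y"
  moreover have "x \<in> X" using calculation by (simp add: link_def)
  ultimately show "proj X Y y = x" unfolding proj_def using proj_unique[OF assms] by (intro the1_equality) auto
qed

lemma proj_in: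
  assumes "(X, Y) \<in> aniso_rel G" "card X \<le> card Y" "y \<in> Y"
  shows "proj X Y y \<in> X"
  using proj_eq_iff[OF assms] by (auto simp: link_def)

lemma proj_fibre:
  assumes "(X, Y) \<in> aniso_rel G" "card X \<le> card Y"
  obtains t where "card Y = card X * t" "t \<ge> 1" "\<And>x. x \<in> X \<Longrightarrow> card {y \<in> Y. proj X Y y = x} = t"
proof -
  obtain t where t: "biregular (link X Y) X Y t 1" "card Y = card X * t" "t \<ge> 1"
    using link_biregular[OF assms] by metis
  have "{y \<in> Y. proj X Y y = x} = {y \<in> Y. (x, y) \<in> link X Y}" for x
    using proj_eq_iff[OF assms] by blast
  then have "card {y \<in> Y. proj X Y y = x} = t" if "x \<in> X" for x
    using t(1) that by (simp add: biregular_def)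
  then show thesis using that t(2,3) by blast
qed

lemma proj_image:
  assumes "(X, Y) \<in> aniso_rel G" "card X \<le> card Y"
  shows "proj X Y ` Y = X"
proof -
  obtain t where t: "t \<ge> 1" "\<And>x. x \<in> X \<Longrightarrow> card {y \<in> Y. proj X Y y = x} = t"
    using proj_fibre[OF assms] by metis
  have "x \<in> proj X Y ` Y" if "x \<in> X" for x
  proof -
    have "card {y \<in> Y. proj X Y y = x} \<noteq> 0" using t(1) t(2)[OF that] by simp
    then have "{y \<in> Y. proj X Y y = x} \<noteq> {}" by (metis card.empty)
    then show ?thesis by blast
  qed
  then show ?thesis using proj_in[OF assms] by blast
qed

lemma proj_equivariant:
  assumes XY: "(X, Y) \<in> aniso_rel G" "card X \<le> card Y" and fX: "f ` X = X" and h: "h y \<in> Y" and y: "y \<in> Y"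
    and arcs: "\<And>x. x \<in> X \<Longrightarrow> (f x, h y) \<in> parcs G \<longleftrightarrow> (x, y) \<in> parcs G"
  shows "proj X Y (h y) = f (proj X Y y)"
proof -
  let ?x = "proj X Y y"
  have x: "?x \<in> X" "(?x, y) \<in> link X Y" using proj_in[OF XY y] proj_eq_iff[OF XY y] by auto
  have "(f ?x, h y) \<in> link X Y"
    using x h arcs[OF x(1)] fX by (auto simp: link_def)
  then show ?thesis using proj_eq_iff[OF XY h] by simp
qed

lemma heterogeneous_alternating:
  assumes X: "X \<in> P" and het: "\<not> homogeneous G X"
  shows "alternating X (\<lambda>u v. (u, v) \<in> parcs G)"
proof -
  obtain p p' where p: "p \<in> X" "p' \<in> X" "(p, p') \<in> parcs G"
    using het unfolding homogeneous_def empty_on_def by blast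
  obtain t t' where t: "t \<in> X" "t' \<in> X" "t \<noteq> t'" "(t, t') \<notin> parcs G"
    using het unfolding homogeneous_def complete_on_def by blast
  show ?thesis
    by (rule alternating_regular[OF cell_finite[OF X] arc_sym arc_irrefl equitable[OF X X] p t])
qed

end

section \<open>Anisotropic components\<close>

text \<open>
  In \<open>desc G p R X q\<close>, the map \<open>q\<close> sends \<open>X\<close> to the root \<open>R\<close> by composing the projections \<open>p\<close>
  along a path of parent cells on which the cell sizes do not decrease away from the root.
\<close>

inductive desc :: "'a pair_pre_digraph \<Rightarrow> ('a set \<Rightarrow> 'a set \<Rightarrow> 'a \<Rightarrow> 'a) \<Rightarrow> 'a set \<Rightarrow> 'a set \<Rightarrow> ('a \<Rightarrow> 'a) \<Rightarrow> bool"
  for G p R where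
  root: "desc G p R R id"
| child: "desc G p R X q \<Longrightarrow> parent_cell G R X Y \<Longrightarrow> card X \<le> card Y \<Longrightarrow> desc G p R Y (q \<circ> p X Y)"

locale amenable_component = amenable_graph G for G :: "'a pair_pre_digraph" +
  fixes A R
  assumes comp: "A \<in> anisotropic_components G" and root: "is_root G A R"
begin

abbreviation "lev \<equiv> cell_dist G R"
abbreviation "parent \<equiv> parent_cell G R"
abbreviation "des \<equiv> desc G proj R"

lemma root_in: "R \<in> A" using root by (simp add: is_root_def)

lemma component_eq: "A = (aniso_rel G)\<^sup>* `` {R}" and root_cell: "R \<in> P"
proof -
  obtain X where X: "X \<in> P" "A = (aniso_rel G)\<^sup>* `` {X}"
    using comp unfolding anisotropic_components_def by (auto elim: quotientE)
  then have XR: "(X, R) \<in> (aniso_rel G)\<^sup>*" using root_in by blast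
  have "sym ((aniso_rel G)\<^sup>*)" by (rule sym_rtrancl) (use aniso_sym in \<open>auto simp: sym_def\<close>)
  then have "(R, X) \<in> (aniso_rel G)\<^sup>*" using XR by (auto dest: symD)
  with XR X(2) show "A = (aniso_rel G)\<^sup>* `` {R}" by (auto dest: rtrancl_trans)
  show "R \<in> P" using XR X(1) by cases (use anisoD in auto)
qed

lemma component_cells: "X \<in> A \<Longrightarrow> X \<in> P"
  using component_eq root_cell anisoD by (auto elim: rtranclE)

lemma component_closed: "X \<in> A \<Longrightarrow> (X, Y) \<in> aniso_rel G \<Longrightarrow> Y \<in> A"
  using component_eq by (auto intro: rtrancl_into_rtrancl)

lemma lev_reach: "X \<in> A \<Longrightarrow> (R, X) \<in> aniso_rel G ^^ lev X"
  unfolding cell_dist_def component_eq by (rule LeastI_ex) (auto dest: rtrancl_imp_relpow)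

lemma lev_le: "(R, X) \<in> aniso_rel G ^^ n \<Longrightarrow> lev X \<le> n"
  unfolding cell_dist_def by (rule Least_le)

lemma lev_root: "lev R = 0"
  using lev_le[of R 0] by simp

lemma lev_0_iff: "X \<in> A \<Longrightarrow> lev X = 0 \<longleftrightarrow> X = R"
  using lev_reach[of X] lev_root by auto

lemma lev_step: "X \<in> A \<Longrightarrow> (X, Y) \<in> aniso_rel G \<Longrightarrow> lev Y \<le> Suc (lev X)"
  using lev_reach[of X] by (intro lev_le) auto

lemma parentD: "parent X Y \<Longrightarrow> (X, Y) \<in> aniso_rel G \<and> lev Y = Suc (lev X)"
  by (simp add: parent_cell_def)

lemma ex_parent:
  assumes "Y \<in> A" "Y \<noteq> R"
  obtains X where "X \<in> A" "parent X Y"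
proof -
  obtain n where n: "lev Y = Suc n" using assms lev_0_iff by (metis not0_implies_Suc)
  then obtain X where X: "(R, X) \<in> aniso_rel G ^^ n" "(X, Y) \<in> aniso_rel G"
    using lev_reach[OF assms(1)] by auto
  have "X \<in> A" using X component_closed[OF assms(1)] aniso_sym by blast
  moreover have "lev X = n" using lev_le[OF X(1)] lev_step[OF calculation X(2)] n by simp
  ultimately show thesis using that X n by (auto simp: parent_cell_def)
qed

lemma desc_in: "des X q \<Longrightarrow> X \<in> A"
  by (induction rule: desc.induct) (use root_in component_closed parentD in blast)+

lemma desc_image: "des X q \<Longrightarrow> q ` X = R"
proof (induction rule: desc.induct)
  case (child X q Y)
  then show ?case using proj_image[of X Y] parentD by (metis image_comp)
qed simp

lemma desc_fibre: "des X q \<Longrightarrow> r \<in> R \<Longrightarrow> card R * card {u \<in> X. q u = r} = card X"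
proof (induction rule: desc.induct)
  case root
  then have "{u \<in> R. id u = r} = {r}" by auto
  then show ?case by simp
next
  case (child X q Y)
  have XY: "(X, Y) \<in> aniso_rel G" using child parentD by blast
  obtain t where t: "card Y = card X * t" "\<And>x. x \<in> X \<Longrightarrow> card {y \<in> Y. proj X Y y = x} = t"
    using proj_fibre[OF XY child(3)] by metis
  have finX: "finite {x \<in> X. q x = r}" using cell_finite anisoD[OF XY] by simp
  have finY: "finite Y" using cell_finite anisoD[OF XY] by simp
  have "{y \<in> Y. (q \<circ> proj X Y) y = r} = (\<Union>x\<in>{x \<in> X. q x = r}. {y \<in> Y. proj X Y y = x})"
    using proj_in[OF XY child(3)] by auto
  also have "card \<dots> = (\<Sum>x\<in>{x \<in> X. q x = r}. card {y \<in> Y. proj X Y y = x})"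
    by (rule card_UN_disjoint) (use finX finY in auto)
  also have "\<dots> = card {x \<in> X. q x = r} * t" using t(2) by simp
  finally show ?case using child.IH child.prems t(1) by (simp add: mult.assoc[symmetric])
qed

lemma desc_equivariant:
  assumes "des W q" "lev W \<le> lev Y" "W \<noteq> Y" and Y: "Y \<in> A"
    and f: "\<And>C. C \<in> P \<Longrightarrow> f ` C = C"
      "\<And>u v. u \<in> pverts G \<Longrightarrow> v \<in> pverts G \<Longrightarrow> u \<notin> Y \<Longrightarrow> v \<notin> Y \<Longrightarrow> (f u, f v) \<in> parcs G \<longleftrightarrow> (u, v) \<in> parcs G"
    and u: "u \<in> W"
  shows "q (f u) = f (q u)"
  using assms(1-3) u
proof (induction arbitrary: u rule: desc.induct)
  case root
  then show ?case by simp
next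
  case (child X q W)
  have XW: "(X, W) \<in> aniso_rel G" "lev W = Suc (lev X)" using child parentD by auto
  have cells: "X \<in> P" "W \<in> P" "Y \<in> P" using anisoD[OF XW(1)] component_cells[OF Y] by auto
  have XY: "X \<noteq> Y" using XW child.prems by auto
  have "proj X W (f u) = f (proj X W u)"
  proof (rule proj_equivariant[OF XW(1) child.hyps(3)])
    show "f ` X = X" using f(1) cells by blast
    show "f u \<in> W" using f(1)[of W] cells child.prems by blast
    show "u \<in> W" by fact
    fix x assume x: "x \<in> X"
    show "(f x, f u) \<in> parcs G \<longleftrightarrow> (x, u) \<in> parcs G"
    proof (rule f(2))
      show "x \<in> pverts G" "u \<in> pverts G" using x child.prems cells cell_subset by blast+
      show "x \<notin> Y" "u \<notin> Y" using x child.prems cells cell_unique XY by blast+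
    qed
  qed
  moreover have "q (f (proj X W u)) = f (q (proj X W u))"
    by (rule child.IH) (use XW child.prems XY proj_in[OF XW(1) child.hyps(3)] in auto)
  ultimately show ?case by simp
qed

definition root_adj :: "'a \<Rightarrow> 'a \<Rightarrow> bool" where
  "root_adj r s \<longleftrightarrow> (if homogeneous G R then r = s else (r, s) \<in> parcs G)"

lemma root_adj_sym: "root_adj r s \<Longrightarrow> root_adj s r"
  unfolding root_adj_def using arc_sym by (auto split: if_splits)

lemma root_adj_iso:
  "f permutes pverts G \<Longrightarrow> (f r, f s) \<in> parcs G \<longleftrightarrow> (r, s) \<in> parcs G \<Longrightarrow> root_adj (f r) (f s) \<longleftrightarrow> root_adj r s"
  using inj_eq[OF permutes_inj, of f "pverts G" r s] by (simp add: root_adj_def)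

lemma root_adj_alternating:
  assumes d: "des X q" and lt: "homogeneous G R \<Longrightarrow> card R < card X" "card R \<ge> 2"
  shows "alternating X (\<lambda>u v. root_adj (q u) (q v))"
proof (cases "homogeneous G R")
  case True
  obtain r r' where r: "r \<in> R" "r' \<in> R" "r \<noteq> r'"
    using lt(2) by (metis card_2_iff' obtain_subset_with_card_n subset_iff)
  have "2 \<le> card {u \<in> X. q u = r}" if "r \<in> R" for r
  proof (rule ccontr)
    assume "\<not> ?thesis"
    then have "card R * card {u \<in> X. q u = r} \<le> card R * 1" by (intro mult_le_mono2) simp
    then show False using desc_fibre[OF d that] lt(1)[OF True] by simp
  qed
  then have "alternating X (\<lambda>u v. q u = q v)" by (rule alternating_kernel[OF r])
  then show ?thesis using True by (simp add: root_adj_def)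
next
  case False
  have "alternating X (\<lambda>u v. (q u, q v) \<in> parcs G)"
    by (rule alternating_vimage[OF heterogeneous_alternating[OF root_cell False] desc_image[OF d]])
  then show ?thesis using False by (simp add: root_adj_def)
qed

lemma root_card:
  assumes "X \<in> A" "X \<noteq> R"
  shows "card R \<ge> 2"
proof -
  have "(R, X) \<in> (aniso_rel G)\<^sup>*" using assms(1) component_eq by blast
  then show ?thesis using assms(2) by (cases rule: converse_rtranclE) (auto intro: aniso_card)
qed

lemma child_card:
  assumes d: "des X q" and XZ: "parent X Z"
  shows "card X \<le> card Z"
proof (rule ccontr)
  assume "\<not> ?thesis"
  then have lt: "card Z < card X" by simp
  have an: "(X, Z) \<in> aniso_rel G" "(Z, X) \<in> aniso_rel G" "lev Z = Suc (lev X)"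
    using parentD[OF XZ] aniso_sym by auto
  have cells: "X \<in> P" "Z \<in> P" "X \<noteq> Z" using anisoD[OF an(1)] by auto
  have XA: "X \<in> A" using desc_in[OF d] .
  have ZA: "Z \<in> A" using component_closed[OF XA an(1)] .
  let ?p = "proj Z X"
  have "R \<noteq> Z" using an(3) lev_root by auto
  have alt: "alternating X (\<lambda>u v. root_adj (q u) (q v))"
  proof (rule root_adj_alternating[OF d])
    have "card R \<le> card Z" if "homogeneous G R"
      using root that ZA unfolding is_root_def by (auto split: if_splits)
    then show "card R < card X" if "homogeneous G R" using lt that by fastforce
    show "card R \<ge> 2" using root_card[OF ZA] \<open>R \<noteq> Z\<close> by auto
  qed
  have alt': "alternating X (\<lambda>u v. ?p u = ?p v)"
  proof -
    obtain t where t: "card X = card Z * t" "\<And>x. x \<in> Z \<Longrightarrow> card {y \<in> X. ?p y = x} = t"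
      using proj_fibre[OF an(2)] lt by (metis less_imp_le)
    have "t \<ge> 2" using t(1) lt by (cases t; cases "t - 1") auto
    obtain r r' where r: "r \<in> Z" "r' \<in> Z" "r \<noteq> r'"
      using aniso_card[OF an(2)] by (metis card_2_iff' obtain_subset_with_card_n subset_iff)
    show ?thesis by (rule alternating_kernel[OF r]) (use t(2) \<open>t \<ge> 2\<close> in auto)
  qed
  show False
  proof (rule overlap_contradiction[OF _ _ _ alt alt'])
    show "finite X" using cell_finite cells by blast
    show "root_adj (q v) (q u)" if "root_adj (q u) (q v)" for u v using root_adj_sym that by blast
    show "?p v = ?p u" if "?p u = ?p v" for u v using that by simp
    fix \<sigma> assume \<sigma>: "\<sigma> permutes X"
    obtain f where "twisting Z X \<sigma> f" using ex_twisting[OF cells(2,1) cells(3)[symmetric] \<sigma>] by blast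
    note f = twistingD[OF this]
    have fX: "f u \<in> X" if "u \<in> X" for u using f(2)[of X] cells that by blast
    have q: "q (f u) = f (q u)" if "u \<in> X" for u
      by (rule desc_equivariant[OF d _ cells(3) ZA f(2) f(4) that]) (use an in auto)
    have p: "?p (\<sigma> (f u)) = f (?p u)" if "u \<in> X" for u
      by (rule proj_equivariant[OF an(2)])
        (use lt f(2,3) cells that fX \<sigma> in \<open>auto simp: permutes_in_image\<close>)
    have qR: "q u \<in> R" if "u \<in> X" for u using desc_image[OF d] that by blast
    have SR: "root_adj (f r) (f s) \<longleftrightarrow> root_adj r s" if "r \<in> R" "s \<in> R" for r s
    proof (rule root_adj_iso[OF f(1)])
      have "r \<notin> Z" "s \<notin> Z" using that cell_unique cells(2) root_cell \<open>R \<noteq> Z\<close> by blast+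
      then show "(f r, f s) \<in> parcs G \<longleftrightarrow> (r, s) \<in> parcs G"
        using f(4)[of r s] cell_subset[OF root_cell] that by blast
    qed
    show "\<exists>f. inj f \<and> f ` X = X \<and> (\<forall>u\<in>X. \<forall>v\<in>X. root_adj (q (f u)) (q (f v)) \<longleftrightarrow> root_adj (q u) (q v)) \<and>
      (\<forall>u\<in>X. \<forall>v\<in>X. ?p (\<sigma> (f u)) = ?p (\<sigma> (f v)) \<longleftrightarrow> ?p u = ?p v)"
      using permutes_inj[OF f(1)] f(2)[OF cells(1)] q p SR qR
      by (intro exI[of _ f]) (simp add: inj_eq)
  qed
qed

lemma ex_desc: "W \<in> A \<Longrightarrow> \<exists>q. des W q"
proof (induction "lev W" arbitrary: W rule: less_induct)
  case less
  show ?case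
  proof (cases "W = R")
    case True
    then show ?thesis using desc.root by blast
  next
    case False
    then obtain X where X: "X \<in> A" "parent X W" using ex_parent less.prems by blast
    then obtain q where "des X q" using less.hyps[of X] parentD by auto
    then show ?thesis using desc.child[OF _ X(2)] child_card[OF _ X(2)] by blast
  qed
qed

lemma parent_card: "X \<in> A \<Longrightarrow> parent X Y \<Longrightarrow> card X \<le> card Y"
  using ex_desc child_card by blast

lemma nonroot_homogeneous:
  assumes Y: "Y \<in> A" "Y \<noteq> R"
  shows "homogeneous G Y"
proof (rule ccontr)
  assume het: "\<not> homogeneous G Y"
  then have hetR: "\<not> homogeneous G R" using root Y unfolding is_root_def by (auto split: if_splits)
  obtain X where X: "X \<in> A" "parent X Y" using ex_parent Y by blast
  obtain q where d: "des X q" using ex_desc X by blast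
  have an: "(X, Y) \<in> aniso_rel G" "lev Y = Suc (lev X)" using parentD X by auto
  have cells: "X \<in> P" "Y \<in> P" "X \<noteq> Y" using anisoD[OF an(1)] by auto
  have le: "card X \<le> card Y" using parent_card X by blast
  let ?q = "q \<circ> proj X Y"
  have d': "des Y ?q" using desc.child[OF d X(2) le] .
  have altR: "alternating R (\<lambda>u v. (u, v) \<in> parcs G)" by (rule heterogeneous_alternating[OF root_cell hetR])
  have alt: "alternating Y (\<lambda>u v. (?q u, ?q v) \<in> parcs G)"
    by (rule alternating_vimage[OF altR desc_image[OF d']])
  have alt': "alternating Y (\<lambda>u v. (u, v) \<in> parcs G)" by (rule heterogeneous_alternating[OF cells(2) het])
  show False
  proof (rule overlap_contradiction[OF _ _ _ alt' alt])
    show "finite Y" using cell_finite cells by blast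
    show "(v, u) \<in> parcs G" if "(u, v) \<in> parcs G" for u v using arc_sym that by blast
    show "(?q v, ?q u) \<in> parcs G" if "(?q u, ?q v) \<in> parcs G" for u v using arc_sym that by blast
    fix \<sigma> assume \<sigma>: "\<sigma> permutes Y"
    obtain f where "twisting X Y \<sigma> f" using ex_twisting[OF cells \<sigma>] by blast
    note f = twistingD[OF this]
    have fY: "f u \<in> Y" if "u \<in> Y" for u using f(2)[of Y] cells that by blast
    have q: "q (f u) = f (q u)" if "u \<in> X" for u
      by (rule desc_equivariant[OF d _ cells(3) Y(1) f(2) f(4) that]) (use an in auto)
    have p: "proj X Y (\<sigma> (f u)) = f (proj X Y u)" if "u \<in> Y" for u
      by (rule proj_equivariant[OF an(1) le])
        (use f(2,3) cells that fY \<sigma> in \<open>auto simp: permutes_in_image\<close>)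
    have qp: "?q (\<sigma> (f u)) = f (?q u)" if "u \<in> Y" for u
      using p[OF that] q[OF proj_in[OF an(1) le that]] by simp
    have qR: "?q u \<in> R" if "u \<in> Y" for u using desc_image[OF d'] that by blast
    have arcR: "(f r, f s) \<in> parcs G \<longleftrightarrow> (r, s) \<in> parcs G" if "r \<in> R" "s \<in> R" for r s
    proof (rule f(4))
      show "r \<in> pverts G" "s \<in> pverts G" using that cell_subset[OF root_cell] by auto
      have "r \<notin> Y" "s \<notin> Y" using that cell_unique cells(2) root_cell Y(2) by blast+
      then show "\<not> (r \<in> X \<and> s \<in> Y)" "\<not> (r \<in> Y \<and> s \<in> X)" by auto
    qed
    have arcY: "(f r, f s) \<in> parcs G \<longleftrightarrow> (r, s) \<in> parcs G" if "r \<in> Y" "s \<in> Y" for r s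
    proof (rule f(4))
      show "r \<in> pverts G" "s \<in> pverts G" using that cell_subset[OF cells(2)] by auto
      have "r \<notin> X" "s \<notin> X" using that cell_unique cells by blast+
      then show "\<not> (r \<in> X \<and> s \<in> Y)" "\<not> (r \<in> Y \<and> s \<in> X)" by auto
    qed
    show "\<exists>f. inj f \<and> f ` Y = Y \<and> (\<forall>u\<in>Y. \<forall>v\<in>Y. (f u, f v) \<in> parcs G \<longleftrightarrow> (u, v) \<in> parcs G) \<and>
      (\<forall>u\<in>Y. \<forall>v\<in>Y. (?q (\<sigma> (f u)), ?q (\<sigma> (f v))) \<in> parcs G \<longleftrightarrow> (?q u, ?q v) \<in> parcs G)"
      using permutes_inj[OF f(1)] f(2)[OF cells(2)] qp arcR arcY qR
      by (intro exI[of _ f]) simp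
  qed
qed

lemma parent_unique_aux:
  assumes Y: "Y \<in> A" and X: "X \<in> A" "parent X Y" and X': "X' \<in> A" "X' \<noteq> X" "(X', Y) \<in> aniso_rel G"
    "lev X' \<le> lev Y" "card X' \<le> card Y"
  shows False
proof -
  have an: "(X, Y) \<in> aniso_rel G" "lev Y = Suc (lev X)" using parentD X by auto
  have cells: "X \<in> P" "Y \<in> P" "X \<noteq> Y" "X' \<in> P" "X' \<noteq> Y" using anisoD[OF an(1)] anisoD[OF X'(3)] by auto
  have le: "card X \<le> card Y" using parent_card X by blast
  obtain q where d: "des X q" using ex_desc X by blast
  obtain q' where d': "des X' q'" using ex_desc X' by blast
  let ?q = "q \<circ> proj X Y" and ?q' = "q' \<circ> proj X' Y"
  have "Y \<noteq> R" using an lev_root by auto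
  then obtain r r' where r: "r \<in> R" "r' \<in> R" "r \<noteq> r'"
    using root_card[OF Y] by (metis card_2_iff' obtain_subset_with_card_n subset_iff)
  have im: "?q ` Y = R" using desc_image[OF d] proj_image[OF an(1) le] by (metis image_comp)
  have im': "?q' ` Y = R" using desc_image[OF d'] proj_image[OF X'(3,5)] by (metis image_comp)
  have "finite Y" using cell_finite cells by blast
  then show False
  proof (rule agreement_not_constant[OF _ im im' r])
    fix \<sigma> assume \<sigma>: "\<sigma> permutes Y"
    obtain f where "twisting X Y \<sigma> f" using ex_twisting[OF cells(1-3) \<sigma>] by blast
    note f = twistingD[OF this]
    have fY: "f u \<in> Y" if "u \<in> Y" for u using f(2)[of Y] cells that by blast
    have q: "q (f u) = f (q u)" if "u \<in> X" for u
      by (rule desc_equivariant[OF d _ cells(3) Y f(2) f(4) that]) (use an in auto)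
    have q': "q' (f u) = f (q' u)" if "u \<in> X'" for u
      by (rule desc_equivariant[OF d' X'(4) cells(5) Y f(2) f(4) that]) auto
    have p: "proj X Y (\<sigma> (f u)) = f (proj X Y u)" if "u \<in> Y" for u
      by (rule proj_equivariant[OF an(1) le])
        (use f(2,3) cells that fY \<sigma> in \<open>auto simp: permutes_in_image\<close>)
    have p': "proj X' Y (f u) = f (proj X' Y u)" if "u \<in> Y" for u
    proof (rule proj_equivariant[where h = f, OF X'(3,5) f(2)[OF cells(4)] fY[OF that] that])
      fix x assume x: "x \<in> X'"
      show "(f x, f u) \<in> parcs G \<longleftrightarrow> (x, u) \<in> parcs G"
      proof (rule f(4))
        show "x \<in> pverts G" "u \<in> pverts G" using x that cells cell_subset by blast+
        show "\<not> (x \<in> X \<and> u \<in> Y)" "\<not> (x \<in> Y \<and> u \<in> X)" using x that cells X'(2) cell_unique by blast+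
      qed
    qed
    have qp: "?q (\<sigma> (f u)) = f (?q u)" "?q' (f u) = f (?q' u)" if "u \<in> Y" for u
      using p[OF that] q[OF proj_in[OF an(1) le that]] p'[OF that] q'[OF proj_in[OF X'(3,5) that]] by simp_all
    have inj: "f u = f v \<longleftrightarrow> u = v" for u v using permutes_inj[OF f(1)] by (auto simp: inj_eq)
    have "f ` {u \<in> Y. ?q u = ?q' u} = {u \<in> Y. ?q (\<sigma> u) = ?q' u}"
    proof (intro set_eqI iffI)
      fix u assume u: "u \<in> {u \<in> Y. ?q (\<sigma> u) = ?q' u}"
      then obtain w where "w \<in> Y" "u = f w" using f(2)[OF cells(2)] by blast
      then show "u \<in> f ` {u \<in> Y. ?q u = ?q' u}" using u qp inj by auto
    next
      fix u assume "u \<in> f ` {u \<in> Y. ?q u = ?q' u}"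
      then show "u \<in> {u \<in> Y. ?q (\<sigma> u) = ?q' u}" using qp fY by auto
    qed
    moreover have "card (f ` {u \<in> Y. ?q u = ?q' u}) = card {u \<in> Y. ?q u = ?q' u}"
      by (rule card_image) (use inj in \<open>auto simp: inj_on_def\<close>)
    ultimately show "card {u \<in> Y. ?q (\<sigma> u) = ?q' u} = card {u \<in> Y. ?q u = ?q' u}" by simp
  qed
qed

lemma parent_unique:
  assumes Y: "Y \<in> A" and X: "X \<in> A" "parent X Y" and X': "X' \<in> A" "(X', Y) \<in> aniso_rel G" "lev X' \<le> lev Y"
  shows "X' = X"
proof (rule ccontr)
  assume ne: "X' \<noteq> X"
  show False
  proof (cases "card X' \<le> card Y")
    case True
    then show False using parent_unique_aux[OF Y X X'(1) ne X'(2,3)] by blast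
  next
    case False
    have "lev X' = lev Y"
    proof (rule ccontr)
      assume "lev X' \<noteq> lev Y"
      then have "parent X' Y" using X' lev_step[OF X'(1,2)] by (simp add: parent_cell_def)
      then show False using parent_card X'(1) False by blast
    qed
    then have "X' \<noteq> R" using parentD[OF X(2)] lev_root by auto
    then obtain Z where Z: "Z \<in> A" "parent Z X'" using ex_parent X'(1) by blast
    have "Y \<noteq> Z" using parentD[OF Z(2)] \<open>lev X' = lev Y\<close> by auto
    then show False
      using parent_unique_aux[OF X'(1) Z Y _ aniso_sym[OF X'(2)]] \<open>lev X' = lev Y\<close> False by simp
  qed
qed

end

section \<open>Distinguishing labelings of rooted forests\<close>

lemma finite_distinguishing_labelings: "finite V \<Longrightarrow> finite (distinguishing_labelings V \<Gamma> c)"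
  unfolding distinguishing_labelings_def by (auto intro: finite_PiE finite_subset)

lemma distinguishing_labelings_mono:
  assumes "c \<le> d" shows "distinguishing_labelings V \<Gamma> c \<subseteq> distinguishing_labelings V \<Gamma> d"
proof -
  have "(V \<rightarrow>\<^sub>E {..<c}) \<subseteq> (V \<rightarrow>\<^sub>E {..<d})" using assms by (intro PiE_mono) auto
  then show ?thesis unfolding distinguishing_labelings_def by blast
qed

lemma distinguishing_labelings_via_colors:
  assumes Q: "finite Q" and \<psi>: "\<psi> ` V \<subseteq> Q" and perm: "\<And>s. s \<in> \<Gamma> \<Longrightarrow> s permutes V"
    and dist: "\<And>s. s \<in> \<Gamma> \<Longrightarrow> (\<And>u. u \<in> V \<Longrightarrow> \<psi> (s u) = \<psi> u) \<Longrightarrow> s = id"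
  shows "distinguishing_labelings V \<Gamma> (card Q) \<noteq> {}"
proof -
  obtain \<beta> where \<beta>: "bij_betw \<beta> Q {0..<card Q}" using ex_bij_betw_finite_nat[OF Q] by blast
  define \<phi> where "\<phi> = (\<lambda>u\<in>V. \<beta> (\<psi> u))"
  have "\<phi> \<in> V \<rightarrow>\<^sub>E {..<card Q}"
    unfolding \<phi>_def using bij_betwE[OF \<beta>] \<psi> by (auto simp: PiE_iff)
  moreover have "s = id" if s: "s \<in> \<Gamma>" and pres: "\<forall>v\<in>V. \<phi> (s v) = \<phi> v" for s
  proof (rule dist[OF s])
    fix u assume u: "u \<in> V"
    have "s u \<in> V" using perm[OF s] u by (simp add: permutes_in_image)
    then have "\<beta> (\<psi> (s u)) = \<beta> (\<psi> u)" using pres u unfolding \<phi>_def by auto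
    then show "\<psi> (s u) = \<psi> u"
      using \<beta> \<psi> u \<open>s u \<in> V\<close> unfolding bij_betw_def by (meson image_subset_iff inj_onD)
  qed
  ultimately have "\<phi> \<in> distinguishing_labelings V \<Gamma> (card Q)"
    unfolding distinguishing_labelings_def by blast
  then show ?thesis by blast
qed

lemma distinguishing_labelings_card_nonempty:
  assumes "finite V" "\<And>s. s \<in> \<Gamma> \<Longrightarrow> s permutes V"
  shows "distinguishing_labelings V \<Gamma> (card V) \<noteq> {}"
proof (rule distinguishing_labelings_via_colors[where \<psi> = id])
  fix s assume "s \<in> \<Gamma>" "\<And>u. u \<in> V \<Longrightarrow> id (s u) = id u"
  then show "s = id" using assms(2) by (auto simp: permutes_def fun_eq_iff)
qed (use assms in auto)

lemma fewest_colors_le_iff: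
  assumes "finite V" "\<And>s. s \<in> \<Gamma> \<Longrightarrow> s permutes V"
  shows "fewest_colors V \<Gamma> \<le> n \<longleftrightarrow> distinguishing_labelings V \<Gamma> n \<noteq> {}"
proof
  have "\<exists>c. distinguishing_labelings V \<Gamma> c \<noteq> {}"
    using distinguishing_labelings_card_nonempty[of V \<Gamma>] assms by blast
  then have "distinguishing_labelings V \<Gamma> (fewest_colors V \<Gamma>) \<noteq> {}"
    unfolding fewest_colors_def by (rule LeastI_ex)
  then show "distinguishing_labelings V \<Gamma> n \<noteq> {}" if "fewest_colors V \<Gamma> \<le> n"
    using distinguishing_labelings_mono[OF that] by blast
next
  assume "distinguishing_labelings V \<Gamma> n \<noteq> {}"
  then show "fewest_colors V \<Gamma> \<le> n" unfolding fewest_colors_def by (rule Least_le)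
qed

locale rooted_forest =
  fixes V R :: "'a set" and par :: "'a \<Rightarrow> 'a" and \<kappa> :: "'a \<Rightarrow> 'k" and lev :: "'a \<Rightarrow> nat"
  assumes fin: "finite V" and R_sub: "R \<subseteq> V"
    and par_in: "\<And>y. y \<in> V - R \<Longrightarrow> par y \<in> V"
    and lev_par: "\<And>y. y \<in> V - R \<Longrightarrow> lev y = Suc (lev (par y))"
    and lev_root: "\<And>r. r \<in> R \<Longrightarrow> lev r = 0"
    and lev_kind: "\<And>u v. u \<in> V \<Longrightarrow> v \<in> V \<Longrightarrow> \<kappa> u = \<kappa> v \<Longrightarrow> lev u = lev v"
    and root_kind: "\<And>r s. r \<in> R \<Longrightarrow> s \<in> R \<Longrightarrow> \<kappa> r = \<kappa> s"
    and par_kind: "\<And>y z. y \<in> V - R \<Longrightarrow> z \<in> V - R \<Longrightarrow> \<kappa> y = \<kappa> z \<Longrightarrow> \<kappa> (par y) = \<kappa> (par z)"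
    and regular: "\<And>x x' k. x \<in> V \<Longrightarrow> x' \<in> V \<Longrightarrow> \<kappa> x = \<kappa> x' \<Longrightarrow>
      card {y \<in> V - R. par y = x \<and> \<kappa> y = k} = card {y \<in> V - R. par y = x' \<and> \<kappa> y = k}"
begin

definition forest_auts :: "('a \<Rightarrow> 'a) set" where
  "forest_auts = {g. g permutes V \<and> (\<forall>x\<in>V. \<kappa> (g x) = \<kappa> x) \<and> (\<forall>y\<in>V - R. par (g y) = g (par y))}"

definition root_of :: "'a \<Rightarrow> 'a" where "root_of y = (par ^^ lev y) y"

definition tree_at :: "'a \<Rightarrow> 'a set" where "tree_at v = {y \<in> V. root_of y = v}"

lemma lev_0_iff: "y \<in> V \<Longrightarrow> lev y = 0 \<longleftrightarrow> y \<in> R"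
  using lev_root lev_par by force

lemma root_of_root: "r \<in> R \<Longrightarrow> root_of r = r"
  by (simp add: root_of_def lev_root)

lemma root_of_par: "y \<in> V - R \<Longrightarrow> root_of y = root_of (par y)"
  using lev_par[of y] by (simp add: root_of_def funpow_swap1)

lemma forest_induct [consumes 1, case_names root child]:
  assumes "y \<in> V" "\<And>r. r \<in> R \<Longrightarrow> Q r" "\<And>y. y \<in> V - R \<Longrightarrow> Q (par y) \<Longrightarrow> Q y"
  shows "Q y"
  using assms(1)
proof (induction "lev y" arbitrary: y rule: less_induct)
  case less
  then show ?case using assms(2,3)[of y] lev_par[of y] par_in[of y] by (cases "y \<in> R") auto
qed

lemma root_of_in: "y \<in> V \<Longrightarrow> root_of y \<in> R"
  by (induction y rule: forest_induct) (auto simp: root_of_root root_of_par)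

lemma forest_autsD:
  assumes "g \<in> forest_auts"
  shows "g permutes V" "\<And>x. x \<in> V \<Longrightarrow> \<kappa> (g x) = \<kappa> x" "\<And>y. y \<in> V - R \<Longrightarrow> par (g y) = g (par y)"
    "\<And>x. g x \<in> V \<longleftrightarrow> x \<in> V" "\<And>x. g x \<in> R \<longleftrightarrow> x \<in> R"
proof -
  show g: "g permutes V" "\<And>x. x \<in> V \<Longrightarrow> \<kappa> (g x) = \<kappa> x" "\<And>y. y \<in> V - R \<Longrightarrow> par (g y) = g (par y)"
    using assms by (auto simp: forest_auts_def)
  show V: "g x \<in> V \<longleftrightarrow> x \<in> V" for x using g(1) by (simp add: permutes_in_image)
  show "g x \<in> R \<longleftrightarrow> x \<in> R" for x
  proof (cases "x \<in> V")
    case True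
    then have "lev (g x) = lev x" using lev_kind g(2) V by blast
    then show ?thesis using lev_0_iff True V by metis
  next
    case False
    then show ?thesis using V R_sub by blast
  qed
qed

lemma forest_auts_inv_cancel:
  assumes "g \<in> forest_auts"
  shows "g (inv g x) = x" "inv g (g x) = x"
  using permutes_inverses[OF forest_autsD(1)[OF assms]] by auto

lemma forest_auts_id: "id \<in> forest_auts"
  by (simp add: forest_auts_def permutes_id)

lemma forest_auts_comp:
  assumes "g \<in> forest_auts" "h \<in> forest_auts"
  shows "g \<circ> h \<in> forest_auts"
proof -
  note g = forest_autsD[OF assms(1)] and h = forest_autsD[OF assms(2)]
  have "par (g (h y)) = g (h (par y))" if "y \<in> V - R" for y
    using g(3)[of "h y"] h(3)[OF that] h(4,5) that by auto
  then show ?thesis unfolding forest_auts_def using permutes_compose[OF h(1) g(1)] g(2) h(2,4) by auto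
qed

lemma forest_auts_inv:
  assumes "g \<in> forest_auts"
  shows "inv g \<in> forest_auts"
proof -
  note g = forest_autsD[OF assms] and c = forest_auts_inv_cancel[OF assms]
  have V: "inv g x \<in> V \<longleftrightarrow> x \<in> V" for x using g(4)[of "inv g x"] c by simp
  have R: "inv g x \<in> R \<longleftrightarrow> x \<in> R" for x using g(5)[of "inv g x"] c by simp
  have "\<kappa> (inv g x) = \<kappa> x" if "x \<in> V" for x using g(2)[of "inv g x"] V c that by simp
  moreover have "par (inv g y) = inv g (par y)" if "y \<in> V - R" for y
    using g(3)[of "inv g y"] V R c that by (metis DiffE DiffI)
  ultimately show ?thesis unfolding forest_auts_def using permutes_inv[OF g(1)] by simp
qed

lemma root_of_equivariant:
  assumes "g \<in> forest_auts" "y \<in> V"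
  shows "root_of (g y) = g (root_of y)"
  using assms(2)
proof (induction y rule: forest_induct)
  case (root r)
  then show ?case using forest_autsD(5)[OF assms(1)] by (simp add: root_of_root)
next
  case (child y)
  have "root_of (g y) = root_of (par (g y))" using root_of_par[of "g y"] forest_autsD(4,5)[OF assms(1)] child by auto
  then show ?case using child forest_autsD(3)[OF assms(1)] root_of_par by simp
qed

lemma forest_auts_leg:
  assumes "g \<in> forest_auts" "v \<in> R"
  shows "g y \<in> tree_at (g v) \<longleftrightarrow> y \<in> tree_at v"
  using root_of_equivariant[OF assms(1), of y] forest_autsD(4)[OF assms(1)] permutes_inj[OF forest_autsD(1)[OF assms(1)]]
  by (auto simp: tree_at_def inj_eq)

lemma inj_permutes:
  assumes "\<And>x. x \<in> V \<Longrightarrow> g x \<in> V" "inj_on g V" "\<And>x. x \<notin> V \<Longrightarrow> g x = x"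
  shows "g permutes V"
proof -
  have "g ` V \<subseteq> V" using assms(1) by blast
  then have "bij_betw g V V" using endo_inj_surj[OF fin] assms(2) by (simp add: bij_betw_def)
  then show ?thesis by (rule bij_imp_permutes) (rule assms(3))
qed

lemma forest_auts_assemble:
  assumes s: "s permutes R" and h: "\<And>u. u \<in> R \<Longrightarrow> h u \<in> forest_auts" "\<And>u. u \<in> R \<Longrightarrow> h u u = s u"
  shows "(\<lambda>y. if y \<in> V then h (root_of y) y else y) \<in> forest_auts"
proof -
  let ?g = "\<lambda>y. if y \<in> V then h (root_of y) y else y"
  have hV: "h (root_of y) \<in> forest_auts" if "y \<in> V" for y using h(1) root_of_in that by blast
  have rtg: "root_of (?g y) = s (root_of y)" if "y \<in> V" for y
    using root_of_equivariant[OF hV[OF that] that] h(2) root_of_in that by simp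
  have "?g permutes V"
  proof (rule inj_permutes)
    show "?g x \<in> V" if "x \<in> V" for x using forest_autsD(4)[OF hV] that by simp
    show "inj_on ?g V"
    proof (rule inj_onI)
      fix x y assume xy: "x \<in> V" "y \<in> V" "?g x = ?g y"
      then have "s (root_of x) = s (root_of y)" using rtg[OF xy(1)] rtg[OF xy(2)] by simp
      then have "root_of x = root_of y" using inj_eq[OF permutes_inj[OF s]] by simp
      then have "h (root_of x) x = h (root_of x) y" using xy by simp
      then show "x = y" using permutes_inj[OF forest_autsD(1)[OF hV[OF xy(1)]]] by (simp add: inj_eq)
    qed
  qed simp
  moreover have "par (?g y) = ?g (par y)" if "y \<in> V - R" for y
    using forest_autsD(3)[OF hV, of y y] root_of_par[OF that] par_in[OF that] that by simp
  moreover have "\<kappa> (?g y) = \<kappa> y" if "y \<in> V" for y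
    using forest_autsD(2)[OF hV] that by simp
  ultimately show ?thesis unfolding forest_auts_def by blast
qed

lemma partial_extension:
  assumes s: "s permutes R"
  shows "\<exists>g. (\<forall>r\<in>R. g r = s r) \<and> (\<forall>x\<in>V. lev x \<le> n \<longrightarrow> g x \<in> V \<and> \<kappa> (g x) = \<kappa> x) \<and>
    (\<forall>y\<in>V - R. lev y \<le> n \<longrightarrow> par (g y) = g (par y)) \<and> inj_on g {x \<in> V. lev x \<le> n}"
proof (induction n)
  case 0
  have "s r \<in> R" if "r \<in> R" for r using s that by (simp add: permutes_in_image)
  moreover have "inj_on s S" for S using permutes_inj[OF s] by (rule inj_on_subset) simp
  moreover have "x \<in> R" if "x \<in> V" "lev x \<le> 0" for x using lev_0_iff that by simp
  ultimately show ?case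
    using root_kind R_sub by (intro exI[of _ s] conjI ballI impI) blast+
next
  case (Suc n)
  then obtain g where g: "\<And>r. r \<in> R \<Longrightarrow> g r = s r"
    "\<And>x. x \<in> V \<Longrightarrow> lev x \<le> n \<Longrightarrow> g x \<in> V" "\<And>x. x \<in> V \<Longrightarrow> lev x \<le> n \<Longrightarrow> \<kappa> (g x) = \<kappa> x"
    "\<And>y. y \<in> V - R \<Longrightarrow> lev y \<le> n \<Longrightarrow> par (g y) = g (par y)" "inj_on g {x \<in> V. lev x \<le> n}" by blast
  define ch where "ch x k = {y \<in> V - R. par y = x \<and> \<kappa> y = k}" for x k
  have "\<exists>\<beta>. bij_betw \<beta> (ch x k) (ch (g x) k)" if "x \<in> V" "lev x \<le> n" for x k
  proof -
    have "card (ch x k) = card (ch (g x) k)"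
      unfolding ch_def using regular[of x "g x" k] g(2,3)[OF that] that by simp
    moreover have "finite (ch x k)" "finite (ch (g x) k)" using fin by (auto simp: ch_def)
    ultimately show ?thesis by (simp add: finite_same_card_bij)
  qed
  then obtain \<beta> where \<beta>: "\<And>x k. x \<in> V \<Longrightarrow> lev x \<le> n \<Longrightarrow> bij_betw (\<beta> x k) (ch x k) (ch (g x) k)" by metis
  define h where "h y = (if lev y = Suc n then \<beta> (par y) (\<kappa> y) y else g y)" for y
  have new: "h y \<in> V - R" "par (h y) = g (par y)" "\<kappa> (h y) = \<kappa> y" "lev (h y) = Suc n" "par y \<in> V" "lev (par y) = n"
    if y: "y \<in> V" "lev y = Suc n" for y
  proof -
    have yR: "y \<in> V - R" using y by (auto dest: lev_root)
    then show p: "par y \<in> V" "lev (par y) = n" using par_in lev_par y by auto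
    have "y \<in> ch (par y) (\<kappa> y)" using yR by (simp add: ch_def)
    then have "h y \<in> ch (g (par y)) (\<kappa> y)"
      using bij_betwE[OF \<beta>[of "par y" "\<kappa> y"]] p y by (auto simp: h_def)
    then show "h y \<in> V - R" "par (h y) = g (par y)" "\<kappa> (h y) = \<kappa> y" by (auto simp: ch_def)
    then show "lev (h y) = Suc n" using lev_kind[of "h y" y] y by auto
  qed
  have old: "h y = g y" "lev (h y) = lev y" if "y \<in> V" "lev y \<le> n" for y
    using that lev_kind[OF g(2)[OF that] that(1) g(3)[OF that]] by (auto simp: h_def)
  have old_par: "h (par y) = g (par y)" if "y \<in> V - R" "lev y \<le> Suc n" for y
    using old(1)[OF par_in[OF that(1)]] lev_par[OF that(1)] that(2) by simp
  have "h r = s r" if "r \<in> R" for r using g(1) old(1)[of r] R_sub lev_root that by auto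
  moreover have "h x \<in> V \<and> \<kappa> (h x) = \<kappa> x" if "x \<in> V" "lev x \<le> Suc n" for x
    using new[of x] old[of x] g(2,3)[of x] that by (cases "lev x = Suc n") auto
  moreover have "par (h y) = h (par y)" if "y \<in> V - R" "lev y \<le> Suc n" for y
    using new[of y] old[of y] g(4)[of y] that old_par[OF that] by (cases "lev y = Suc n") auto
  moreover have "inj_on h {x \<in> V. lev x \<le> Suc n}"
  proof (rule inj_onI)
    fix x y assume "x \<in> {x \<in> V. lev x \<le> Suc n}" "y \<in> {x \<in> V. lev x \<le> Suc n}" and eq: "h x = h y"
    then have xy: "x \<in> V" "lev x \<le> Suc n" "y \<in> V" "lev y \<le> Suc n" by auto
    have "lev (h z) = lev z" if "z \<in> V" "lev z \<le> Suc n" for z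
      using new(4)[of z] old(2)[of z] that by (cases "lev z = Suc n") auto
    then have l: "lev x = lev y" using eq xy by metis
    show "x = y"
    proof (cases "lev x = Suc n")
      case False
      then have "x \<in> {x \<in> V. lev x \<le> n}" "y \<in> {x \<in> V. lev x \<le> n}" using xy l by auto
      then show ?thesis using g(5) old(1) eq by (auto dest: inj_onD)
    next
      case True
      note nx = new[OF xy(1) True] and ny = new[OF xy(3) True[unfolded l]]
      have "g (par x) = g (par y)" "\<kappa> x = \<kappa> y" using nx ny eq by auto
      then have p: "par x = par y" using g(5) nx(5,6) ny(5,6) by (auto dest: inj_onD)
      have "x \<in> V - R" "y \<in> V - R" using xy True l by (auto dest: lev_root)
      then have "x \<in> ch (par x) (\<kappa> x)" "y \<in> ch (par x) (\<kappa> x)" using p \<open>\<kappa> x = \<kappa> y\<close> by (auto simp: ch_def)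
      moreover have "\<beta> (par x) (\<kappa> x) x = \<beta> (par x) (\<kappa> x) y"
        using eq True l p \<open>\<kappa> x = \<kappa> y\<close> by (simp add: h_def)
      ultimately show ?thesis
        using \<beta>[of "par x" "\<kappa> x"] nx(5,6) unfolding bij_betw_def by (auto dest: inj_onD)
    qed
  qed
  ultimately show ?case by (intro exI[of _ h]) blast
qed

lemma forest_auts_extension:
  assumes s: "s permutes R"
  obtains g where "g \<in> forest_auts" "\<And>r. r \<in> R \<Longrightarrow> g r = s r"
proof -
  define n where "n = Max (insert 0 (lev ` V))"
  have n: "lev x \<le> n" if "x \<in> V" for x unfolding n_def using fin that by (intro Max_ge) auto
  obtain g where "\<forall>r\<in>R. g r = s r" "\<forall>x\<in>V. lev x \<le> n \<longrightarrow> g x \<in> V \<and> \<kappa> (g x) = \<kappa> x"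
    "\<forall>y\<in>V - R. lev y \<le> n \<longrightarrow> par (g y) = g (par y)" "inj_on g {x \<in> V. lev x \<le> n}"
    using partial_extension[OF s, of n] by (elim exE conjE)
  moreover have "{x \<in> V. lev x \<le> n} = V" using n by blast
  ultimately have g: "\<And>r. r \<in> R \<Longrightarrow> g r = s r" "\<And>x. x \<in> V \<Longrightarrow> g x \<in> V" "\<And>x. x \<in> V \<Longrightarrow> \<kappa> (g x) = \<kappa> x"
    "\<And>y. y \<in> V - R \<Longrightarrow> par (g y) = g (par y)" "inj_on g V"
    using n by simp_all
  let ?g = "\<lambda>x. if x \<in> V then g x else x"
  have "?g permutes V"
  proof (rule inj_permutes)
    show "inj_on ?g V" using g(5) by (auto simp: inj_on_def)
  qed (use g(2) in auto)
  moreover have "par (?g y) = ?g (par y)" if "y \<in> V - R" for y using g(4) par_in that by simp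
  ultimately have "?g \<in> forest_auts" unfolding forest_auts_def using g(3) by simp
  then show thesis by (rule that) (use g(1) R_sub in auto)
qed

lemma forest_auts_transitive:
  assumes "v \<in> R"
  obtains g where "\<And>u. u \<in> R \<Longrightarrow> g u \<in> forest_auts" "\<And>u. u \<in> R \<Longrightarrow> g u v = u"
proof -
  have "\<exists>h. h \<in> forest_auts \<and> h v = u" if "u \<in> R" for u
  proof -
    have "transpose v u permutes R" using assms that by (intro permutes_swap_id)
    then obtain h where "h \<in> forest_auts" "\<And>r. r \<in> R \<Longrightarrow> h r = transpose v u r" using forest_auts_extension by blast
    then show ?thesis using assms by (intro exI[of _ h]) simp
  qed
  then show thesis using that by metis
qed

definition leg_auts :: "'a \<Rightarrow> ('a \<Rightarrow> 'a) set" where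
  "leg_auts v = {\<pi> \<in> forest_auts. \<forall>x. x \<notin> tree_at v \<longrightarrow> \<pi> x = x}"

lemma leg_autsD:
  assumes "\<pi> \<in> leg_auts v" "v \<in> R"
  shows "\<pi> \<in> forest_auts" "\<And>x. x \<notin> tree_at v \<Longrightarrow> \<pi> x = x" "\<And>r. r \<in> R \<Longrightarrow> \<pi> r = r" "\<And>x. \<pi> x \<in> tree_at v \<longleftrightarrow> x \<in> tree_at v"
proof -
  show \<pi>: "\<pi> \<in> forest_auts" "\<And>x. x \<notin> tree_at v \<Longrightarrow> \<pi> x = x" using assms(1) by (auto simp: leg_auts_def)
  have inj: "\<pi> x = \<pi> y \<longleftrightarrow> x = y" for x y using permutes_inj[OF forest_autsD(1)[OF \<pi>(1)]] by (auto simp: inj_eq)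
  show r: "\<pi> r = r" if "r \<in> R" for r
  proof (cases "\<pi> r \<in> tree_at v")
    case False
    then show ?thesis using \<pi>(2) inj by blast
  next
    case True
    then have "\<pi> r = v" using forest_autsD(5)[OF \<pi>(1)] that root_of_root by (simp add: tree_at_def)
    moreover have "r = v" if "r \<noteq> v"
    proof -
      have "r \<notin> tree_at v" using that root_of_root \<open>r \<in> R\<close> by (simp add: tree_at_def)
      then show ?thesis using \<pi>(2) calculation by simp
    qed
    ultimately show ?thesis by metis
  qed
  show "\<pi> x \<in> tree_at v \<longleftrightarrow> x \<in> tree_at v" for x
    using forest_auts_leg[OF \<pi>(1) assms(2), of x] r[OF assms(2)] by simp
qed

lemma leg_auts_restrict:
  assumes "k \<in> forest_auts" "v \<in> R" "k v = v"
  shows "(\<lambda>y. if y \<in> tree_at v then k y else y) \<in> leg_auts v"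
proof -
  have "(\<lambda>y. if y \<in> V then (if root_of y = v then k else id) y else y) \<in> forest_auts"
    by (rule forest_auts_assemble[where h = "\<lambda>u. if u = v then k else id", OF permutes_id]) (use assms forest_auts_id in \<open>auto split: if_splits\<close>)
  also have "(\<lambda>y. if y \<in> V then (if root_of y = v then k else id) y else y) = (\<lambda>y. if y \<in> tree_at v then k y else y)"
    by (auto simp: tree_at_def)
  finally show ?thesis by (simp add: leg_auts_def)
qed

lemma leg_auts_id: "id \<in> leg_auts v"
  by (simp add: leg_auts_def forest_auts_id)

lemma leg_auts_comp: "\<pi> \<in> leg_auts v \<Longrightarrow> \<pi>' \<in> leg_auts v \<Longrightarrow> \<pi> \<circ> \<pi>' \<in> leg_auts v"
  by (simp add: leg_auts_def forest_auts_comp)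

lemma leg_auts_inv:
  assumes "\<pi> \<in> leg_auts v" shows "inv \<pi> \<in> leg_auts v"
proof -
  have \<pi>: "\<pi> \<in> forest_auts" using assms by (simp add: leg_auts_def)
  have "inv \<pi> x = x" if "x \<notin> tree_at v" for x
    using assms that forest_auts_inv_cancel(2)[OF \<pi>, of x] by (simp add: leg_auts_def)
  then show ?thesis using forest_auts_inv[OF \<pi>] by (simp add: leg_auts_def)
qed

definition head_restrict :: "('a \<Rightarrow> 'a) \<Rightarrow> 'a \<Rightarrow> 'a" where
  "head_restrict g x = (if x \<in> R then g x else x)"

lemma forest_distinguishing_iff:
  assumes v: "v \<in> R" and \<Gamma>: "\<And>s. s \<in> \<Gamma> \<Longrightarrow> s permutes R" "id \<in> \<Gamma>"
  shows "distinguishing_labelings V {g \<in> forest_auts. head_restrict g \<in> \<Gamma>} c \<noteq> {} \<longleftrightarrow>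
    fewest_colors R \<Gamma> \<le> inequivalent_count (tree_at v) (leg_auts v) c"
proof -
  define L where "L = tree_at v"
  define D where "D = distinguishing_labelings L (leg_auts v) c"
  define rel where "rel = {(\<phi>, \<phi>'). \<phi> \<in> D \<and> \<phi>' \<in> D \<and> (\<exists>\<pi>\<in>leg_auts v. \<forall>x\<in>L. \<phi> x = \<phi>' (\<pi> x))}"
  have N: "inequivalent_count (tree_at v) (leg_auts v) c = card (D // rel)"
    unfolding inequivalent_count_def rel_def D_def L_def ..
  note LD = leg_autsD[OF _ v, folded L_def]
  have LV: "x \<in> V" if "x \<in> L" for x using that by (simp add: L_def tree_at_def)
  have "equiv D rel"
  proof (rule equivI)
    show "rel \<subseteq> D \<times> D" by (auto simp: rel_def)
    show "refl_on D rel" using leg_auts_id by (auto simp: refl_on_def rel_def intro!: bexI[of _ id])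
    show "sym rel"
    proof (rule symI)
      fix \<phi> \<phi>' assume "(\<phi>, \<phi>') \<in> rel"
      then obtain \<pi> where \<pi>: "\<phi> \<in> D" "\<phi>' \<in> D" "\<pi> \<in> leg_auts v" "\<forall>x\<in>L. \<phi> x = \<phi>' (\<pi> x)"
        by (auto simp: rel_def)
      have "\<phi>' x = \<phi> (inv \<pi> x)" if "x \<in> L" for x
      proof -
        have "\<pi> (inv \<pi> x) = x" using forest_auts_inv_cancel(1)[OF LD(1)[OF \<pi>(3)]] .
        moreover have "inv \<pi> x \<in> L" using LD(4)[OF leg_auts_inv[OF \<pi>(3)]] that by blast
        ultimately show ?thesis using \<pi>(4) by metis
      qed
      then show "(\<phi>', \<phi>) \<in> rel" using \<pi> leg_auts_inv[OF \<pi>(3)] unfolding rel_def by blast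
    qed
    show "trans rel"
    proof (rule transI)
      fix \<phi> \<phi>' \<phi>'' assume "(\<phi>, \<phi>') \<in> rel" "(\<phi>', \<phi>'') \<in> rel"
      then obtain \<pi> \<pi>' where \<pi>: "\<phi> \<in> D" "\<phi>'' \<in> D" "\<pi> \<in> leg_auts v" "\<forall>x\<in>L. \<phi> x = \<phi>' (\<pi> x)"
        "\<pi>' \<in> leg_auts v" "\<forall>x\<in>L. \<phi>' x = \<phi>'' (\<pi>' x)"
        by (auto simp: rel_def)
      have "\<forall>x\<in>L. \<phi> x = \<phi>'' ((\<pi>' \<circ> \<pi>) x)" using \<pi>(4,6) LD(4)[OF \<pi>(3)] by simp
      then show "(\<phi>, \<phi>'') \<in> rel" using \<pi> leg_auts_comp[OF \<pi>(5,3)] unfolding rel_def by blast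
    qed
  qed
  have finV: "finite L" using fin by (simp add: L_def tree_at_def)
  have finQ: "finite (D // rel)"
    unfolding D_def by (rule finite_quotient) (use finite_distinguishing_labelings[OF finV] \<open>equiv D rel\<close> in \<open>auto simp: D_def rel_def\<close>)
  obtain g where g: "\<And>u. u \<in> R \<Longrightarrow> g u \<in> forest_auts" "\<And>u. u \<in> R \<Longrightarrow> g u v = u"
    using forest_auts_transitive[OF v] by blast
  note gc = forest_auts_inv_cancel[OF g(1)] and gD = forest_autsD[OF g(1)]
  have g_leg: "g u x \<in> tree_at u \<longleftrightarrow> x \<in> L" if "u \<in> R" for u x
    using forest_auts_leg[OF g(1)[OF that] v, of x] g(2)[OF that] by (simp add: L_def)
  have g_inv_leg: "inv (g (root_of y)) y \<in> L" if "y \<in> V" for y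
    using g_leg[OF root_of_in[OF that], of "inv (g (root_of y)) y"] gc(1)[OF root_of_in[OF that]] that by (simp add: tree_at_def)
  have rt_g: "root_of (g u x) = u" if "u \<in> R" "x \<in> L" for u x
    using g_leg[OF that(1), THEN iffD2, OF that(2)] by (simp add: tree_at_def)
  have "finite R" using fin R_sub finite_subset by blast
  have *: "fewest_colors R \<Gamma> \<le> inequivalent_count (tree_at v) (leg_auts v) c \<longleftrightarrow>
      distinguishing_labelings R \<Gamma> (card (D // rel)) \<noteq> {}"
    unfolding N by (rule fewest_colors_le_iff[OF \<open>finite R\<close> \<Gamma>(1)])
  show ?thesis
    unfolding *
  proof
    assume "distinguishing_labelings V {g \<in> forest_auts. head_restrict g \<in> \<Gamma>} c \<noteq> {}"
    then obtain \<phi> where \<phi>: "\<phi> \<in> V \<rightarrow>\<^sub>E {..<c}"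
      "\<And>\<pi>. \<pi> \<in> forest_auts \<Longrightarrow> head_restrict \<pi> \<in> \<Gamma> \<Longrightarrow> (\<And>y. y \<in> V \<Longrightarrow> \<phi> (\<pi> y) = \<phi> y) \<Longrightarrow> \<pi> = id"
      unfolding distinguishing_labelings_def by blast
    define \<theta> where "\<theta> u = (\<lambda>x\<in>L. \<phi> (g u x))" for u
    have \<theta>D: "\<theta> u \<in> D" if u: "u \<in> R" for u
    proof -
      have "\<theta> u \<in> L \<rightarrow>\<^sub>E {..<c}"
        using \<phi>(1) gD(4)[OF u] LV by (auto simp: \<theta>_def PiE_iff)
      moreover have "\<pi> = id" if \<pi>: "\<pi> \<in> leg_auts v" and pres: "\<forall>x\<in>L. \<theta> u (\<pi> x) = \<theta> u x" for \<pi>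
      proof -
        let ?\<Psi> = "g u \<circ> (\<pi> \<circ> inv (g u))"
        have \<Psi>: "?\<Psi> \<in> forest_auts" using forest_auts_comp[OF g(1)[OF u] forest_auts_comp[OF LD(1)[OF \<pi>] forest_auts_inv[OF g(1)[OF u]]]] .
        have fix_R: "?\<Psi> r = r" if "r \<in> R" for r
          using LD(3)[OF \<pi>] forest_autsD(5)[OF forest_auts_inv[OF g(1)[OF u]]] that gc(1)[OF u] by simp
        then have "head_restrict ?\<Psi> = id" by (auto simp: head_restrict_def)
        moreover have "\<phi> (?\<Psi> y) = \<phi> y" if "y \<in> V" for y
        proof (cases "inv (g u) y \<in> L")
          case True
          then have "\<phi> (g u (\<pi> (inv (g u) y))) = \<phi> (g u (inv (g u) y))"
            using pres LD(4)[OF \<pi>] unfolding \<theta>_def by auto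
          then show ?thesis using gc(1)[OF u] by simp
        next
          case False
          then show ?thesis using LD(2)[OF \<pi>] gc(1)[OF u] by simp
        qed
        ultimately have id: "?\<Psi> = id" using \<phi>(2)[OF \<Psi>] \<Gamma>(2) by simp
        have "\<pi> x = x" for x
          using fun_cong[OF id, of "g u x"] gc(2)[OF u] by (metis comp_apply id_apply)
        then show ?thesis by auto
      qed
      ultimately show ?thesis unfolding D_def distinguishing_labelings_def by blast
    qed
    show "distinguishing_labelings R \<Gamma> (card (D // rel)) \<noteq> {}"
    proof (rule distinguishing_labelings_via_colors[OF finQ, where \<psi> = "\<lambda>u. rel `` {\<theta> u}"])
      show "(\<lambda>u. rel `` {\<theta> u}) ` R \<subseteq> D // rel" using \<theta>D by (auto intro: quotientI)
      show "s permutes R" if "s \<in> \<Gamma>" for s using \<Gamma>(1) that .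
      fix s assume s: "s \<in> \<Gamma>" and eq: "\<And>u. u \<in> R \<Longrightarrow> rel `` {\<theta> (s u)} = rel `` {\<theta> u}"
      have sR: "s u \<in> R" if "u \<in> R" for u using \<Gamma>(1)[OF s] that by (simp add: permutes_in_image)
      have "(\<theta> u, \<theta> (s u)) \<in> rel" if "u \<in> R" for u
        using eq[OF that] \<theta>D[OF that] \<theta>D[OF sR[OF that]] \<open>equiv D rel\<close> by (metis eq_equiv_class_iff)
      then have "\<forall>u\<in>R. \<exists>\<pi>. \<pi> \<in> leg_auts v \<and> (\<forall>x\<in>L. \<theta> u x = \<theta> (s u) (\<pi> x))"
        unfolding rel_def by blast
      then obtain \<pi> where \<pi>: "\<And>u. u \<in> R \<Longrightarrow> \<pi> u \<in> leg_auts v"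
        "\<And>u x. u \<in> R \<Longrightarrow> x \<in> L \<Longrightarrow> \<theta> u x = \<theta> (s u) (\<pi> u x)" by metis
      define h where "h u = g (s u) \<circ> (\<pi> u \<circ> inv (g u))" for u
      let ?\<Psi> = "\<lambda>y. if y \<in> V then h (root_of y) y else y"
      have \<Psi>: "?\<Psi> \<in> forest_auts"
      proof (rule forest_auts_assemble[OF \<Gamma>(1)[OF s]])
        fix u assume u: "u \<in> R"
        show "h u \<in> forest_auts" unfolding h_def
          by (intro forest_auts_comp forest_auts_inv g(1) sR u LD(1) \<pi>(1))
        have "inv (g u) u = v" using gc(2)[OF u, of v] g(2)[OF u] by simp
        then show "h u u = s u" unfolding h_def using LD(3)[OF \<pi>(1)[OF u] v] g(2)[OF sR[OF u]] by simp
      qed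
      have \<Psi>R: "?\<Psi> u = s u" if "u \<in> R" for u
      proof -
        have "inv (g u) u = v" using gc(2)[OF that, of v] g(2)[OF that] by simp
        then show ?thesis unfolding h_def
          using LD(3)[OF \<pi>(1)[OF that] v] g(2)[OF sR[OF that]] root_of_root[OF that] R_sub that by auto
      qed
      then have "head_restrict ?\<Psi> = s"
        using \<Gamma>(1)[OF s] by (auto simp: head_restrict_def permutes_def)
      moreover have "\<phi> (?\<Psi> y) = \<phi> y" if y: "y \<in> V" for y
      proof -
        let ?u = "root_of y" and ?x = "inv (g (root_of y)) y"
        have u: "?u \<in> R" using root_of_in[OF y] .
        have x: "?x \<in> L" using g_inv_leg[OF y] .
        have "\<phi> (?\<Psi> y) = \<theta> (s ?u) (\<pi> ?u ?x)"
          using y x LD(4)[OF \<pi>(1)[OF u]] by (simp add: h_def \<theta>_def)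
        also have "\<dots> = \<theta> ?u ?x" using \<pi>(2)[OF u x] by simp
        also have "\<dots> = \<phi> y" using x gc(1)[OF u] by (simp add: \<theta>_def)
        finally show ?thesis .
      qed
      ultimately have "?\<Psi> = id" using \<phi>(2)[OF \<Psi>] s by simp
      from fun_cong[OF this] have "s u = u" if "u \<in> R" for u using \<Psi>R[OF that] by simp
      then show "s = id" using \<Gamma>(1)[OF s] by (auto simp: permutes_def fun_eq_iff)
    qed
  next
    assume "distinguishing_labelings R \<Gamma> (card (D // rel)) \<noteq> {}"
    then obtain \<chi> where \<chi>: "\<chi> \<in> R \<rightarrow>\<^sub>E {..<card (D // rel)}"
      "\<And>s. s \<in> \<Gamma> \<Longrightarrow> (\<And>u. u \<in> R \<Longrightarrow> \<chi> (s u) = \<chi> u) \<Longrightarrow> s = id"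
      unfolding distinguishing_labelings_def by blast
    obtain \<beta> where \<beta>: "bij_betw \<beta> {0..<card (D // rel)} (D // rel)"
      using ex_bij_betw_nat_finite[OF finQ] by blast
    have \<chi>_in: "\<chi> u \<in> {0..<card (D // rel)}" if "u \<in> R" for u using \<chi>(1) that by (auto simp: PiE_iff)
    have "\<exists>\<mu>. \<mu> \<in> D \<and> \<beta> (\<chi> u) = rel `` {\<mu>}" if "u \<in> R" for u
    proof -
      have "\<beta> (\<chi> u) \<in> D // rel" using bij_betwE[OF \<beta>] \<chi>_in[OF that] by blast
      then show ?thesis by (metis quotientE)
    qed
    then obtain \<mu> where \<mu>: "\<And>u. u \<in> R \<Longrightarrow> \<mu> u \<in> D" "\<And>u. u \<in> R \<Longrightarrow> \<beta> (\<chi> u) = rel `` {\<mu> u}" by metis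
    define \<phi> where "\<phi> = (\<lambda>y\<in>V. \<mu> (root_of y) (inv (g (root_of y)) y))"
    have \<mu>D: "\<mu> u \<in> L \<rightarrow>\<^sub>E {..<c}" "\<And>\<pi>. \<pi> \<in> leg_auts v \<Longrightarrow> (\<And>x. x \<in> L \<Longrightarrow> \<mu> u (\<pi> x) = \<mu> u x) \<Longrightarrow> \<pi> = id"
      if "u \<in> R" for u
      using \<mu>(1)[OF that] unfolding D_def distinguishing_labelings_def by auto
    have \<phi>_g: "\<phi> (g u x) = \<mu> u x" if "u \<in> R" "x \<in> L" for u x
      using rt_g[OF that] gc(2)[OF that(1)] gD(4)[OF that(1)] LV[OF that(2)] by (simp add: \<phi>_def)
    have "\<phi> \<in> V \<rightarrow>\<^sub>E {..<c}"
      unfolding \<phi>_def using \<mu>D(1)[OF root_of_in] g_inv_leg by (auto simp: PiE_iff)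
    moreover have "\<Psi> = id" if \<Psi>: "\<Psi> \<in> forest_auts" and head: "head_restrict \<Psi> \<in> \<Gamma>" and pres: "\<forall>y\<in>V. \<phi> (\<Psi> y) = \<phi> y" for \<Psi>
    proof -
      define k where "k u = inv (g (\<Psi> u)) \<circ> (\<Psi> \<circ> g u)" for u
      let ?\<pi> = "\<lambda>u y. if y \<in> L then k u y else y"
      have \<Psi>R: "\<Psi> u \<in> R" if "u \<in> R" for u using forest_autsD(5)[OF \<Psi>] that by simp
      have \<pi>: "?\<pi> u \<in> leg_auts v" if "u \<in> R" for u
        unfolding L_def
      proof (rule leg_auts_restrict[OF _ v])
        show "k u \<in> forest_auts" unfolding k_def
          by (intro forest_auts_comp forest_auts_inv g(1) \<Psi>R that \<Psi>)
        show "k u v = v" unfolding k_def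
          using g(2)[OF that] gc(2)[OF \<Psi>R[OF that], of v] g(2)[OF \<Psi>R[OF that]] by simp
      qed
      have eq: "\<mu> u x = \<mu> (\<Psi> u) (?\<pi> u x)" if u: "u \<in> R" and x: "x \<in> L" for u x
      proof -
        have kx: "k u x \<in> L" using LD(4)[OF \<pi>[OF u], of x] x by simp
        have "g (\<Psi> u) (k u x) = \<Psi> (g u x)" unfolding k_def using gc(1)[OF \<Psi>R[OF u]] by simp
        then have "\<mu> (\<Psi> u) (k u x) = \<phi> (\<Psi> (g u x))" using \<phi>_g[OF \<Psi>R[OF u] kx] by simp
        also have "\<dots> = \<phi> (g u x)" using pres gD(4)[OF u] LV[OF x] by simp
        also have "\<dots> = \<mu> u x" using \<phi>_g[OF u x] .
        finally show ?thesis using x by simp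
      qed
      have "\<chi> (\<Psi> u) = \<chi> u" if u: "u \<in> R" for u
      proof -
        have "\<exists>\<pi>\<in>leg_auts v. \<forall>x\<in>L. \<mu> u x = \<mu> (\<Psi> u) (\<pi> x)"
          by (rule bexI[OF _ \<pi>[OF u]]) (intro ballI eq[OF u])
        then have "(\<mu> u, \<mu> (\<Psi> u)) \<in> rel"
          using \<mu>(1)[OF u] \<mu>(1)[OF \<Psi>R[OF u]] by (simp add: rel_def)
        then have "rel `` {\<mu> u} = rel `` {\<mu> (\<Psi> u)}" using \<open>equiv D rel\<close> by (rule equiv_class_eq[rotated])
        then have "\<beta> (\<chi> u) = \<beta> (\<chi> (\<Psi> u))" using \<mu>(2)[OF u] \<mu>(2)[OF \<Psi>R[OF u]] by simp
        then show ?thesis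
          using \<beta> \<chi>_in[OF u] \<chi>_in[OF \<Psi>R[OF u]] unfolding bij_betw_def by (auto dest: inj_onD)
      qed
      then have hr: "head_restrict \<Psi> = id" by (intro \<chi>(2)[OF head]) (simp add: head_restrict_def)
      have fixR: "\<Psi> u = u" if "u \<in> R" for u
        using fun_cong[OF hr, of u] that by (simp add: head_restrict_def)
      have "\<Psi> y = y" if y: "y \<in> V" for y
      proof -
        let ?u = "root_of y" and ?x = "inv (g (root_of y)) y"
        have u: "?u \<in> R" using root_of_in[OF y] .
        have x: "?x \<in> L" using g_inv_leg[OF y] .
        have "?\<pi> ?u = id" by (rule \<mu>D(2)[OF u \<pi>[OF u]]) (use eq[OF u] fixR[OF u] in simp)
        from fun_cong[OF this, of ?x] have "k ?u ?x = ?x" using x by simp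
        then have "g ?u (inv (g ?u) (\<Psi> (g ?u ?x))) = g ?u ?x" unfolding k_def fixR[OF u] by simp
        then show ?thesis using gc(1)[OF u] by simp
      qed
      moreover have "\<Psi> y = y" if "y \<notin> V" for y using forest_autsD(1)[OF \<Psi>] that by (simp add: permutes_def)
      ultimately show ?thesis by (auto simp: fun_eq_iff)
    qed
    ultimately have "\<phi> \<in> distinguishing_labelings V {g \<in> forest_auts. head_restrict g \<in> \<Gamma>} c"
      unfolding distinguishing_labelings_def by blast
    then show "distinguishing_labelings V {g \<in> forest_auts. head_restrict g \<in> \<Gamma>} c \<noteq> {}" by blast
  qed
qed

lemma forest_fewest_colors:
  assumes v: "v \<in> R" and \<Gamma>: "\<And>s. s \<in> \<Gamma> \<Longrightarrow> s permutes R" "id \<in> \<Gamma>"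
  shows "\<exists>c. fewest_colors R \<Gamma> \<le> inequivalent_count (tree_at v) (leg_auts v) c"
    and "fewest_colors V {g \<in> forest_auts. head_restrict g \<in> \<Gamma>} =
      (LEAST c. fewest_colors R \<Gamma> \<le> inequivalent_count (tree_at v) (leg_auts v) c)"
proof -
  show "\<exists>c. fewest_colors R \<Gamma> \<le> inequivalent_count (tree_at v) (leg_auts v) c"
    using distinguishing_labelings_card_nonempty[OF fin, of "{g \<in> forest_auts. head_restrict g \<in> \<Gamma>}"] forest_autsD(1)
      forest_distinguishing_iff[OF assms] by blast
  show "fewest_colors V {g \<in> forest_auts. head_restrict g \<in> \<Gamma>} =
      (LEAST c. fewest_colors R \<Gamma> \<le> inequivalent_count (tree_at v) (leg_auts v) c)"
    unfolding fewest_colors_def[of V]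
    by (intro arg_cong[where f = Least] ext) (rule forest_distinguishing_iff[OF assms])
qed

end

section \<open>The jellyfish graph\<close>

context amenable_component
begin

definition cell :: "'a \<Rightarrow> 'a set" where
  "cell y = (THE X. X \<in> A \<and> y \<in> X)"

definition pcell :: "'a set \<Rightarrow> 'a set" where
  "pcell Y = (SOME X. X \<in> A \<and> parent X Y)"

definition par :: "'a \<Rightarrow> 'a" where
  "par y = proj (pcell (cell y)) (cell y) y"

definition head_arcs :: "('a \<times> 'a) set" where
  "head_arcs = cell_arcs (induced G (\<Union>A)) R R"

lemma cell_eq: "X \<in> A \<Longrightarrow> y \<in> X \<Longrightarrow> cell y = X"
  unfolding cell_def using cell_unique component_cells by (intro the_equality) blast+

lemma cell_in: "y \<in> \<Union>A \<Longrightarrow> cell y \<in> A" "y \<in> \<Union>A \<Longrightarrow> y \<in> cell y"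
  using cell_eq by auto

lemma cell_root: "r \<in> R \<Longrightarrow> cell r = R"
  using cell_eq root_in by blast

lemma cell_eq_root_iff: "y \<in> \<Union>A \<Longrightarrow> cell y = R \<longleftrightarrow> y \<in> R"
  using cell_in cell_root by blast

lemma pcell_props:
  assumes "Y \<in> A" "Y \<noteq> R"
  shows "pcell Y \<in> A" "parent (pcell Y) Y" "(pcell Y, Y) \<in> aniso_rel G" "lev Y = Suc (lev (pcell Y))"
    "card (pcell Y) \<le> card Y"
proof -
  have "pcell Y \<in> A \<and> parent (pcell Y) Y"
    unfolding pcell_def by (rule someI_ex) (use ex_parent[OF assms] in blast)
  then show "pcell Y \<in> A" "parent (pcell Y) Y" by auto
  then show "(pcell Y, Y) \<in> aniso_rel G" "lev Y = Suc (lev (pcell Y))" "card (pcell Y) \<le> card Y"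
    using parentD parent_card by blast+
qed

lemma par_props:
  assumes "y \<in> \<Union>A - R"
  shows "par y \<in> pcell (cell y)" "(par y, y) \<in> link (pcell (cell y)) (cell y)" "par y \<in> \<Union>A"
    "cell (par y) = pcell (cell y)" "lev (cell y) = Suc (lev (cell (par y)))"
proof -
  have Y: "cell y \<in> A" "cell y \<noteq> R" "y \<in> cell y" using assms cell_in cell_eq_root_iff by auto
  note p = pcell_props[OF Y(1,2)]
  show "par y \<in> pcell (cell y)" unfolding par_def by (rule proj_in[OF p(3,5) Y(3)])
  then show "par y \<in> \<Union>A" "cell (par y) = pcell (cell y)" using p(1) cell_eq by auto
  then show "lev (cell y) = Suc (lev (cell (par y)))" using p(4) by simp
  show "(par y, y) \<in> link (pcell (cell y)) (cell y)"
    unfolding par_def using proj_eq_iff[OF p(3,5) Y(3)] by blast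
qed

lemma link_parent:
  assumes XY: "X \<in> A" "Y \<in> A" "(X, Y) \<in> aniso_rel G" "lev X \<le> lev Y" and l: "(u, w) \<in> link X Y"
  shows "w \<in> \<Union>A - R \<and> u = par w"
proof -
  have uw: "u \<in> X" "w \<in> Y" using l by (auto simp: link_def)
  have YR: "Y \<noteq> R"
    using XY anisoD[OF XY(3)] lev_root lev_0_iff[OF XY(1)] by auto
  note p = pcell_props[OF XY(2) YR]
  have X: "X = pcell Y" by (rule parent_unique[OF XY(2) p(1,2) XY(1,3,4)])
  have c: "cell w = Y" using cell_eq XY(2) uw(2) by blast
  have "w \<in> \<Union>A - R" using XY(2) uw(2) cell_root c YR by blast
  moreover have "u = par w"
    unfolding par_def c using proj_eq_iff[OF p(3,5) uw(2), of u] l X by simp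
  ultimately show ?thesis ..
qed

lemma pair_arcs_induced:
  assumes "X \<in> A" "Y \<in> A"
  shows "pair_arcs (induced G (\<Union>A)) X Y = pair_arcs G X Y"
proof -
  let ?K = "induced G (\<Union>A)"
  have arcs: "(u, v) \<in> parcs ?K \<longleftrightarrow> (u, v) \<in> parcs G" if "u \<in> \<Union>A" "v \<in> \<Union>A" for u v
    using that by (simp add: induced_def)
  have "bip_empty ?K X Y = bip_empty G X Y" "bip_complete ?K X Y = bip_complete G X Y"
    using arcs assms unfolding bip_empty_def bip_complete_def by blast+
  moreover have "bip_complement ?K X Y = bip_complement G X Y"
    using arcs assms unfolding bip_complement_def by blast
  moreover have "X \<times> Y - parcs ?K = X \<times> Y - parcs G" "parcs ?K \<inter> X \<times> Y = parcs G \<inter> X \<times> Y"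
    using arcs assms by blast+
  ultimately show ?thesis unfolding pair_arcs_def isotropic_def by simp
qed

lemma cell_arcs_nonroot:
  assumes "X \<in> A" "X \<noteq> R"
  shows "cell_arcs (induced G (\<Union>A)) R X = {}"
proof -
  let ?K = "induced G (\<Union>A)"
  have arcs: "(u, v) \<in> parcs ?K \<longleftrightarrow> (u, v) \<in> parcs G" if "u \<in> X" "v \<in> X" for u v
    using that assms(1) by (auto simp: induced_def)
  have "homogeneous G X" using nonroot_homogeneous[OF assms] .
  then have "empty_on ?K X \<or> complete_on ?K X"
    unfolding homogeneous_def empty_on_def complete_on_def using arcs by blast
  then show ?thesis using assms(2) unfolding cell_arcs_def complete_on_def empty_on_def by auto
qed

lemma pair_arcs_isotropic:
  assumes "isotropic G X Y" shows "pair_arcs G X Y = {}"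
  using assms unfolding pair_arcs_def isotropic_def bip_empty_def bip_complete_def by auto

lemma pverts_jellyfish: "pverts (jellyfish G A R) = \<Union>A"
  by (simp add: jellyfish_def induced_def Let_def)

lemma head_arcs_sub: "head_arcs \<subseteq> R \<times> R"
  unfolding head_arcs_def cell_arcs_def by auto

lemma jellyfish_arcs:
  "(u, w) \<in> parcs (jellyfish G A R) \<longleftrightarrow>
    (u, w) \<in> head_arcs \<or> (w \<in> \<Union>A - R \<and> u = par w) \<or> (u \<in> \<Union>A - R \<and> w = par u)"
proof -
  have "parcs (jellyfish G A R) = (\<Union>X\<in>A. cell_arcs (induced G (\<Union>A)) R X) \<union> (\<Union>X\<in>A. \<Union>Y\<in>A - {X}. pair_arcs (induced G (\<Union>A)) X Y)"
    by (simp add: jellyfish_def Let_def)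
  also have "(\<Union>X\<in>A. cell_arcs (induced G (\<Union>A)) R X) = head_arcs"
    using cell_arcs_nonroot root_in unfolding head_arcs_def by blast
  also have "(\<Union>X\<in>A. \<Union>Y\<in>A - {X}. pair_arcs (induced G (\<Union>A)) X Y) = (\<Union>X\<in>A. \<Union>Y\<in>A - {X}. pair_arcs G X Y)"
    using pair_arcs_induced by auto
  finally have arcs: "(u, w) \<in> parcs (jellyfish G A R) \<longleftrightarrow>
      (u, w) \<in> head_arcs \<or> (\<exists>X\<in>A. \<exists>Y\<in>A. X \<noteq> Y \<and> (u, w) \<in> pair_arcs G X Y)" by blast
  have "(\<exists>X\<in>A. \<exists>Y\<in>A. X \<noteq> Y \<and> (u, w) \<in> pair_arcs G X Y) \<longleftrightarrow>
      (w \<in> \<Union>A - R \<and> u = par w) \<or> (u \<in> \<Union>A - R \<and> w = par u)" (is "?l \<longleftrightarrow> ?r")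
  proof
    assume ?l
    then obtain X Y where XY: "X \<in> A" "Y \<in> A" "X \<noteq> Y" "(u, w) \<in> pair_arcs G X Y" by blast
    have "\<not> isotropic G X Y" using pair_arcs_isotropic XY(4) by blast
    then have an: "(X, Y) \<in> aniso_rel G" using XY component_cells by (simp add: aniso_rel_def)
    then have l: "(u, w) \<in> link X Y" using pair_arcs_eq_link XY(4) by simp
    show ?r
    proof (cases "lev X \<le> lev Y")
      case True
      then show ?thesis using link_parent[OF XY(1,2) an _ l] by blast
    next
      case False
      then show ?thesis
        using link_parent[OF XY(2,1) aniso_sym[OF an], of w u] l link_sym[of u w X Y] by simp
    qed
  next
    have *: "\<exists>X\<in>A. \<exists>Y\<in>A. X \<noteq> Y \<and> (par y, y) \<in> pair_arcs G X Y \<and> (y, par y) \<in> pair_arcs G Y X"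
      if y: "y \<in> \<Union>A - R" for y
    proof -
      have Y: "cell y \<in> A" "cell y \<noteq> R" using y cell_in cell_eq_root_iff by auto
      note p = pcell_props[OF Y]
      have "(par y, y) \<in> pair_arcs G (pcell (cell y)) (cell y)"
        using par_props(2)[OF y] pair_arcs_eq_link[OF p(3)] by simp
      moreover have "(y, par y) \<in> pair_arcs G (cell y) (pcell (cell y))"
        using par_props(2)[OF y] pair_arcs_eq_link[OF aniso_sym[OF p(3)]] link_sym by simp
      moreover have "pcell (cell y) \<noteq> cell y" using anisoD[OF p(3)] by blast
      ultimately show ?thesis using p(1) Y(1) by blast
    qed
    assume ?r
    then show ?l
    proof
      assume "w \<in> \<Union>A - R \<and> u = par w"
      then show ?l using *[of w] by blast
    next
      assume r: "u \<in> \<Union>A - R \<and> w = par u"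
      obtain X Y where "X \<in> A" "Y \<in> A" "X \<noteq> Y" "(u, par u) \<in> pair_arcs G Y X" using *[of u] r by blast
      then show ?l using r by metis
    qed
  qed
  then show ?thesis using arcs by blast
qed

lemma parent_child_iff: "(u, w) \<in> parent_child G A R \<longleftrightarrow> w \<in> \<Union>A - R \<and> u = par w"
proof
  assume "(u, w) \<in> parent_child G A R"
  then obtain X Y where J: "(u, w) \<in> parcs (jellyfish G A R)" and XY: "X \<in> A" "Y \<in> A" "parent X Y" "u \<in> X" "w \<in> Y"
    unfolding parent_child_def by blast
  have c: "cell u = X" "cell w = Y" using cell_eq XY by auto
  have l: "lev Y = Suc (lev X)" using parentD XY(3) by blast
  have "(u, w) \<notin> head_arcs" using head_arcs_sub c cell_root l by fastforce
  moreover have "\<not> (u \<in> \<Union>A - R \<and> w = par u)"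
  proof
    assume "u \<in> \<Union>A - R \<and> w = par u"
    then have "lev (cell u) = Suc (lev (cell w))" using par_props(5)[of u] by simp
    then show False using c l by simp
  qed
  ultimately show "w \<in> \<Union>A - R \<and> u = par w" using J jellyfish_arcs by blast
next
  assume w: "w \<in> \<Union>A - R \<and> u = par w"
  then have Y: "cell w \<in> A" "cell w \<noteq> R" "w \<in> cell w" using cell_in cell_eq_root_iff by auto
  have "(u, w) \<in> parcs (jellyfish G A R)" using w jellyfish_arcs by blast
  moreover have "u \<in> pcell (cell w)" using par_props(1)[of w] w by blast
  ultimately show "(u, w) \<in> parent_child G A R"
    unfolding parent_child_def using pcell_props[OF Y(1,2)] Y by blast
qed

sublocale forest: rooted_forest "\<Union>A" R par cell "\<lambda>y. lev (cell y)"
proof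
  have "\<Union>A \<subseteq> pverts G" using component_cells cell_subset by blast
  then show "finite (\<Union>A)" using pair_finite_verts finite_subset by blast
  show "R \<subseteq> \<Union>A" using root_in by blast
  show "par y \<in> \<Union>A" if "y \<in> \<Union>A - R" for y using par_props(3)[OF that] .
  show "lev (cell y) = Suc (lev (cell (par y)))" if "y \<in> \<Union>A - R" for y using par_props(5)[OF that] .
  show "lev (cell r) = 0" if "r \<in> R" for r using cell_root[OF that] lev_root by simp
  show "lev (cell u) = lev (cell v)" if "cell u = cell v" for u v using that by simp
  show "cell r = cell s" if "r \<in> R" "s \<in> R" for r s using cell_root that by simp
  show "cell (par y) = cell (par z)" if "y \<in> \<Union>A - R" "z \<in> \<Union>A - R" "cell y = cell z" for y z
    using par_props(4) that by simp
  show "card {y \<in> \<Union>A - R. par y = x \<and> cell y = k} = card {y \<in> \<Union>A - R. par y = x' \<and> cell y = k}"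
    if x: "x \<in> \<Union>A" "x' \<in> \<Union>A" "cell x = cell x'" for x x' k
  proof (cases "k \<in> A \<and> k \<noteq> R \<and> pcell k = cell x")
    case True
    then have k: "k \<in> A" "k \<noteq> R" "pcell k = cell x" by auto
    note p = pcell_props[OF k(1,2)]
    obtain t where t: "\<And>x. x \<in> pcell k \<Longrightarrow> card {y \<in> k. proj (pcell k) k y = x} = t"
      using proj_fibre[OF p(3,5)] by metis
    have "{y \<in> \<Union>A - R. par y = z \<and> cell y = k} = {y \<in> k. proj (pcell k) k y = z}" for z
    proof (intro set_eqI iffI)
      fix y assume "y \<in> {y \<in> k. proj (pcell k) k y = z}"
      then have y: "y \<in> k" "proj (pcell k) k y = z" by auto
      then have "cell y = k" using cell_eq k(1) by blast
      moreover have "y \<notin> R" using calculation cell_root k(2) by blast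
      ultimately show "y \<in> {y \<in> \<Union>A - R. par y = z \<and> cell y = k}"
        using y k(1) unfolding par_def by auto
    next
      fix y assume "y \<in> {y \<in> \<Union>A - R. par y = z \<and> cell y = k}"
      then show "y \<in> {y \<in> k. proj (pcell k) k y = z}" using cell_in(2)[of y] by (auto simp: par_def)
    qed
    moreover have "x \<in> pcell k" "x' \<in> pcell k" using k(3) cell_in(2) x by auto
    ultimately show ?thesis using t by simp
  next
    case False
    have "{y \<in> \<Union>A - R. par y = z \<and> cell y = k} = {}" if "cell z = cell x" for z
    proof -
      have "k \<in> A \<and> k \<noteq> R \<and> pcell k = cell x" if y: "y \<in> \<Union>A - R" "par y = z" "cell y = k" for y
        using y cell_in(1)[of y] cell_eq_root_iff[of y] par_props(4)[OF y(1)] \<open>cell z = cell x\<close> by auto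
      then show ?thesis using False by blast
    qed
    then show ?thesis using x(3) by (metis (no_types, lifting))
  qed
qed

lemma leg_verts:
  assumes v: "v \<in> R"
  shows "(parent_child G A R)\<^sup>* `` {v} = forest.tree_at v"
proof (intro set_eqI iffI)
  fix y assume "y \<in> (parent_child G A R)\<^sup>* `` {v}"
  then have "(v, y) \<in> (parent_child G A R)\<^sup>*" by blast
  then show "y \<in> forest.tree_at v"
  proof (induction rule: rtrancl_induct)
    case base
    then show ?case using v root_in forest.root_of_root by (auto simp: forest.tree_at_def)
  next
    case (step y z)
    then show ?case using parent_child_iff forest.root_of_par by (auto simp: forest.tree_at_def)
  qed
next
  fix y assume y: "y \<in> forest.tree_at v"
  have "(forest.root_of y, y) \<in> (parent_child G A R)\<^sup>*" if "y \<in> \<Union>A" for y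
    using that
  proof (induction y rule: forest.forest_induct)
    case (root r)
    then show ?case using forest.root_of_root by simp
  next
    case (child y)
    then have "(par y, y) \<in> parent_child G A R" using parent_child_iff by blast
    then show ?case using child forest.root_of_par by (metis rtrancl.rtrancl_into_rtrancl)
  qed
  then show "y \<in> (parent_child G A R)\<^sup>* `` {v}" using y by (auto simp: forest.tree_at_def)
qed

lemma cell_preserved:
  assumes "\<forall>x\<in>L. \<forall>X\<in>P. x \<in> X \<longrightarrow> \<pi> x \<in> X" "L \<subseteq> \<Union>A" "x \<in> L"
  shows "cell (\<pi> x) = cell x"
  using assms cell_in[of x] cell_eq component_cells by blast

lemma par_commute:
  assumes y: "y \<in> \<Union>A - R" and arc: "(\<pi> (par y), \<pi> y) \<in> parcs (jellyfish G A R)" and \<pi>y: "\<pi> y \<in> \<Union>A"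
    and c: "cell (\<pi> y) = cell y" "cell (\<pi> (par y)) = cell (par y)"
  shows "par (\<pi> y) = \<pi> (par y)"
proof -
  have "\<pi> y \<notin> R" using y c(1) cell_eq_root_iff[of y] cell_root by auto
  then have "(\<pi> (par y), \<pi> y) \<notin> head_arcs" using head_arcs_sub by blast
  moreover have "\<not> (\<pi> (par y) \<in> \<Union>A - R \<and> \<pi> y = par (\<pi> (par y)))"
  proof
    assume "\<pi> (par y) \<in> \<Union>A - R \<and> \<pi> y = par (\<pi> (par y))"
    then have "lev (cell (\<pi> (par y))) = Suc (lev (cell (\<pi> y)))"
      using par_props(5)[of "\<pi> (par y)"] by simp
    then show False using par_props(5)[OF y] c by simp
  qed
  ultimately show ?thesis using arc jellyfish_arcs by auto
qed

lemma forest_auts_cells: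
  assumes g: "g \<in> forest.forest_auts" and x: "x \<in> \<Union>A" and X: "X \<in> P" "x \<in> X"
  shows "g x \<in> X"
proof -
  have "X = cell x" using cell_unique[OF X(1) component_cells X(2)] cell_in[OF x] by blast
  moreover have "g x \<in> cell (g x)" using cell_in(2) forest.forest_autsD(4)[OF g] x by blast
  ultimately show ?thesis using forest.forest_autsD(2)[OF g x] by simp
qed

lemma forest_auts_arcs:
  assumes g: "g \<in> forest.forest_auts" and uw: "u \<in> \<Union>A" "w \<in> \<Union>A"
    and head: "(g u, g w) \<in> head_arcs \<longleftrightarrow> (u, w) \<in> head_arcs"
  shows "(g u, g w) \<in> parcs (jellyfish G A R) \<longleftrightarrow> (u, w) \<in> parcs (jellyfish G A R)"
proof -
  note D = forest.forest_autsD[OF g]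
  have "(g y \<in> \<Union>A - R \<and> g x = par (g y)) \<longleftrightarrow> (y \<in> \<Union>A - R \<and> x = par y)" for x y
  proof (cases "y \<in> \<Union>A - R")
    case True
    then show ?thesis using D(3)[OF True] D(4)[of y] D(5)[of y] inj_eq[OF permutes_inj[OF D(1)]] by simp
  next
    case False
    then show ?thesis using D(4)[of y] D(5)[of y] by blast
  qed
  then show ?thesis unfolding jellyfish_arcs using head by simp
qed

lemma head_verts: "pverts (jelly_head G A R) = R"
  by (simp add: jelly_head_def induced_def)

lemma jellyfish_arcs_root: "u \<in> R \<Longrightarrow> w \<in> R \<Longrightarrow> (u, w) \<in> parcs (jellyfish G A R) \<longleftrightarrow> (u, w) \<in> head_arcs"
  unfolding jellyfish_arcs by blast

lemma head_arcs_iff: "u \<in> R \<Longrightarrow> w \<in> R \<Longrightarrow> (u, w) \<in> parcs (jelly_head G A R) \<longleftrightarrow> (u, w) \<in> head_arcs"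
  by (simp add: jelly_head_def induced_def jellyfish_arcs_root)

lemma cell_Aut_jellyfish:
  "cell_Aut (jellyfish G A R) P = {g \<in> forest.forest_auts. forest.head_restrict g \<in> Aut (jelly_head G A R)}"
proof (intro set_eqI iffI)
  let ?J = "jellyfish G A R"
  fix g assume "g \<in> cell_Aut ?J P"
  then have g: "g permutes \<Union>A" "\<forall>u\<in>\<Union>A. \<forall>w\<in>\<Union>A. (g u, g w) \<in> parcs ?J \<longleftrightarrow> (u, w) \<in> parcs ?J"
    "\<forall>x\<in>\<Union>A. \<forall>X\<in>P. x \<in> X \<longrightarrow> g x \<in> X"
    by (auto simp: cell_Aut_def Aut_def pverts_jellyfish)
  have gV: "g x \<in> \<Union>A \<longleftrightarrow> x \<in> \<Union>A" for x using g(1) by (rule permutes_in_image)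
  have c: "cell (g x) = cell x" if "x \<in> \<Union>A" for x by (rule cell_preserved[OF g(3) _ that]) simp
  have "par (g y) = g (par y)" if y: "y \<in> \<Union>A - R" for y
  proof (rule par_commute[OF y])
    have "(par y, y) \<in> parcs ?J" using jellyfish_arcs y by blast
    then show "(g (par y), g y) \<in> parcs ?J" using g(2) par_props(3)[OF y] y by blast
    show "g y \<in> \<Union>A" using gV y by blast
    show "cell (g y) = cell y" "cell (g (par y)) = cell (par y)" using c par_props(3)[OF y] y by blast+
  qed
  then have fa: "g \<in> forest.forest_auts" using g(1) c unfolding forest.forest_auts_def by blast
  have R: "g x \<in> R \<longleftrightarrow> x \<in> R" for x using forest.forest_autsD(5)[OF fa] .
  have "forest.head_restrict g permutes R"
  proof (rule bij_imp_permutes)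
    have "g ` R \<subseteq> R" using R by blast
    moreover have "inj_on g R" using permutes_inj[OF g(1)] by (rule inj_on_subset) simp
    ultimately have "bij_betw g R R"
      using endo_inj_surj[OF cell_finite[OF root_cell]] by (simp add: bij_betw_def)
    then show "bij_betw (forest.head_restrict g) R R"
      by (rule bij_betw_cong[THEN iffD1, rotated]) (simp add: forest.head_restrict_def)
  qed (simp add: forest.head_restrict_def)
  moreover have "(g u, g w) \<in> head_arcs \<longleftrightarrow> (u, w) \<in> head_arcs" if "u \<in> R" "w \<in> R" for u w
  proof -
    have "(g u, g w) \<in> parcs ?J \<longleftrightarrow> (u, w) \<in> parcs ?J" using g(2) that root_in by blast
    then show ?thesis using that R jellyfish_arcs_root by simp
  qed
  ultimately have "forest.head_restrict g \<in> Aut (jelly_head G A R)"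
    using R by (simp add: Aut_def head_verts forest.head_restrict_def head_arcs_iff)
  with fa show "g \<in> {g \<in> forest.forest_auts. forest.head_restrict g \<in> Aut (jelly_head G A R)}" by blast
next
  let ?J = "jellyfish G A R"
  fix g assume "g \<in> {g \<in> forest.forest_auts. forest.head_restrict g \<in> Aut (jelly_head G A R)}"
  then have g: "g \<in> forest.forest_auts" and h: "forest.head_restrict g \<in> Aut (jelly_head G A R)" by auto
  note D = forest.forest_autsD[OF g]
  have hd: "(g u, g w) \<in> head_arcs \<longleftrightarrow> (u, w) \<in> head_arcs" for u w
  proof (cases "u \<in> R \<and> w \<in> R")
    case True
    then show ?thesis
      using h D(5) by (auto simp: Aut_def head_verts forest.head_restrict_def head_arcs_iff)
  next
    case False
    then have "\<not> (g u \<in> R \<and> g w \<in> R)" using D(5) by blast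
    with False show ?thesis using head_arcs_sub by blast
  qed
  have "(g u, g w) \<in> parcs ?J \<longleftrightarrow> (u, w) \<in> parcs ?J" if "u \<in> \<Union>A" "w \<in> \<Union>A" for u w
    using forest_auts_arcs[OF g that hd] .
  then have "g \<in> Aut ?J" using D(1) unfolding Aut_def pverts_jellyfish by blast
  then show "g \<in> cell_Aut ?J P"
    unfolding cell_Aut_def pverts_jellyfish using forest_auts_cells[OF g] by blast
qed

lemma pverts_leg: "v \<in> R \<Longrightarrow> pverts (leg G A R v) = forest.tree_at v"
  by (simp add: leg_def induced_def leg_verts)

lemma leg_arcs:
  assumes "v \<in> R" "u \<in> forest.tree_at v" "w \<in> forest.tree_at v"
  shows "(u, w) \<in> parcs (leg G A R v) \<longleftrightarrow> (u, w) \<in> parcs (jellyfish G A R)"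
  using assms by (simp add: leg_def induced_def leg_verts)

lemma cell_Aut_leg:
  assumes v: "v \<in> R"
  shows "cell_Aut (leg G A R v) P = forest.leg_auts v"
proof (intro set_eqI iffI)
  let ?L = "forest.tree_at v" and ?J = "jellyfish G A R"
  have LV: "?L \<subseteq> \<Union>A" by (auto simp: forest.tree_at_def)
  fix g assume "g \<in> cell_Aut (leg G A R v) P"
  then have g: "g permutes ?L" "\<forall>u\<in>?L. \<forall>w\<in>?L. (g u, g w) \<in> parcs (leg G A R v) \<longleftrightarrow> (u, w) \<in> parcs (leg G A R v)"
    "\<forall>x\<in>?L. \<forall>X\<in>P. x \<in> X \<longrightarrow> g x \<in> X"
    by (auto simp: cell_Aut_def Aut_def pverts_leg[OF v])
  have gL: "g x \<in> ?L \<longleftrightarrow> x \<in> ?L" for x using g(1) by (rule permutes_in_image)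
  have out: "g x = x" if "x \<notin> ?L" for x using permutes_not_in[OF g(1) that] .
  have c: "cell (g x) = cell x" if "x \<in> \<Union>A" for x
    using cell_preserved[OF g(3) LV, of x] out[of x] by (cases "x \<in> ?L") auto
  have par_leg: "par y \<in> ?L \<longleftrightarrow> y \<in> ?L" if "y \<in> \<Union>A - R" for y
    using that par_props(3)[OF that] forest.root_of_par[OF that] by (auto simp: forest.tree_at_def)
  have "par (g y) = g (par y)" if y: "y \<in> \<Union>A - R" for y
  proof (cases "y \<in> ?L")
    case False
    then show ?thesis using out par_leg[OF y] by simp
  next
    case True
    then have p: "par y \<in> ?L" using par_leg[OF y] by simp
    show ?thesis
    proof (rule par_commute[OF y])
      have "(par y, y) \<in> parcs ?J" using jellyfish_arcs y by blast
      then have "(g (par y), g y) \<in> parcs (leg G A R v)" using g(2) leg_arcs[OF v] p True by blast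
      then show "(g (par y), g y) \<in> parcs ?J" using leg_arcs[OF v] gL p True by blast
      show "g y \<in> \<Union>A" using gL True LV by blast
      show "cell (g y) = cell y" "cell (g (par y)) = cell (par y)" using c par_props(3)[OF y] y by blast+
    qed
  qed
  then have "g \<in> forest.forest_auts" using permutes_subset[OF g(1) LV] c unfolding forest.forest_auts_def by blast
  then show "g \<in> forest.leg_auts v" using out by (simp add: forest.leg_auts_def)
next
  let ?L = "forest.tree_at v" and ?J = "jellyfish G A R"
  have LV: "?L \<subseteq> \<Union>A" by (auto simp: forest.tree_at_def)
  fix g assume ga: "g \<in> forest.leg_auts v"
  note D = forest.leg_autsD[OF ga v]
  have perm: "g permutes ?L"
    using forest.forest_autsD(1)[OF D(1)] D(2) unfolding permutes_def by blast
  have "(g u, g w) \<in> parcs (leg G A R v) \<longleftrightarrow> (u, w) \<in> parcs (leg G A R v)" if uw: "u \<in> ?L" "w \<in> ?L" for u w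
  proof -
    have "(g u, g w) \<in> head_arcs \<longleftrightarrow> (u, w) \<in> head_arcs"
      using D(3) forest.forest_autsD(5)[OF D(1)] head_arcs_sub by (metis SigmaE2 subsetD)
    then have "(g u, g w) \<in> parcs ?J \<longleftrightarrow> (u, w) \<in> parcs ?J"
      using forest_auts_arcs[OF D(1)] uw LV by blast
    then show ?thesis using leg_arcs[OF v] uw D(4) by blast
  qed
  then have "g \<in> Aut (leg G A R v)" using perm by (simp add: Aut_def pverts_leg[OF v])
  then show "g \<in> cell_Aut (leg G A R v) P"
    unfolding cell_Aut_def pverts_leg[OF v] using forest_auts_cells[OF D(1)] LV by blast
qed

lemma jellyfish_distinguishing_number:
  assumes v: "v \<in> R"
  shows "\<exists>c. dist_number (jelly_head G A R) \<le> cell_dist_count (leg G A R v) P c"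
    and "cell_dist_number (jellyfish G A R) P =
      (LEAST c. dist_number (jelly_head G A R) \<le> cell_dist_count (leg G A R v) P c)"
proof -
  have perm: "s permutes R" if "s \<in> Aut (jelly_head G A R)" for s
    using that by (simp add: Aut_def head_verts)
  have "id \<in> Aut (jelly_head G A R)" by (simp add: Aut_def permutes_id)
  note * = forest.forest_fewest_colors[OF v perm this]
  show "\<exists>c. dist_number (jelly_head G A R) \<le> cell_dist_count (leg G A R v) P c"
    "cell_dist_number (jellyfish G A R) P =
      (LEAST c. dist_number (jelly_head G A R) \<le> cell_dist_count (leg G A R v) P c)"
    unfolding dist_number_def cell_dist_count_def cell_dist_number_def
      cell_Aut_leg[OF v] cell_Aut_jellyfish pverts_leg[OF v] pverts_jellyfish head_verts
    using * by simp_all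
qed

end

theorem theorem9:
  fixes G :: "'a pair_pre_digraph"
    and A :: "'a set set"
    and R :: "'a set"
    and v :: 'a
  assumes "pair_graph G"
    and "amenable G"
    and "A \<in> anisotropic_components G"
    and "is_root G A R"
    and "v \<in> R"
  shows "(\<exists>c. cell_dist_count (leg G A R v) (stable_partition G) c
              \<ge> dist_number (jelly_head G A R)) \<and>
         cell_dist_number (jellyfish G A R) (stable_partition G) =
           (LEAST c. cell_dist_count (leg G A R v) (stable_partition G) c
                       \<ge> dist_number (jelly_head G A R))"
proof -
  interpret pair_graph G by fact
  interpret amenable_component G A R
    by unfold_locales (use assms in auto)
  show ?thesis using jellyfish_distinguishing_number[OF \<open>v \<in> R\<close>] by blast
qed

end
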